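(* Let $K_1,K_2\subseteq\mathbb{R}^n_q$ and $T\subseteq\mathbb{R}^n_p$ be smooth and strictly convex bodies. Then $$\xi_T(K_1+K_2)\ \ge\ \xi_T(K_1)+\xi_T(K_2),$$ where $\xi_T(K):=\widetilde c_{EHZ}(K\times T)$ for a convex body $K\subset\mathbb{R}^n_q$, and $K_1+K_2=\{a+b:a\in K_1,b\in K_2\}$ is the Minkowski sum.
   Context: A convex body is a compact convex set with non-empty interior; it is smooth if its boundary is smooth, and a smooth body is called strictly convex if it has strictly positive Gauss curvature at every boundary point. $\mathbb{R}^{2n}=\mathbb{R}^n_q\times\mathbb{R}^n_p$ carries $\omega_{st}=\sum dq_i\wedge dp_i$, the standard inner product, and $J(q,p)=(-p,q)$. For a closed curve $\gamma:[0,2\pi]\to\mathbb{R}^{2n}$ the action is $A(\gamma)=\frac12\int_0^{2\pi}\langle J\gamma(t),\dot\gamma(t)\rangle\,dt$. For a smooth convex body $\Sigma\subset\mathbb{R}^{2n}$, a closed characteristic on $\partial\Sigma$ is an embedded circle in $\partial\Sigma$ everywhere tangent to the line bundle $\{(x,\zeta)\in T\partial\Sigma : \omega_{st}(\zeta,\eta)=0\ \text{for all}\ \eta\in T_x\partial\Sigma\}$, and the Ekeland-Hofer-Zehnder capacity is $c_{EHZ}(\Sigma)=\min\{|A(\gamma)| : \gamma \text{ a closed characteristic on }\partial\Sigma\}$. For an arbitrary convex body $\Sigma\subset\mathbb{R}^{2n}$, $\widetilde c_{EHZ}(\Sigma)=\inf\{c_{EHZ}(\Sigma') : \Sigma'\supset\Sigma,\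 \Sigma' \text{ a smooth convex body}\}$; it coincides with $c_{EHZ}$ on smooth convex bodies. *)

theory Defs
  imports "HOL-Analysis.Analysis"
begin

primrec Ck_on :: "nat \<Rightarrow> 'a::real_normed_vector set \<Rightarrow> ('a \<Rightarrow> 'b::real_normed_vector) \<Rightarrow> bool" where
  "Ck_on 0 U f \<longleftrightarrow> continuous_on U f"
| "Ck_on (Suc k) U f \<longleftrightarrow>
     (\<forall>x\<in>U. f differentiable (at x)) \<and> (\<forall>v. Ck_on k U (\<lambda>x. frechet_derivative f (at x) v))"

text \<open>Intended for open \<open>U\<close> in finite dimension.\<close>

definition smooth_on :: "'a::real_normed_vector set \<Rightarrow> ('a \<Rightarrow> 'b::real_normed_vector) \<Rightarrow> bool" where
  "smooth_on U f \<longleftrightarrow> (\<forall>k. Ck_on k U f)"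

definition smooth_hypersurface :: "'a::euclidean_space set \<Rightarrow> bool" where
  "smooth_hypersurface S \<longleftrightarrow>
     (\<forall>x\<in>S. \<exists>U (\<rho> :: 'a \<Rightarrow> real). open U \<and> x \<in> U \<and> smooth_on U \<rho> \<and>
        (\<forall>y\<in>U. frechet_derivative \<rho> (at y) \<noteq> (\<lambda>_. 0)) \<and>
        S \<inter> U = {y\<in>U. \<rho> y = 0})"

definition tangent_space :: "'a::euclidean_space set \<Rightarrow> 'a \<Rightarrow> 'a set" where
  "tangent_space S x =
     {v. \<exists>c \<epsilon>. 0 < \<epsilon> \<and> smooth_on {-\<epsilon><..<\<epsilon>} c \<and> (\<forall>t\<in>{-\<epsilon><..<\<epsilon>}. c t \<in> S) \<and>
         c (0::real) = x \<and> (c has_vector_derivative v) (at 0)}"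

definition convex_body :: "'a::euclidean_space set \<Rightarrow> bool" where
  "convex_body K \<longleftrightarrow> compact K \<and> convex K \<and> interior K \<noteq> {}"

definition smooth_convex_body :: "'a::euclidean_space set \<Rightarrow> bool" where
  "smooth_convex_body K \<longleftrightarrow> convex_body K \<and> smooth_hypersurface (frontier K)"

text \<open>The outer unit normal of a convex body; it is unique at a smooth boundary point.\<close>

definition gauss_map :: "'a::euclidean_space set \<Rightarrow> 'a \<Rightarrow> 'a" where
  "gauss_map K x = (THE u. norm u = 1 \<and> (\<forall>y\<in>K. u \<bullet> (y - x) \<le> 0))"

text \<open>
  The Gauss curvature at \<open>x\<close> is the determinant of the differential of the Gauss map, an
  endomorphism of the tangent space of \<open>frontier K\<close> at \<open>x\<close>. The derivative within
  \<open>frontier K\<close> determines \<open>L\<close> on that tangent space only; requiring \<open>L\<close> to fix the normal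
  vector makes \<open>L\<close> unique and does not change the determinant. In dimension one the
  tangent space is trivial and the curvature is 1.
\<close>

definition gauss_curvature :: "(real ^ 'n) set \<Rightarrow> real ^ 'n \<Rightarrow> real" where
  "gauss_curvature K x =
     det (matrix (THE L. (gauss_map K has_derivative L) (at x within frontier K) \<and>
                         L (gauss_map K x) = gauss_map K x))"

definition smooth_strictly_convex_body :: "(real ^ 'n) set \<Rightarrow> bool" where
  "smooth_strictly_convex_body K \<longleftrightarrow>
     smooth_convex_body K \<and> (\<forall>x\<in>frontier K. gauss_curvature K x > 0)"

text \<open>Phase space consists of the pairs \<open>(q, p)\<close>.\<close>

type_synonym 'n phase = "(real ^ 'n) \<times> (real ^ 'n)"

definition omega_st :: "'n::finite phase \<Rightarrow> 'n phase \<Rightarrow> real" where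
  "omega_st \<zeta> \<eta> = (\<Sum>i\<in>UNIV. fst \<zeta> $ i * snd \<eta> $ i - snd \<zeta> $ i * fst \<eta> $ i)"

definition J :: "'n::finite phase \<Rightarrow> 'n phase" where
  "J z = (- snd z, fst z)"

definition action :: "(real \<Rightarrow> 'n::finite phase) \<Rightarrow> real" where
  "action \<gamma> = (1/2) * integral {0..2*pi} (\<lambda>t. J (\<gamma> t) \<bullet> vector_derivative \<gamma> (at t))"

definition characteristic_line :: "'n::finite phase set \<Rightarrow> 'n phase \<Rightarrow> 'n phase set" where
  "characteristic_line \<Sigma> x =
     {\<zeta> \<in> tangent_space (frontier \<Sigma>) x. \<forall>\<eta> \<in> tangent_space (frontier \<Sigma>) x. omega_st \<zeta> \<eta> = 0}"

text \<open>
  An embedded circle is represented by a smooth regular parametrisation of period \<open>2 * pi\<close> that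
  is injective on a period. The absolute action does not depend on the parametrisation.
\<close>

definition closed_characteristic :: "'n::finite phase set \<Rightarrow> (real \<Rightarrow> 'n phase) \<Rightarrow> bool" where
  "closed_characteristic \<Sigma> \<gamma> \<longleftrightarrow>
     smooth_on UNIV \<gamma> \<and> (\<forall>t. \<gamma> (t + 2*pi) = \<gamma> t) \<and> inj_on \<gamma> {0..<2*pi} \<and>
     (\<forall>t. vector_derivative \<gamma> (at t) \<noteq> 0) \<and>
     (\<forall>t. \<gamma> t \<in> frontier \<Sigma>) \<and>
     (\<forall>t. vector_derivative \<gamma> (at t) \<in> characteristic_line \<Sigma> (\<gamma> t))"

text \<open>Meaningful for smooth convex bodies, where the minimum is attained.\<close>

definition c_EHZ :: "'n::finite phase set \<Rightarrow> real" where
  "c_EHZ \<Sigma> = (LEAST a. a \<in> {\<bar>action \<gamma>\<bar> | \<gamma>. closed_characteristic \<Sigma> \<gamma>})"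

definition c_EHZ_ext :: "'n::finite phase set \<Rightarrow> real" where
  "c_EHZ_ext \<Sigma> = Inf {c_EHZ \<Sigma>' | \<Sigma>'. \<Sigma> \<subseteq> \<Sigma>' \<and> smooth_convex_body \<Sigma>'}"

definition \<xi> :: "(real ^ 'n) set \<Rightarrow> (real ^ 'n::finite) set \<Rightarrow> real" where
  "\<xi> T K = c_EHZ_ext (K \<times> T)"

end

theory Submission
  imports Defs "HOL-Complex_Analysis.Great_Picard"
begin

text \<open>
  The proof is by Clarke duality. Write a closed curve \<open>z\<close> as \<open>z' = J y\<close> and let \<open>h\<close> be the support
  function of a body \<open>\<Sigma>\<close>. For smooth \<open>\<Sigma>\<close> the capacity is the minimum of \<open>(\<integral> h(y))\<^sup>2 / (4 A(z))\<close> over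
  loops of positive action. Indeed closed characteristics attain the value \<open>\<bar>A\<bar>\<close> of this quotient.
  Conversely, maximise \<open>A\<close> under \<open>\<integral> h(y)\<^sup>2 / 2 \<le> 1\<close>; a maximising sequence of curves converges uniformly by
  Arzela-Ascoli, and if \<open>c\<close> minimises \<open>\<integral> H(z - c)\<close>, where \<open>H\<close> is half the squared gauge of \<open>\<Sigma>\<close>, then
  comparing the Fenchel inequality with its equality case shows that \<open>z - c\<close> is a multiple of a closed
  characteristic.

  For a product \<open>K \<times> T\<close> the support function splits, and rescaling the two factors symplectically turns
  the quotient into \<open>(\<integral> h\<^sub>K) (\<integral> h\<^sub>T) / A\<close>. As this is linear in \<open>h\<^sub>K\<close>, its infimum is superadditive in \<open>K\<close>.
\<close>

section \<open>Functions of class \<open>C\<^sup>k\<close>\<close>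

text \<open>All competitors are C^1 curves with continuous \<open>y\<close>, so no weak limit of
  derivatives is available: along a maximising sequence only the curves converge, and the limit
  \<open>z\<close> is a priori merely continuous. Its differentiability has to come out of the
  argument. The first-order condition for \<open>act \<le> maxact * en\<close> is tested with the
  one \<open>y\<close> that would give equality in the Fenchel inequality; it has mean zero because
  \<open>c\<close> minimises over translates. The integrated Fenchel inequality is then sharp, and
  perturbing its argument on \<open>{0..t}\<close> identifies \<open>z t\<close>.

  A product \<open>K \<times> T\<close> has corners, so its capacity is seen only through smooth
  bodies around it. The two sides of the inequality use this differently: a smooth \<open>S\<close>
  around the product with the sum has a minimising loop of its own, and the products with the
  summands are merely tested on that same loop. No minimiser on a product is required.

  The factor 4 in the quotient makes it equal to the action when the length is twice the action, as
  on a closed characteristic; it is also the 4 in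
  \<open>4 * a * b \<le> (a + b)\<^sup>2\<close>.\<close>

lemma Ck_on_SucD:
  assumes "Ck_on (Suc k) U f" "x \<in> U"
  shows "(f has_derivative frechet_derivative f (at x)) (at x)"
  using assms by (simp add: frechet_derivative_works)

lemma Ck_on_SucD2:
  assumes "Ck_on (Suc k) U f"
  shows "Ck_on k U (\<lambda>x. frechet_derivative f (at x) v)"
  using assms by simp

lemma Ck_on_cong:
  assumes "open U" "\<And>x. x \<in> U \<Longrightarrow> f x = g x" "Ck_on k U f"
  shows "Ck_on k U g"
  using assms(2,3)
proof (induction k arbitrary: f g)
  case 0
  then show ?case by (simp cong: continuous_on_cong)
next
  case (Suc k)
  have der: "(g has_derivative frechet_derivative f (at x)) (at x)" if "x \<in> U" for x
    using has_derivative_transform_within_open[OF Ck_on_SucD[OF Suc.prems(2) that] assms(1) that]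
      Suc.prems(1) by blast
  have eq: "frechet_derivative g (at x) = frechet_derivative f (at x)" if "x \<in> U" for x
    using frechet_derivative_at[OF der[OF that]] by simp
  have "Ck_on k U (\<lambda>x. frechet_derivative g (at x) v)" for v
    by (rule Suc.IH[OF _ Ck_on_SucD2[OF Suc.prems(2), of v]]) (simp add: eq)
  then show ?case
    using der by (auto simp: differentiable_def)
qed

lemma Ck_on_SucI:
  assumes "open U" "\<And>x. x \<in> U \<Longrightarrow> (f has_derivative f' x) (at x)"
    and "\<And>v. Ck_on k U (\<lambda>x. f' x v)"
  shows "Ck_on (Suc k) U f"
proof -
  have "f' x = frechet_derivative f (at x)" if "x \<in> U" for x
    using frechet_derivative_at[OF assms(2)[OF that]] .
  then have "Ck_on k U (\<lambda>x. frechet_derivative f (at x) v)" for v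
    by (intro Ck_on_cong[OF assms(1) _ assms(3)[of v]]) simp
  then show ?thesis
    using assms(2) by (auto simp: differentiable_def)
qed

lemma Ck_on_subset: "Ck_on k U f \<Longrightarrow> V \<subseteq> U \<Longrightarrow> Ck_on k V f"
  by (induction k arbitrary: f) (auto intro: continuous_on_subset)

lemma Ck_on_Suc_imp: "Ck_on (Suc k) U f \<Longrightarrow> Ck_on k U f"
proof (induction k arbitrary: f)
  case 0
  then show ?case
    by (auto intro!: continuous_at_imp_continuous_on differentiable_imp_continuous_within)
next
  case (Suc k)
  have "Ck_on k U (\<lambda>x. frechet_derivative f (at x) v)" for v
    using Suc.IH[OF Ck_on_SucD2[OF Suc.prems]] .
  then show ?case using Suc.prems by simp
qed

lemma Ck_on_imp_continuous_on: "Ck_on k U f \<Longrightarrow> continuous_on U f"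
  by (induction k) (simp, metis Ck_on_Suc_imp)

text \<open>Needed because a hypersurface comes with defining functions on small open sets only,
  while the gauge has to be smooth on the whole complement of the origin.\<close>

lemma Ck_on_local:
  assumes "\<And>x. x \<in> U \<Longrightarrow> \<exists>V. open V \<and> x \<in> V \<and> Ck_on k V f"
  shows "Ck_on k U f"
  using assms
proof (induction k arbitrary: f)
  case 0
  then show ?case
    by (force intro: continuous_at_imp_continuous_on simp: continuous_on_eq_continuous_at)
next
  case (Suc k)
  have "f differentiable (at x)" if "x \<in> U" for x
    using Suc.prems[OF that] by auto
  moreover have "Ck_on k U (\<lambda>x. frechet_derivative f (at x) v)" for v
    by (rule Suc.IH) (use Suc.prems in force)
  ultimately show ?case by simp
qed

lemma Ck_on_const: "Ck_on k U (\<lambda>x. c)"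
  by (induction k arbitrary: c) (auto simp: frechet_derivative_const)

lemma Ck_on_bounded_linear:
  assumes "bounded_linear L"
  shows "Ck_on k U L"
proof (cases k)
  case 0
  then show ?thesis
    using assms by (auto simp: linear_continuous_on)
next
  case (Suc m)
  have "(L has_derivative L) (at x)" for x
    using assms by (rule bounded_linear_imp_has_derivative)
  then have "frechet_derivative L (at x) = L" "L differentiable (at x)" for x
    by (metis frechet_derivative_at, auto simp: differentiable_def)
  then show ?thesis
    by (simp add: Suc Ck_on_const)
qed

lemma Ck_on_compose_bounded_linear:
  assumes "bounded_linear L" "open U" "Ck_on k U f"
  shows "Ck_on k U (\<lambda>x. L (f x))"
  using assms(3)
proof (induction k arbitrary: f)
  case 0
  then show ?case
    using bounded_linear.continuous_on[OF assms(1)] by simp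
next
  case (Suc k)
  show ?case
    by (rule Ck_on_SucI[OF assms(2) bounded_linear.has_derivative[OF assms(1) Ck_on_SucD[OF Suc.prems]]
        Suc.IH[OF Ck_on_SucD2[OF Suc.prems]]])
qed

lemma Ck_on_add:
  assumes "open U" "Ck_on k U f" "Ck_on k U g"
  shows "Ck_on k U (\<lambda>x. f x + g x)"
  using assms(2,3)
proof (induction k arbitrary: f g)
  case 0
  then show ?case by (simp add: continuous_on_add)
next
  case (Suc k)
  show ?case
    by (rule Ck_on_SucI[OF assms(1) has_derivative_add[OF Ck_on_SucD[OF Suc.prems(1)] Ck_on_SucD[OF Suc.prems(2)]]
        Suc.IH[OF Ck_on_SucD2[OF Suc.prems(1)] Ck_on_SucD2[OF Suc.prems(2)]]])
qed

lemma Ck_on_sum: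
  assumes "open U" "\<And>i. i \<in> I \<Longrightarrow> Ck_on k U (f i)"
  shows "Ck_on k U (\<lambda>x. \<Sum>i\<in>I. f i x)"
  using assms(2)
  by (induction I rule: infinite_finite_induct) (auto simp: Ck_on_const intro: Ck_on_add[OF assms(1)])

text \<open>Product rule and induction: in each term of the derivative one factor is differentiated,
  and the other has one order to spare.\<close>

lemma Ck_on_bilinear:
  assumes "bounded_bilinear B" "open U" "Ck_on k U f" "Ck_on k U g"
  shows "Ck_on k U (\<lambda>x. B (f x) (g x))"
  using assms(3,4)
proof (induction k arbitrary: f g)
  case 0
  then show ?case
    using bounded_bilinear.continuous_on[OF assms(1)] by simp
next
  case (Suc k)
  show ?case
    by (rule Ck_on_SucI[OF assms(2) bounded_bilinear.FDERIV[OF assms(1) Ck_on_SucD[OF Suc.prems(1)] Ck_on_SucD[OF Suc.prems(2)]]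
        Ck_on_add[OF assms(2) Suc.IH[OF Ck_on_Suc_imp[OF Suc.prems(1)] Ck_on_SucD2[OF Suc.prems(2)]]
          Suc.IH[OF Ck_on_SucD2[OF Suc.prems(1)] Ck_on_Suc_imp[OF Suc.prems(2)]]]])
qed

lemmas Ck_on_mult = Ck_on_bilinear[OF bounded_bilinear_mult]
lemmas Ck_on_scaleR = Ck_on_bilinear[OF bounded_bilinear_scaleR]

lemma Ck_on_inverse:
  fixes f :: "'a::real_normed_vector \<Rightarrow> real"
  assumes "open U" "Ck_on k U f" "\<And>x. x \<in> U \<Longrightarrow> f x \<noteq> 0"
  shows "Ck_on k U (\<lambda>x. inverse (f x))"
  using assms(2)
proof (induction k)
  case 0
  then show ?case
    using assms(3) by (auto intro: continuous_on_inverse)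
next
  case (Suc k)
  note IH = Suc.IH[OF Ck_on_Suc_imp[OF Suc.prems]]
  let ?d = "\<lambda>x v. - (inverse (f x) * frechet_derivative f (at x) v * inverse (f x))"
  have "((\<lambda>x. inverse (f x)) has_derivative ?d x) (at x)" if "x \<in> U" for x
    using Deriv.has_derivative_inverse[OF assms(3)[OF that] Ck_on_SucD[OF Suc.prems that]] .
  moreover have "Ck_on k U (\<lambda>x. ?d x v)" for v
    by (rule Ck_on_compose_bounded_linear[OF bounded_linear_minus[OF bounded_linear_ident] assms(1)
        Ck_on_mult[OF assms(1) Ck_on_mult[OF assms(1) IH Ck_on_SucD2[OF Suc.prems]] IH]])
  ultimately show ?case
    by (intro Ck_on_SucI[OF assms(1)])
qed

text \<open>In the chain rule the direction \<open>g' x v\<close> moves with \<open>x\<close>,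
  whereas \<open>Ck_on\<close> speaks of derivatives in fixed directions. Expanding it in
  \<open>Basis\<close> yields a finite sum of products to which the induction hypothesis
  applies.\<close>

lemma Ck_on_compose:
  fixes f :: "'b::euclidean_space \<Rightarrow> 'c::real_normed_vector"
  assumes "open U" "open V" "\<And>x. x \<in> U \<Longrightarrow> g x \<in> V" "Ck_on k V f" "Ck_on k U g"
  shows "Ck_on k U (\<lambda>x. f (g x))"
  using assms(4,5)
proof (induction k arbitrary: f)
  case 0
  then show ?case
    by (auto intro!: continuous_on_compose2[of V f U g] assms(3))
next
  case (Suc k)
  let ?f' = "\<lambda>y. frechet_derivative f (at y)" and ?g' = "\<lambda>x. frechet_derivative g (at x)"
  have der: "((\<lambda>x. f (g x)) has_derivative (\<lambda>v. ?f' (g x) (?g' x v))) (at x)" if "x \<in> U" for x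
    using has_derivative_compose[OF Ck_on_SucD[OF Suc.prems(2) that] Ck_on_SucD[OF Suc.prems(1) assms(3)[OF that]]] .
  have expand: "(\<Sum>b\<in>Basis. (?g' x v \<bullet> b) *\<^sub>R ?f' (g x) b) = ?f' (g x) (?g' x v)" if "x \<in> U" for x v
  proof -
    have "linear (?f' (g x))"
      using has_derivative_bounded_linear[OF Ck_on_SucD[OF Suc.prems(1) assms(3)[OF that]]]
      by (rule bounded_linear.linear)
    then have "?f' (g x) (\<Sum>b\<in>Basis. (?g' x v \<bullet> b) *\<^sub>R b) = (\<Sum>b\<in>Basis. (?g' x v \<bullet> b) *\<^sub>R ?f' (g x) b)"
      by (simp add: linear_sum linear_scale)
    then show ?thesis by (simp add: euclidean_representation)
  qed
  have "Ck_on k U (\<lambda>x. ?f' (g x) b)" for b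
    by (rule Suc.IH[OF Ck_on_SucD2[OF Suc.prems(1)] Ck_on_Suc_imp[OF Suc.prems(2)]])
  moreover have "Ck_on k U (\<lambda>x. ?g' x v \<bullet> b)" for b v
    by (rule Ck_on_compose_bounded_linear[OF bounded_linear_inner_left assms(1) Ck_on_SucD2[OF Suc.prems(2)]])
  ultimately have "Ck_on k U (\<lambda>x. \<Sum>b\<in>Basis. (?g' x v \<bullet> b) *\<^sub>R ?f' (g x) b)" for v
    by (intro Ck_on_sum[OF assms(1)] Ck_on_scaleR[OF assms(1)])
  then have "Ck_on k U (\<lambda>x. ?f' (g x) (?g' x v))" for v
    by (rule Ck_on_cong[OF assms(1), rotated]) (rule expand)
  with der show ?case
    by (rule Ck_on_SucI[OF assms(1)])
qed

lemma smooth_on_Ck_on: "smooth_on U f \<Longrightarrow> Ck_on k U f"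
  by (simp add: smooth_on_def)

lemma smooth_on_imp_continuous_on: "smooth_on U f \<Longrightarrow> continuous_on U f"
  by (rule Ck_on_imp_continuous_on[OF smooth_on_Ck_on])

lemma smooth_on_has_derivative:
  assumes "smooth_on U f" "x \<in> U"
  shows "(f has_derivative frechet_derivative f (at x)) (at x)"
  by (rule Ck_on_SucD[OF smooth_on_Ck_on[OF assms(1)] assms(2)])

lemma smooth_on_frechet_derivative:
  assumes "smooth_on U f"
  shows "smooth_on U (\<lambda>x. frechet_derivative f (at x) v)"
  unfolding smooth_on_def using Ck_on_SucD2[OF smooth_on_Ck_on[OF assms]] by simp

text \<open>Bootstrapping: each derivative is gained from the previous one.\<close>

lemma smooth_on_ode_solution:
  fixes X :: "'a::euclidean_space \<Rightarrow> 'a"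
  assumes "open I" "open V" "smooth_on V X" "\<And>t. t \<in> I \<Longrightarrow> \<gamma> t \<in> V"
    and der: "\<And>t. t \<in> I \<Longrightarrow> (\<gamma> has_vector_derivative X (\<gamma> t)) (at t)"
  shows "smooth_on I \<gamma>"
  unfolding smooth_on_def
proof
  fix k
  show "Ck_on k I \<gamma>"
  proof (induction k)
    case 0
    show ?case
      using has_vector_derivative_continuous[OF der] by (simp add: continuous_at_imp_continuous_on)
  next
    case (Suc k)
    have "Ck_on k I (\<lambda>t. X (\<gamma> t))"
      by (rule Ck_on_compose[OF assms(1,2,4) smooth_on_Ck_on[OF assms(3)] Suc])
    then have "Ck_on k I (\<lambda>t. v *\<^sub>R X (\<gamma> t))" for v
      by (rule Ck_on_scaleR[OF assms(1) Ck_on_const])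
    then show ?case
      using der unfolding has_vector_derivative_def by (intro Ck_on_SucI[OF assms(1)])
  qed
qed

section \<open>Support function and gauge\<close>

definition support_fn :: "'a::euclidean_space set \<Rightarrow> 'a \<Rightarrow> real" where
  "support_fn D y = (SUP x\<in>D. x \<bullet> y)"

text \<open>The Minkowski functional of \<open>D\<close>, whose unit ball is \<open>D\<close> for a
  closed convex body around the origin.\<close>

definition mgauge :: "'a::euclidean_space set \<Rightarrow> 'a \<Rightarrow> real" where
  "mgauge D x = Inf {r. 0 < r \<and> (1 / r) *\<^sub>R x \<in> D}"

lemma bdd_above_inner_image:
  assumes "compact D"
  shows "bdd_above ((\<lambda>x. x \<bullet> y) ` D)"
  by (intro bounded_imp_bdd_above compact_imp_bounded compact_continuous_image assms continuous_intros)

lemma support_fn_upper: "compact D \<Longrightarrow> x \<in> D \<Longrightarrow> x \<bullet> y \<le> support_fn D y"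
  unfolding support_fn_def by (rule cSUP_upper[OF _ bdd_above_inner_image])

lemma support_fn_least: "D \<noteq> {} \<Longrightarrow> (\<And>x. x \<in> D \<Longrightarrow> x \<bullet> y \<le> c) \<Longrightarrow> support_fn D y \<le> c"
  unfolding support_fn_def by (rule cSUP_least)

lemma support_fn_attained:
  assumes "compact D" "D \<noteq> {}"
  obtains x where "x \<in> D" "support_fn D y = x \<bullet> y"
proof -
  have "continuous_on D (\<lambda>x. x \<bullet> y)" by (intro continuous_intros)
  then obtain x where x: "x \<in> D" "\<And>z. z \<in> D \<Longrightarrow> z \<bullet> y \<le> x \<bullet> y"
    using continuous_attains_sup[OF assms, of "\<lambda>x. x \<bullet> y"]
    by blast
  have "support_fn D y = x \<bullet> y"
    by (intro antisym support_fn_least support_fn_upper assms x)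
  with x(1) that show thesis by blast
qed

lemma support_fn_add_le:
  assumes "compact D" "D \<noteq> {}"
  shows "support_fn D (y + z) \<le> support_fn D y + support_fn D z"
  by (rule support_fn_least[OF assms(2)]) (simp add: inner_add_right add_mono support_fn_upper[OF assms(1)])

lemma support_fn_scaleR:
  assumes "compact D" "D \<noteq> {}" "0 \<le> c"
  shows "support_fn D (c *\<^sub>R y) = c * support_fn D y"
proof -
  obtain x where x: "x \<in> D" "support_fn D y = x \<bullet> y" using support_fn_attained assms(1,2) .
  show ?thesis
  proof (rule antisym)
    show "support_fn D (c *\<^sub>R y) \<le> c * support_fn D y"
      by (rule support_fn_least[OF assms(2)]) (simp add: mult_left_mono assms support_fn_upper)
    show "c * support_fn D y \<le> support_fn D (c *\<^sub>R y)"
      using support_fn_upper[OF assms(1) x(1), of "c *\<^sub>R y"] x(2) by simp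
  qed
qed

lemma support_fn_le_norm:
  assumes "D \<noteq> {}" "\<And>x. x \<in> D \<Longrightarrow> norm x \<le> R"
  shows "support_fn D y \<le> R * norm y"
proof (rule support_fn_least[OF assms(1)])
  fix x assume "x \<in> D"
  have "x \<bullet> y \<le> norm x * norm y" by (rule norm_cauchy_schwarz)
  also have "\<dots> \<le> R * norm y" by (intro mult_right_mono assms \<open>x \<in> D\<close>) simp
  finally show "x \<bullet> y \<le> R * norm y" .
qed

lemma support_fn_diff_le:
  assumes "compact D" "D \<noteq> {}" "\<And>x. x \<in> D \<Longrightarrow> norm x \<le> R"
  shows "\<bar>support_fn D y - support_fn D z\<bar> \<le> R * norm (y - z)"
proof -
  have "support_fn D y - support_fn D z \<le> R * norm (y - z)" for y z
    using support_fn_add_le[OF assms(1,2), of z "y - z"] support_fn_le_norm[of D R "y - z"] assms by auto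
  from this[of y z] this[of z y] show ?thesis by (simp add: norm_minus_commute abs_le_iff)
qed

lemma continuous_on_support_fn:
  assumes "compact D" "D \<noteq> {}"
  shows "continuous_on UNIV (support_fn D)"
proof -
  obtain R where R: "0 < R" "\<And>x. x \<in> D \<Longrightarrow> norm x \<le> R"
    using compact_imp_bounded[OF assms(1)] by (auto simp: bounded_pos)
  have "R-lipschitz_on UNIV (support_fn D)"
    using support_fn_diff_le[OF assms R(2)] R(1) by (intro lipschitz_onI) (auto simp: dist_norm)
  then show ?thesis by (rule lipschitz_on_continuous_on)
qed

lemma support_fn_translate:
  assumes "compact D" "D \<noteq> {}"
  shows "support_fn ((\<lambda>x. x - p) ` D) y = support_fn D y - p \<bullet> y"
proof -
  have "compact ((\<lambda>x. x - p) ` D)"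
    by (intro compact_continuous_image continuous_intros assms)
  then have le: "(x - p) \<bullet> y \<le> support_fn ((\<lambda>x. x - p) ` D) y" if "x \<in> D" for x
    using that by (intro support_fn_upper) auto
  have "support_fn D y \<le> support_fn ((\<lambda>x. x - p) ` D) y + p \<bullet> y"
    using le by (intro support_fn_least assms) (simp add: inner_diff_left algebra_simps)
  moreover have "support_fn ((\<lambda>x. x - p) ` D) y \<le> support_fn D y - p \<bullet> y"
    using assms support_fn_upper[OF assms(1)] by (intro support_fn_least) (auto simp: inner_diff_left)
  ultimately show ?thesis by simp
qed

text \<open>With the origin in the interior, both the support function and the gauge are positive
  off the origin and comparable to the norm. General bodies are translated into this position
  later.\<close>

locale centered_body =
  fixes D :: "'a::euclidean_space set"
  assumes compact: "compact D" and convex: "convex D" and zero_interior: "0 \<in> interior D"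
begin

abbreviation "h \<equiv> support_fn D"
abbreviation "g \<equiv> mgauge D"

lemma zero_mem: "0 \<in> D"
  using zero_interior interior_subset by blast

lemma nonempty: "D \<noteq> {}"
  using zero_mem by blast

lemma inner_ball:
  obtains r where "0 < r" "cball 0 r \<subseteq> D"
  using zero_interior by (meson mem_interior_cball)

lemma outer_ball:
  obtains R where "0 < R" "\<And>x. x \<in> D \<Longrightarrow> norm x \<le> R"
  using compact_imp_bounded[OF compact] by (auto simp: bounded_pos)

lemma h_upper: "x \<in> D \<Longrightarrow> x \<bullet> y \<le> h y"
  by (rule support_fn_upper[OF compact])

lemma h_nonneg: "0 \<le> h y"
  using h_upper[OF zero_mem, of y] by simp

lemma h_ge_norm:
  obtains r where "0 < r" "\<And>y. r * norm y \<le> h y"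
proof -
  obtain r where r: "0 < r" "cball 0 r \<subseteq> D" by (rule inner_ball)
  have "r * norm y \<le> h y" for y
  proof (cases "y = 0")
    case True
    then show ?thesis by (simp add: h_nonneg)
  next
    case False
    have "(r / norm y) *\<^sub>R y \<in> D"
      using r False by (auto intro!: subsetD[OF r(2)])
    from h_upper[OF this, of y] False show ?thesis
      by (simp add: power2_norm_eq_inner[symmetric] power2_eq_square)
  qed
  with r(1) that show thesis by blast
qed

lemma h_pos: "y \<noteq> 0 \<Longrightarrow> 0 < h y"
  using h_ge_norm by (metis mult_pos_pos order_less_le_trans zero_less_norm_iff)

lemma h_continuous: "continuous_on S h"
  using continuous_on_support_fn[OF compact nonempty] continuous_on_subset by blast

lemma h_scaleR: "0 \<le> c \<Longrightarrow> h (c *\<^sub>R y) = c * h y"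
  by (rule support_fn_scaleR[OF compact nonempty])

lemma h_zero: "h 0 = 0"
  using h_scaleR[of 0 0] by simp

lemma h_add_le: "h (y + z) \<le> h y + h z"
  by (rule support_fn_add_le[OF compact nonempty])

lemma scale_mem:
  assumes "x \<in> D" "0 \<le> c" "c \<le> 1"
  shows "c *\<^sub>R x \<in> D"
  using convexD[OF convex assms(1) zero_mem, of c "1 - c"] assms by simp

lemma g_set_nonempty: "\<exists>r. 0 < r \<and> (1 / r) *\<^sub>R x \<in> D"
proof -
  obtain r where r: "0 < r" "cball 0 r \<subseteq> D" by (rule inner_ball)
  have "(r / (norm x + 1)) *\<^sub>R x \<in> cball 0 r"
  proof -
    have "norm x * r \<le> r * (norm x + 1)" using r by (simp add: algebra_simps)
    then show ?thesis using r(1) by (simp add: divide_simps add_nonneg_pos mult.commute)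
  qed
  with r have "(1 / ((norm x + 1) / r)) *\<^sub>R x \<in> D" by auto
  moreover have "0 < (norm x + 1) / r" using r(1) by (simp add: add_nonneg_pos)
  ultimately show ?thesis by blast
qed

lemma g_bdd_below: "bdd_below {r. 0 < r \<and> (1 / r) *\<^sub>R x \<in> D}"
  by (rule bdd_belowI[of _ 0]) auto

lemma g_nonneg: "0 \<le> g x"
  unfolding mgauge_def using g_set_nonempty by (intro cInf_greatest) auto

lemma g_le: "0 < r \<Longrightarrow> (1 / r) *\<^sub>R x \<in> D \<Longrightarrow> g x \<le> r"
  unfolding mgauge_def by (intro cInf_lower g_bdd_below) simp

lemma g_lessD:
  assumes "g x < r"
  shows "(1 / r) *\<^sub>R x \<in> D"
proof -
  obtain s where s: "0 < s" "(1 / s) *\<^sub>R x \<in> D" "s < r"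
    using assms g_set_nonempty[of x] unfolding mgauge_def
    by (subst (asm) cInf_less_iff[OF _ g_bdd_below]) auto
  from scale_mem[OF s(2), of "s / r"] s show ?thesis by simp
qed

text \<open>Closedness of \<open>D\<close> makes the infimum attained: let an admissible scale
  decrease to \<open>r\<close>.\<close>

lemma g_le_mem:
  assumes "0 < r" "g x \<le> r"
  shows "(1 / r) *\<^sub>R x \<in> D"
proof -
  have "((\<lambda>s. (1 / s) *\<^sub>R x) \<longlongrightarrow> (1 / r) *\<^sub>R x) (at_right r)"
    using assms by (intro tendsto_intros) auto
  moreover have "\<forall>\<^sub>F s in at_right r. (1 / s) *\<^sub>R x \<in> D"
    using assms by (auto simp: eventually_at_right_field intro!: exI[of _ "r + 1"] g_lessD)
  ultimately show ?thesis
    using Lim_in_closed_set[OF compact_imp_closed[OF compact]] by (metis trivial_limit_at_right_real)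
qed

lemma mem_iff_g: "x \<in> D \<longleftrightarrow> g x \<le> 1"
  using g_le[of 1 x] g_le_mem[of 1 x] by auto

text \<open>The Cauchy-Schwarz inequality for the dual pair of gauge and support function.\<close>

lemma inner_le_g_h: "x \<bullet> y \<le> g x * h y"
proof -
  have "x \<bullet> y \<le> r * h y" if "g x < r" for r
  proof -
    have "0 < r" using that g_nonneg[of x] by linarith
    then show ?thesis
      using h_upper[OF g_lessD[OF that], of y] by (simp add: field_simps)
  qed
  then show ?thesis
  proof (cases "h y = 0")
    case True
    with \<open>\<And>r. g x < r \<Longrightarrow> x \<bullet> y \<le> r * h y\<close>[of "g x + 1"] show ?thesis by simp
  next
    case False
    then have hp: "0 < h y" using h_nonneg[of y] by simp
    have "x \<bullet> y / h y \<le> g x"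
      by (rule dense_ge) (use hp \<open>\<And>r. g x < r \<Longrightarrow> x \<bullet> y \<le> r * h y\<close> in \<open>simp add: field_simps\<close>)
    with hp show ?thesis by (simp add: field_simps)
  qed
qed

lemma g_pos: "x \<noteq> 0 \<Longrightarrow> 0 < g x"
proof -
  assume "x \<noteq> 0"
  have "0 < x \<bullet> x" using \<open>x \<noteq> 0\<close> by simp
  also have "\<dots> \<le> g x * h x" by (rule inner_le_g_h)
  finally show ?thesis using g_nonneg[of x] by (cases "g x = 0") auto
qed

lemma g_zero: "g 0 = 0"
proof -
  have "g 0 \<le> e" if "0 < e" for e using g_le[OF that, of 0] zero_mem by simp
  then have "g 0 \<le> 0" by (rule dense_ge)
  then show ?thesis using g_nonneg[of 0] by simp
qed

lemma g_scaleR: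
  assumes "0 \<le> c"
  shows "g (c *\<^sub>R x) = c * g x"
proof (cases "c = 0")
  case True
  then show ?thesis by (simp add: g_zero)
next
  case False
  have le: "g (c *\<^sub>R x) \<le> c * g x" if "0 < c" for c x
  proof -
    have "g (c *\<^sub>R x) / c \<le> g x"
    proof (rule dense_ge)
      fix r assume r: "g x < r"
      then have "0 < r" using g_nonneg[of x] by linarith
      then have "g (c *\<^sub>R x) \<le> c * r"
        using g_lessD[OF r] that by (intro g_le) auto
      then show "g (c *\<^sub>R x) / c \<le> r" using that by (simp add: field_simps)
    qed
    then show ?thesis using that by (simp add: field_simps)
  qed
  have "g x \<le> (1 / c) * g (c *\<^sub>R x)"
    using le[of "1 / c" "c *\<^sub>R x"] False assms by simp
  then show ?thesis using le[of c x] False assms by (simp add: field_simps)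
qed

lemma g_add_le: "g (x + y) \<le> g x + g y"
proof (rule dense_ge)
  fix r assume r: "g x + g y < r"
  \<comment> \<open>The slack is split evenly, so that \<open>s + t = r\<close> and
    \<open>(x + y) / r\<close> is the convex combination of \<open>x / s\<close> and
    \<open>y / t\<close> with weights \<open>s / r\<close> and \<open>t / r\<close>.\<close>
  define e where "e = (r - (g x + g y)) / 2"
  define s t where "s = g x + e" and "t = g y + e"
  have e: "0 < e" "s + t = r" using r by (auto simp: e_def s_def t_def field_simps)
  have pos: "0 < s" "0 < t" using e g_nonneg[of x] g_nonneg[of y] by (auto simp: s_def t_def)
  have "(1 / s) *\<^sub>R x \<in> D" "(1 / t) *\<^sub>R y \<in> D"
    using e by (auto intro!: g_lessD simp: s_def t_def)
  from convexD[OF convex this, of "s / r" "t / r"]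
  have "(1 / r) *\<^sub>R (x + y) \<in> D"
    using pos e by (simp add: add_divide_distrib[symmetric] scaleR_add_right)
  then show "g (x + y) \<le> r" using pos e by (intro g_le) auto
qed

lemma g_le_norm:
  obtains C where "0 < C" "\<And>x. g x \<le> C * norm x"
proof -
  obtain r where r: "0 < r" "cball 0 r \<subseteq> D" by (rule inner_ball)
  have "g x \<le> (1 / r) * norm x" for x
  proof (cases "x = 0")
    case False
    have "(1 / (norm x / r)) *\<^sub>R x \<in> D"
      using r False by (auto intro!: subsetD[OF r(2)])
    from g_le[OF _ this] False r(1) show ?thesis by simp
  qed (simp add: g_zero)
  with r(1) that show thesis by (metis zero_less_divide_1_iff)
qed

lemma g_continuous: "continuous_on S g"
proof -
  obtain C where C: "0 < C" "\<And>x. g x \<le> C * norm x" by (rule g_le_norm) blast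
  have le: "g x - g y \<le> C * norm (x - y)" for x y
    using g_add_le[of y "x - y"] C(2)[of "x - y"] by simp
  have "\<bar>g x - g y\<bar> \<le> C * norm (x - y)" for x y
    using le[of x y] le[of y x] by (simp add: norm_minus_commute[of y x] abs_le_iff)
  then have "C-lipschitz_on UNIV g"
    using C(1) by (intro lipschitz_onI) (auto simp: dist_norm)
  then show ?thesis using lipschitz_on_continuous_on continuous_on_subset by blast
qed

lemma norm_le_g:
  obtains C where "0 < C" "\<And>x. norm x \<le> C * g x"
proof -
  obtain R where R: "0 < R" "\<And>x. x \<in> D \<Longrightarrow> norm x \<le> R" by (rule outer_ball) blast
  have "norm x \<le> R * g x" for x
  proof (cases "x = 0")
    case False
    from R(2)[OF g_le_mem[OF g_pos[OF False] order_refl]] g_pos[OF False] show ?thesis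
      by (simp add: field_simps)
  qed (simp add: g_zero)
  with R(1) that show thesis by blast
qed

lemma frontier_iff_g: "x \<in> frontier D \<longleftrightarrow> g x = 1"
proof
  have "open {y. g y < 1}"
    using g_continuous[of UNIV] by (intro open_Collect_less continuous_intros) auto
  moreover have "{y. g y < 1} \<subseteq> D" by (auto simp: mem_iff_g)
  ultimately have sub: "{y. g y < 1} \<subseteq> interior D" by (rule interior_maximal[rotated])
  assume "x \<in> frontier D"
  then have "x \<in> D" "x \<notin> interior D"
    using compact_imp_closed[OF compact] by (auto simp: frontier_def)
  then show "g x = 1" using sub mem_iff_g[of x] by force
next
  assume x: "g x = 1"
  have "x \<notin> interior D"
  proof
    assume "x \<in> interior D"
    then obtain e where e: "0 < e" "cball x e \<subseteq> D" by (meson mem_interior_cball)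
    have "x \<noteq> 0" using x by (auto simp: g_zero)
    then have "x + (e / norm x) *\<^sub>R x \<in> D"
      using e by (intro subsetD[OF e(2)]) (auto simp: dist_norm)
    moreover have "x + (e / norm x) *\<^sub>R x = (1 + e / norm x) *\<^sub>R x" by (simp add: algebra_simps)
    ultimately have "(1 + e / norm x) * g x \<le> 1"
      using e \<open>x \<noteq> 0\<close> g_scaleR[of "1 + e / norm x" x] by (simp add: mem_iff_g)
    with e \<open>x \<noteq> 0\<close> show False using x by (simp add: field_simps)
  qed
  then show "x \<in> frontier D"
    using x mem_iff_g[of x] by (simp add: frontier_def compact_imp_closed[OF compact])
qed

lemma frontier_normalize: "x \<noteq> 0 \<Longrightarrow> (1 / g x) *\<^sub>R x \<in> frontier D"
  using g_pos[of x] by (simp add: frontier_iff_g g_scaleR)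

end

section \<open>Normals of smooth convex bodies\<close>

text \<open>The subgradient inequalities at \<open>x\<close> and at \<open>y\<close> squeeze the
  remainder between 0 and \<open>(G y - G x) \<bullet> (y - x)\<close>. So a continuous choice of
  subgradients is already the gradient; this serves the gauge, its half square, and the smoothing
  function.\<close>

lemma subgradient_selection_has_derivative:
  fixes f :: "'a::euclidean_space \<Rightarrow> real"
  assumes "\<And>x y. f y \<ge> f x + G x \<bullet> (y - x)" and "isCont G x"
  shows "(f has_derivative (\<lambda>v. G x \<bullet> v)) (at x)"
proof (rule has_derivativeI)
  have *: "norm (f y - f x - G x \<bullet> (y - x)) \<le> norm (G y - G x) * norm (y - x)" for y
  proof -
    have "0 \<le> f y - f x - G x \<bullet> (y - x)"
      using assms(1)[of x y] by simp
    moreover have "f y - f x - G x \<bullet> (y - x) \<le> (G y - G x) \<bullet> (y - x)"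
      using assms(1)[of y x] by (simp add: inner_diff_right inner_diff_left)
    ultimately show ?thesis
      using norm_cauchy_schwarz[of "G y - G x" "y - x"] by simp
  qed
  have "((\<lambda>y. norm (G y - G x)) \<longlongrightarrow> 0) (at x)"
    using assms(2) by (simp add: isCont_def LIM_zero tendsto_norm_zero)
  then show "((\<lambda>y. (f y - f x - G x \<bullet> (y - x)) /\<^sub>R norm (y - x)) \<longlongrightarrow> 0) (at x)"
  proof (rule Lim_null_comparison[rotated])
    show "\<forall>\<^sub>F y in at x. norm ((f y - f x - G x \<bullet> (y - x)) /\<^sub>R norm (y - x)) \<le> norm (G y - G x)"
      using * by (auto simp: eventually_at_filter field_simps)
  qed
qed (rule bounded_linear_inner_right)

context centered_body
begin

text \<open>Separate \<open>x\<close> from the open gauge ball and divide by the value at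
  \<open>x\<close>; homogeneity turns the bound on the ball into a bound by
  \<open>g\<close>.\<close>

lemma normal_exists_frontier:
  assumes "g x = 1"
  obtains n where "n \<bullet> x = 1" "\<And>y. n \<bullet> y \<le> g y"
proof -
  let ?S = "{y. g y < 1}"
  have "convex ?S"
  proof (rule convexI)
    fix y z u v :: real and a b :: 'a
    assume "a \<in> ?S" "b \<in> ?S" and uv: "0 \<le> u" "0 \<le> v" "u + v = 1"
    then have ab: "g a < 1" "g b < 1" by auto
    have "g (u *\<^sub>R a + v *\<^sub>R b) \<le> u * g a + v * g b"
      using g_add_le[of "u *\<^sub>R a" "v *\<^sub>R b"] uv by (simp add: g_scaleR)
    also have "\<dots> < 1" by (rule convex_bound_lt[OF ab uv])
    finally show "u *\<^sub>R a + v *\<^sub>R b \<in> ?S" by simp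
  qed
  moreover have "?S \<noteq> {}" using g_zero by (auto intro!: exI[of _ 0])
  ultimately obtain a b where a: "a \<noteq> 0" "\<And>y. g y < 1 \<Longrightarrow> a \<bullet> y \<le> b" "b \<le> a \<bullet> x"
    using separating_hyperplane_sets[of ?S "{x}"] assms by auto
  have le: "a \<bullet> y \<le> r * (a \<bullet> x)" if "g y < r" for y r
  proof -
    have r: "0 < r" using that g_nonneg[of y] by linarith
    with that have "g ((1 / r) *\<^sub>R y) < 1" by (simp add: g_scaleR)
    from a(2)[OF this] a(3) have "a \<bullet> ((1 / r) *\<^sub>R y) \<le> a \<bullet> x" by linarith
    with r show ?thesis by (simp add: field_simps)
  qed
  have pos: "0 < a \<bullet> x"
  proof -
    have "0 < a \<bullet> a" using a(1) by simp
    also have "\<dots> \<le> (g a + 1) * (a \<bullet> x)" by (rule le) simp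
    finally show ?thesis using g_nonneg[of a] by (simp add: zero_less_mult_iff)
  qed
  show thesis
  proof (rule that)
    show "((1 / (a \<bullet> x)) *\<^sub>R a) \<bullet> x = 1" using pos by simp
    show "((1 / (a \<bullet> x)) *\<^sub>R a) \<bullet> y \<le> g y" for y
      by (rule dense_ge) (use le pos in \<open>simp add: field_simps\<close>)
  qed
qed

lemma normal_exists: "\<exists>n. n \<bullet> x = g x \<and> (\<forall>y. n \<bullet> y \<le> g y)"
proof (cases "x = 0")
  case True
  then show ?thesis by (intro exI[of _ 0]) (simp add: g_zero g_nonneg)
next
  case False
  then have gx: "0 < g x" by (rule g_pos)
  then have "g ((1 / g x) *\<^sub>R x) = 1" by (simp add: g_scaleR)
  then obtain n where "n \<bullet> ((1 / g x) *\<^sub>R x) = 1" "\<And>y. n \<bullet> y \<le> g y"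
    by (rule normal_exists_frontier) blast
  then show ?thesis using gx by (intro exI[of _ n]) (simp add: field_simps)
qed

text \<open>A subgradient of the gauge. On the frontier it is an outer normal scaled by
  \<open>N x \<bullet> x = 1\<close> rather than to unit length, which makes the action integrand
  along a characteristic explicit.\<close>

definition N :: "'a \<Rightarrow> 'a" where
  "N x = (SOME n. n \<bullet> x = g x \<and> (\<forall>y. n \<bullet> y \<le> g y))"

lemma N_inner: "N x \<bullet> x = g x" and N_le: "N x \<bullet> y \<le> g y"
  using someI_ex[OF normal_exists[of x]] by (auto simp: N_def)

lemma h_N_le: "h (N x) \<le> 1"
  using nonempty N_le[of x] mem_iff_g by (intro support_fn_least) (auto simp: inner_commute intro: order_trans)

text \<open>Replaces the implicit function theorem. If \<open>n \<bullet> v\<close> were positive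
  for a tangential \<open>v\<close>, then \<open>\<rho>\<close> would take both signs on the short
  segment of directions \<open>v + \<tau> w\<close>, so some such direction leads to a frontier
  point; there \<open>n\<close> exceeds 1, against \<open>n \<le> g\<close>.\<close>

lemma normal_kernel:
  fixes \<rho> :: "'a \<Rightarrow> real"
  assumes x: "g x = 1" and n: "n \<bullet> x = 1" "\<And>y. n \<bullet> y \<le> g y"
    and U: "open U" "x \<in> U" "continuous_on U \<rho>" "frontier D \<inter> U = {y\<in>U. \<rho> y = 0}"
    and der: "(\<rho> has_derivative \<rho>') (at x)" and w: "0 < \<rho>' w" and v: "\<rho>' v = 0"
  shows "n \<bullet> v \<le> 0"
proof (rule ccontr)
  assume "\<not> n \<bullet> v \<le> 0"
  then have nv: "0 < n \<bullet> v" by simp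
  have lin: "linear \<rho>'" using der has_derivative_linear by blast
  \<comment> \<open>A tilt by at most \<open>\<delta>\<close> along \<open>w\<close> cannot cancel
    \<open>n \<bullet> v\<close>.\<close>
  define \<delta> where "\<delta> = (n \<bullet> v) / (2 * (\<bar>n \<bullet> w\<bar> + 1))"
  have d: "0 < \<delta>" "\<delta> * \<bar>n \<bullet> w\<bar> < n \<bullet> v"
    using nv by (auto simp: \<delta>_def field_simps intro: add_pos_nonneg)
  have rho0: "\<rho> x = 0" using U x frontier_iff_g by blast
  have D: "((\<lambda>s. \<rho> (x + s *\<^sub>R u)) has_real_derivative \<rho>' u) (at 0)" for u
  proof -
    have "((\<lambda>s::real. x + s *\<^sub>R u) has_derivative (\<lambda>s. s *\<^sub>R u)) (at 0)"
      by (auto intro!: derivative_eq_intros)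
    from has_derivative_compose[OF this, of \<rho> \<rho>'] der
    have "((\<lambda>s. \<rho> (x + s *\<^sub>R u)) has_derivative (\<lambda>s. \<rho>' (s *\<^sub>R u))) (at 0)" by simp
    then show ?thesis
      by (simp add: has_field_derivative_def linear_scale[OF lin] mult_commute_abs)
  qed
  have pm: "\<rho>' (v + \<delta> *\<^sub>R w) > 0" "\<rho>' (v + (- \<delta>) *\<^sub>R w) < 0"
    using w v d by (simp_all only: linear_add[OF lin] linear_scale[OF lin]) auto
  obtain s1 where s1: "s1 > 0" "\<And>s. 0 < s \<Longrightarrow> s < s1 \<Longrightarrow> 0 < \<rho> (x + s *\<^sub>R (v + \<delta> *\<^sub>R w))"
    using DERIV_pos_inc_right[OF D pm(1)] rho0 by auto
  obtain s2 where s2: "s2 > 0" "\<And>s. 0 < s \<Longrightarrow> s < s2 \<Longrightarrow> \<rho> (x + s *\<^sub>R (v + (- \<delta>) *\<^sub>R w)) < 0"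
    using DERIV_neg_dec_right[OF D pm(2)] rho0 by auto
  obtain e where e: "e > 0" "ball x e \<subseteq> U" using U(1,2) openE by blast
  define M where "M = norm v + \<delta> * norm w + 1"
  have M: "M > 0" using d by (auto simp: M_def intro: add_nonneg_pos)
  \<comment> \<open>Small enough for both sign conditions and for all tilted points to stay in
    \<open>U\<close>.\<close>
  define s where "s = min (min s1 s2) (e / M) / 2"
  have s: "0 < s" "s < s1" "s < s2" "s * M < e"
  proof -
    have pos: "0 < min (min s1 s2) (e / M)" using s1(1) s2(1) e(1) M by simp
    then show "0 < s" "s < s1" "s < s2" by (auto simp: s_def)
    have "m / 2 < m" if "0 < m" for m :: real using that by simp
    from this[OF pos] have "s < min (min s1 s2) (e / M)" unfolding s_def .
    then have "s < e / M" by simp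
    then show "s * M < e" using M by (simp add: field_simps)
  qed
  have inU: "x + s *\<^sub>R (v + \<tau> *\<^sub>R w) \<in> U" if "\<bar>\<tau>\<bar> \<le> \<delta>" for \<tau>
  proof -
    have "norm (v + \<tau> *\<^sub>R w) \<le> norm v + \<bar>\<tau>\<bar> * norm w" by (metis norm_scaleR norm_triangle_ineq)
    also have "\<dots> \<le> M" using that by (simp add: M_def mult_right_mono add.assoc add_increasing2)
    finally have "s * norm (v + \<tau> *\<^sub>R w) < e"
      using s by (meson mult_left_mono less_imp_le order_le_less_trans)
    then show ?thesis using s(1) by (intro subsetD[OF e(2)]) (simp add: dist_norm)
  qed
  have "continuous_on {-\<delta>..\<delta>} (\<lambda>\<tau>. \<rho> (x + s *\<^sub>R (v + \<tau> *\<^sub>R w)))"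
    by (rule continuous_on_compose2[OF U(3)]) (auto intro!: continuous_intros inU)
  from IVT'[OF less_imp_le[OF s2(2)[OF s(1,3)]] less_imp_le[OF s1(2)[OF s(1,2)]] _ this] d(1)
  obtain \<tau> where t: "- \<delta> \<le> \<tau>" "\<tau> \<le> \<delta>" "\<rho> (x + s *\<^sub>R (v + \<tau> *\<^sub>R w)) = 0" by auto
  moreover from t(1,2) have "x + s *\<^sub>R (v + \<tau> *\<^sub>R w) \<in> U" by (intro inU) simp
  ultimately have "x + s *\<^sub>R (v + \<tau> *\<^sub>R w) \<in> frontier D" using U(4) by blast
  then have "n \<bullet> (x + s *\<^sub>R (v + \<tau> *\<^sub>R w)) \<le> 1"
    using n(2)[of "x + s *\<^sub>R (v + \<tau> *\<^sub>R w)"] by (simp add: frontier_iff_g)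
  then have "s * (n \<bullet> v + \<tau> * (n \<bullet> w)) \<le> 0"
    using n(1) by (simp add: inner_add_right)
  then have "n \<bullet> v + \<tau> * (n \<bullet> w) \<le> 0"
    using s(1) by (simp add: mult_le_0_iff)
  moreover have "\<bar>\<tau> * (n \<bullet> w)\<bar> \<le> \<delta> * \<bar>n \<bullet> w\<bar>"
    using t(1,2) unfolding abs_mult by (intro mult_right_mono) simp_all
  ultimately show False using d(2) by linarith
qed

text \<open>Apply the kernel lemma to \<open>v\<close> and \<open>- v\<close>: the normal vanishes
  on the kernel of \<open>\<rho>'\<close>, hence is a multiple of it, and
  \<open>n \<bullet> x = 1\<close> fixes the multiple. This gives uniqueness and an explicit formula
  at once.\<close>

lemma normal_eq:
  fixes \<rho> :: "'a \<Rightarrow> real"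
  assumes x: "g x = 1" and n: "n \<bullet> x = 1" "\<And>y. n \<bullet> y \<le> g y"
    and U: "open U" "x \<in> U" "continuous_on U \<rho>" "frontier D \<inter> U = {y\<in>U. \<rho> y = 0}"
    and der: "(\<rho> has_derivative \<rho>') (at x)" and nz: "\<rho>' \<noteq> (\<lambda>_. 0)"
  shows "\<rho>' x \<noteq> 0" "n \<bullet> v = \<rho>' v / \<rho>' x"
proof -
  have lin: "linear \<rho>'" using der has_derivative_linear by blast
  obtain w0 where "\<rho>' w0 \<noteq> 0" using nz by auto
  then have "\<exists>w. 0 < \<rho>' w"
    using linear_neg[OF lin, of w0] by (intro exI[of _ "if 0 < \<rho>' w0 then w0 else - w0"]) auto
  then obtain w where w: "0 < \<rho>' w" by blast
  have ker: "n \<bullet> v = 0" if "\<rho>' v = 0" for v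
    using normal_kernel[OF x n U der w that] normal_kernel[OF x n U der w, of "- v"] that
    by (simp add: linear_neg[OF lin])
  show nx: "\<rho>' x \<noteq> 0" using ker[of x] n(1) by auto
  have "\<rho>' (v - (\<rho>' v / \<rho>' x) *\<^sub>R x) = 0"
    using nx by (simp add: linear_diff[OF lin] linear_scale[OF lin])
  from ker[OF this] n(1) show "n \<bullet> v = \<rho>' v / \<rho>' x" by (simp add: inner_diff_right)
qed

end

section \<open>Regularity of the gauge and of the normal field\<close>

locale smooth_body = centered_body +
  assumes smooth: "smooth_hypersurface (frontier D)"
begin

text \<open>A subgradient of the gauge at \<open>x\<close> is also one at the radial projection
  \<open>x / g x\<close>, so the formula for frontier normals extends to all
  \<open>x \<noteq> 0\<close>.\<close>

lemma N_local_formula: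
  assumes "x0 \<noteq> 0"
  obtains U \<rho> W where "open U" "smooth_on U (\<rho> :: 'a \<Rightarrow> real)" "open W" "x0 \<in> W" "0 \<notin> W"
    "\<And>x. x \<in> W \<Longrightarrow> (1 / g x) *\<^sub>R x \<in> U"
    "\<And>x. x \<in> W \<Longrightarrow> frechet_derivative \<rho> (at ((1 / g x) *\<^sub>R x)) ((1 / g x) *\<^sub>R x) \<noteq> 0"
    "\<And>x v. x \<in> W \<Longrightarrow> N x \<bullet> v = frechet_derivative \<rho> (at ((1 / g x) *\<^sub>R x)) v
        / frechet_derivative \<rho> (at ((1 / g x) *\<^sub>R x)) ((1 / g x) *\<^sub>R x)"
proof -
  let ?r = "\<lambda>x. (1 / g x) *\<^sub>R x"
  obtain U \<rho> where U: "open U" "?r x0 \<in> U" "smooth_on U (\<rho> :: 'a \<Rightarrow> real)"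
    "\<And>y. y \<in> U \<Longrightarrow> frechet_derivative \<rho> (at y) \<noteq> (\<lambda>_. 0)" "frontier D \<inter> U = {y\<in>U. \<rho> y = 0}"
    using smooth frontier_normalize[OF assms] unfolding smooth_hypersurface_def by meson
  define W where "W = - {0} \<inter> ?r -` U"
  have "continuous_on (- {0}) ?r"
    using g_pos by (intro continuous_intros g_continuous) (auto simp: less_imp_neq[symmetric])
  then have W: "open W"
    unfolding W_def by (rule continuous_open_preimage[OF _ _ U(1)]) (simp add: open_Compl)
  have key: "frechet_derivative \<rho> (at (?r x)) (?r x) \<noteq> 0 \<and>
      N x \<bullet> v = frechet_derivative \<rho> (at (?r x)) v / frechet_derivative \<rho> (at (?r x)) (?r x)"
    if "x \<in> W" for x v
  proof -
    have x: "x \<noteq> 0" "?r x \<in> U" using that by (auto simp: W_def)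
    have gx: "0 < g x" using x(1) by (rule g_pos)
    then have 1: "g (?r x) = 1" by (simp add: g_scaleR)
    have 2: "N x \<bullet> ?r x = 1" using gx N_inner[of x] by simp
    note * = normal_eq[OF 1 2 N_le U(1) x(2) smooth_on_imp_continuous_on[OF U(3)] U(5)
        smooth_on_has_derivative[OF U(3) x(2)] U(4)[OF x(2)]]
    show ?thesis using * by blast
  qed
  show thesis
    by (rule that[OF U(1,3) W]) (use assms U(2) key in \<open>auto simp: W_def\<close>)
qed

text \<open>The local formula involves \<open>x\<close> only through \<open>x / g x\<close> and
  smooth functions, so \<open>N\<close> is as regular as \<open>g\<close>. As \<open>N\<close> is
  also the gradient of \<open>g\<close>, each application gains one order for
  \<open>g\<close>.\<close>

lemma Ck_on_N_inner:
  assumes "Ck_on k (- {0}) g"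
  shows "Ck_on k (- {0}) (\<lambda>x. N x \<bullet> v)"
proof (rule Ck_on_local)
  fix x0 :: 'a assume "x0 \<in> - {0}"
  then have x0: "x0 \<noteq> 0" by simp
  let ?r = "\<lambda>x. (1 / g x) *\<^sub>R x" and ?d = "\<lambda>\<rho> y. frechet_derivative \<rho> (at y) :: 'a \<Rightarrow> real"
  show "\<exists>V. open V \<and> x0 \<in> V \<and> Ck_on k V (\<lambda>x. N x \<bullet> v)"
  proof (rule N_local_formula[OF x0])
    fix U \<rho> W assume U: "open U" and rho: "smooth_on U (\<rho> :: 'a \<Rightarrow> real)"
      and W: "open W" "x0 \<in> W" "0 \<notin> W" "\<And>x. x \<in> W \<Longrightarrow> ?r x \<in> U"
      and nz: "\<And>x. x \<in> W \<Longrightarrow> ?d \<rho> (?r x) (?r x) \<noteq> 0"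
      and eq: "\<And>x v. x \<in> W \<Longrightarrow> N x \<bullet> v = ?d \<rho> (?r x) v / ?d \<rho> (?r x) (?r x)"
  have sub: "W \<subseteq> - {0}" using W(3) by auto
  have "g x \<noteq> 0" if "x \<in> W" for x
    using g_pos[of x] W(3) that by (cases "x = 0") auto
  with W(1) Ck_on_subset[OF assms sub] have "Ck_on k W (\<lambda>x. inverse (g x))"
    by (rule Ck_on_inverse)
  from Ck_on_scaleR[OF W(1) this Ck_on_bounded_linear[OF bounded_linear_ident]]
  have r: "Ck_on k W ?r" by (simp add: inverse_eq_divide)
  have d: "Ck_on k W (\<lambda>x. ?d \<rho> (?r x) b)" for b
    by (rule Ck_on_compose[OF W(1) U W(4) smooth_on_Ck_on[OF smooth_on_frechet_derivative[OF rho]] r])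
  have "Ck_on k W (\<lambda>x. \<Sum>b\<in>Basis. (?r x \<bullet> b) * ?d \<rho> (?r x) b)"
    by (intro Ck_on_sum[OF W(1)] Ck_on_mult[OF W(1)] d
        Ck_on_compose_bounded_linear[OF bounded_linear_inner_left W(1) r])
  moreover have "(\<Sum>b\<in>Basis. (?r x \<bullet> b) * ?d \<rho> (?r x) b) = ?d \<rho> (?r x) (?r x)" if "x \<in> W" for x
  proof -
    have "linear (?d \<rho> (?r x))"
      using smooth_on_has_derivative[OF rho W(4)[OF that]] by (rule has_derivative_linear)
    then have "?d \<rho> (?r x) (\<Sum>b\<in>Basis. (?r x \<bullet> b) *\<^sub>R b) = (\<Sum>b\<in>Basis. (?r x \<bullet> b) * ?d \<rho> (?r x) b)"
      by (simp only: linear_sum linear_scale real_scaleR_def)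
    then show ?thesis by (simp only: euclidean_representation)
  qed
  ultimately have "Ck_on k W (\<lambda>x. ?d \<rho> (?r x) (?r x))"
    by (rule Ck_on_cong[OF W(1), rotated])
  from Ck_on_mult[OF W(1) d Ck_on_inverse[OF W(1) this nz]]
  have "Ck_on k W (\<lambda>x. ?d \<rho> (?r x) v * inverse (?d \<rho> (?r x) (?r x)))" .
  then have "Ck_on k W (\<lambda>x. N x \<bullet> v)"
    by (rule Ck_on_cong[OF W(1), rotated]) (simp add: eq divide_inverse)
  with W(1,2) show "\<exists>V. open V \<and> x0 \<in> V \<and> Ck_on k V (\<lambda>x. N x \<bullet> v)" by (intro exI[of _ W] conjI)
  qed
qed

lemma N_continuous: "continuous_on (- {0}) N"
proof -
  have "Ck_on 0 (- {0}) g" by (simp add: g_continuous)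
  then have "continuous_on (- {0}) (\<lambda>x. N x \<bullet> b)" for b
    using Ck_on_N_inner[of 0 b] by simp
  then show ?thesis by (subst continuous_on_componentwise) blast
qed

lemma g_has_derivative:
  assumes "x \<noteq> 0"
  shows "(g has_derivative (\<lambda>v. N x \<bullet> v)) (at x)"
proof (rule subgradient_selection_has_derivative)
  show "g y \<ge> g x + N x \<bullet> (y - x)" for x y
    using N_le[of x y] N_inner[of x] by (simp add: inner_diff_right)
  show "isCont N x"
    using N_continuous assms by (simp add: continuous_on_eq_continuous_at open_Compl)
qed

lemma g_smooth: "smooth_on (- {0}) g"
  unfolding smooth_on_def
proof
  fix k show "Ck_on k (- {0}) g"
  proof (induction k)
    case (Suc k)
    have "open (- {0::'a})" by (simp add: open_Compl)
    then show ?case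
      by (rule Ck_on_SucI[where f' = "\<lambda>x v. N x \<bullet> v"]) (simp_all add: g_has_derivative Ck_on_N_inner[OF Suc])
  qed (simp add: g_continuous)
qed

lemma N_smooth: "smooth_on (- {0}) N"
  unfolding smooth_on_def
proof
  fix k
  have o: "open (- {0::'a})" by (simp add: open_Compl)
  have "Ck_on k (- {0}) (\<lambda>x. \<Sum>b\<in>Basis. (N x \<bullet> b) *\<^sub>R b)"
    by (intro Ck_on_sum[OF o] Ck_on_scaleR[OF o _ Ck_on_const] Ck_on_N_inner smooth_on_Ck_on[OF g_smooth])
  then show "Ck_on k (- {0}) N" by (simp add: euclidean_representation)
qed

end

section \<open>Loops and their action\<close>

lemma linear_J: "linear J"
  by (rule linearI) (simp_all add: J_def)

lemma bounded_linear_J: "bounded_linear J"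
  using linear_J by (simp add: linear_linear)

lemma J_J: "J (J z) = - z"
  by (simp add: J_def prod_eq_iff)

lemma J_inner: "J x \<bullet> y = - (x \<bullet> J y)"
  by (simp add: J_def inner_prod_def inner_commute)

lemma J_inner_self: "x \<bullet> J x = 0"
  using J_inner[of x x] by (simp add: inner_commute)

lemma norm_J: "norm (J x) = norm x"
  using J_inner[of x "J x"] by (simp add: J_J norm_eq_sqrt_inner)

lemmas J_simps = linear_add[OF linear_J] linear_diff[OF linear_J] linear_scale[OF linear_J]
  linear_neg[OF linear_J] linear_0[OF linear_J]

lemma continuous_on_J [continuous_intros]: "continuous_on S f \<Longrightarrow> continuous_on S (\<lambda>x. J (f x))"
  by (rule bounded_linear.continuous_on[OF bounded_linear_J])

lemma integral_J: "f integrable_on S \<Longrightarrow> integral S (\<lambda>x. J (f x)) = J (integral S f)"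
  using integral_linear[OF _ bounded_linear_J, of f S] by (simp add: o_def)

lemma integral_inner_right:
  "f integrable_on S \<Longrightarrow> integral S (\<lambda>x. c \<bullet> f x) = c \<bullet> integral S f"
  using integral_linear[OF _ bounded_linear_inner_right, of f S c] by (simp add: o_def)

text \<open>A closed curve is encoded by \<open>y = - J z'\<close>, up to translation.\<close>

definition prim :: "(real \<Rightarrow> 'n::finite phase) \<Rightarrow> real \<Rightarrow> 'n phase" where
  "prim y t = integral {0..t} (\<lambda>s. J (y s))"

text \<open>Mean zero of \<open>y\<close> is closedness of the curve \<open>prim y\<close>;
  continuity of \<open>y\<close> makes that curve C^1.\<close>

definition loop :: "(real \<Rightarrow> 'n::finite phase) \<Rightarrow> bool" where
  "loop y \<longleftrightarrow> continuous_on {0..1} y \<and> integral {0..1} y = 0"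

definition cross :: "(real \<Rightarrow> 'n::finite phase) \<Rightarrow> (real \<Rightarrow> 'n phase) \<Rightarrow> real" where
  "cross y v = integral {0..1} (\<lambda>t. prim y t \<bullet> v t)"

text \<open>For \<open>z' = J y\<close> the integrand \<open>J z \<bullet> z'\<close> of the action
  equals \<open>z \<bullet> y\<close>, because \<open>J\<close> is an isometry. Mean zero of
  \<open>y\<close> makes the base point of \<open>z\<close> immaterial.\<close>

definition act :: "(real \<Rightarrow> 'n::finite phase) \<Rightarrow> real" where
  "act y = cross y y / 2"

lemma loop_continuous: "loop y \<Longrightarrow> continuous_on {0..1} y"
  by (simp add: loop_def)

lemma prim_0: "prim y 0 = 0"
  by (simp add: prim_def)

lemma prim_1: "loop y \<Longrightarrow> prim y 1 = 0"
  unfolding prim_def loop_def by (subst integral_J) (auto intro: integrable_continuous_real simp: J_simps)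

lemma prim_has_vector_derivative:
  assumes "continuous_on {0..1} y" "t \<in> {0..1}"
  shows "(prim y has_vector_derivative J (y t)) (at t within {0..1})"
  unfolding prim_def using assms by (intro integral_has_vector_derivative continuous_intros)

lemma prim_continuous: "continuous_on {0..1} y \<Longrightarrow> continuous_on {0..1} (prim y)"
  by (rule continuous_on_vector_derivative[OF prim_has_vector_derivative])

lemma prim_eqI:
  assumes "\<And>t. t \<in> {0..1} \<Longrightarrow> (z has_vector_derivative J (y t)) (at t within {0..1})" and "t \<in> {0..1}"
  shows "prim y t = z t - z 0"
proof -
  have "((\<lambda>s. J (y s)) has_integral z t - z 0) {0..t}"
    using assms(2) by (intro fundamental_theorem_of_calculus has_vector_derivative_within_subset[OF assms(1)]) auto
  then show ?thesis unfolding prim_def by (rule integral_unique)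
qed

lemma prim_lincomb:
  assumes "continuous_on {0..1} y" "continuous_on {0..1} v" "t \<in> {0..1}"
  shows "prim (\<lambda>s. c *\<^sub>R y s + d *\<^sub>R v s) t = c *\<^sub>R prim y t + d *\<^sub>R prim v t"
proof -
  have "prim (\<lambda>s. c *\<^sub>R y s + d *\<^sub>R v s) t
      = (c *\<^sub>R prim y t + d *\<^sub>R prim v t) - (c *\<^sub>R prim y 0 + d *\<^sub>R prim v 0)"
    by (rule prim_eqI[OF _ assms(3)])
      (auto intro!: derivative_eq_intros prim_has_vector_derivative assms simp: J_simps)
  then show ?thesis by (simp add: prim_0)
qed

lemma prim_diff_le:
  assumes "continuous_on {0..1} y" "0 \<le> s" "s \<le> t" "t \<le> 1" "f integrable_on {s..t}"
    and "\<And>u. u \<in> {s..t} \<Longrightarrow> norm (y u) \<le> f u"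
  shows "norm (prim y t - prim y s) \<le> integral {s..t} f"
proof -
  have c: "continuous_on {0..t} (\<lambda>s. J (y s))"
    using assms by (intro continuous_intros continuous_on_subset[OF assms(1)]) auto
  have "prim y t - prim y s = integral {s..t} (\<lambda>s. J (y s))"
    using Henstock_Kurzweil_Integration.integral_combine[OF assms(2,3) integrable_continuous_real[OF c]] by (simp add: prim_def algebra_simps)
  also have "norm \<dots> \<le> integral {s..t} f"
    by (rule integral_norm_bound_integral[OF integrable_continuous_real[OF continuous_on_subset[OF c]] assms(5)])
      (use assms in \<open>auto simp: norm_J\<close>)
  finally show ?thesis .
qed

lemma integral_y_eq_prim:
  assumes "continuous_on {0..1} y" "t \<in> {0..1}"
  shows "integral {0..t} y = - J (prim y t)"
proof -
  have "y integrable_on {0..t}"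
    using assms by (intro integrable_continuous_real continuous_on_subset[OF assms(1)]) auto
  then show ?thesis by (simp add: prim_def integral_J J_J)
qed

lemma loop_lincomb:
  assumes "loop y" "loop v"
  shows "loop (\<lambda>t. c *\<^sub>R y t + d *\<^sub>R v t)"
proof -
  have "y integrable_on {0..1}" "v integrable_on {0..1}"
    using assms by (auto simp: loop_def intro: integrable_continuous_real)
  then have "integral {0..1} (\<lambda>t. c *\<^sub>R y t + d *\<^sub>R v t) = c *\<^sub>R integral {0..1} y + d *\<^sub>R integral {0..1} v"
    by (simp add: Henstock_Kurzweil_Integration.integral_add integrable_cmul)
  then show ?thesis
    using assms unfolding loop_def by (auto intro!: continuous_intros)
qed

lemma loop_scaleR: "loop y \<Longrightarrow> loop (\<lambda>t. c *\<^sub>R y t)"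
  unfolding loop_def by (auto intro!: continuous_intros)

lemma cross_integrable:
  assumes "continuous_on {0..1} y" "continuous_on {0..1} v"
  shows "(\<lambda>t. prim y t \<bullet> v t) integrable_on {0..1}"
  by (intro integrable_continuous_real continuous_intros prim_continuous assms)

lemma cross_lincomb_left:
  assumes "continuous_on {0..1} y" "continuous_on {0..1} v" "continuous_on {0..1} w"
  shows "cross (\<lambda>s. c *\<^sub>R y s + d *\<^sub>R v s) w = c * cross y w + d * cross v w"
proof -
  have "cross (\<lambda>s. c *\<^sub>R y s + d *\<^sub>R v s) w
      = integral {0..1} (\<lambda>t. c * (prim y t \<bullet> w t) + d * (prim v t \<bullet> w t))"
    unfolding cross_def by (rule integral_cong) (simp add: prim_lincomb assms inner_add_left)
  also have "\<dots> = c * cross y w + d * cross v w"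
    unfolding cross_def
    by (subst Henstock_Kurzweil_Integration.integral_add)
      (simp_all add: cross_integrable assms integrable_on_mult_right)
  finally show ?thesis .
qed

lemma cross_lincomb_right:
  assumes "continuous_on {0..1} y" "continuous_on {0..1} v" "continuous_on {0..1} w"
  shows "cross w (\<lambda>s. c *\<^sub>R y s + d *\<^sub>R v s) = c * cross w y + d * cross w v"
  unfolding cross_def
  by (simp add: inner_add_right Henstock_Kurzweil_Integration.integral_add cross_integrable assms
      integrable_on_mult_right)

text \<open>Integration by parts with \<open>J (prim y) \<bullet> prim v\<close>; the boundary terms
  vanish for loops.\<close>

lemma cross_commute:
  assumes "loop y" "loop v"
  shows "cross y v = cross v y"
proof -
  note cont = loop_continuous[OF assms(1)] loop_continuous[OF assms(2)]
  have "((\<lambda>t. J (prim y t) \<bullet> prim v t) has_vector_derivative (prim y t \<bullet> v t - prim v t \<bullet> y t))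
      (at t within {0..1})" if "t \<in> {0..1}" for t
  proof -
    have "((\<lambda>t. J (prim y t)) has_vector_derivative J (J (y t))) (at t within {0..1})"
      by (rule bounded_linear.has_vector_derivative[OF bounded_linear_J prim_has_vector_derivative[OF cont(1) that]])
    from bounded_bilinear.has_vector_derivative[OF bounded_bilinear_inner this prim_has_vector_derivative[OF cont(2) that]]
    show ?thesis by (simp add: J_J J_inner inner_commute[of "y t"] algebra_simps)
  qed
  then have "((\<lambda>t. prim y t \<bullet> v t - prim v t \<bullet> y t) has_integral
      (J (prim y 1) \<bullet> prim v 1 - J (prim y 0) \<bullet> prim v 0)) {0..1}"
    by (intro fundamental_theorem_of_calculus) auto
  from integral_unique[OF this] show ?thesis
    by (simp add: cross_def Henstock_Kurzweil_Integration.integral_diff cross_integrable cont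
        prim_0 prim_1[OF assms(2)])
qed

lemma act_lincomb:
  assumes "loop y" "loop v"
  shows "act (\<lambda>t. c *\<^sub>R y t + d *\<^sub>R v t) = c\<^sup>2 * act y + c * d * cross y v + d\<^sup>2 * act v"
proof -
  note cont = loop_continuous[OF assms(1)] loop_continuous[OF assms(2)]
  show ?thesis
    unfolding act_def
    by (subst cross_lincomb_left; (intro cont continuous_intros)?)
      (simp add: cross_lincomb_right cont cross_commute[OF assms(2,1)] power2_eq_square algebra_simps)
qed

lemma act_scaleR:
  assumes "loop y"
  shows "act (\<lambda>t. c *\<^sub>R y t) = c\<^sup>2 * act y"
  using act_lincomb[OF assms assms, of c 0] by simp

text \<open>Uniform closeness of the curves, paired with an integral bound on
  \<open>norm (v t)\<close>, controls the action. This is what allows limits in which only the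
  curves converge.\<close>

lemma abs_cross_le:
  assumes "continuous_on {0..1} y" "continuous_on {0..1} v"
    and "\<And>t. t \<in> {0..1} \<Longrightarrow> norm (w t - prim y t) \<le> e" "continuous_on {0..1} w" "0 \<le> e"
  shows "\<bar>integral {0..1} (\<lambda>t. w t \<bullet> v t) - cross y v\<bar> \<le> e * integral {0..1} (\<lambda>t. norm (v t))"
proof -
  have "integral {0..1} (\<lambda>t. w t \<bullet> v t) - cross y v = integral {0..1} (\<lambda>t. (w t - prim y t) \<bullet> v t)"
    unfolding cross_def inner_diff_left
    by (intro Henstock_Kurzweil_Integration.integral_diff[symmetric] cross_integrable integrable_continuous_real continuous_intros assms)
  also have "norm \<dots> \<le> integral {0..1} (\<lambda>t. e * norm (v t))"
  proof (rule integral_norm_bound_integral)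
    show "norm ((w t - prim y t) \<bullet> v t) \<le> e * norm (v t)" if "t \<in> {0..1}" for t
      using Cauchy_Schwarz_ineq2[of "w t - prim y t" "v t"] assms(3)[OF that]
        mult_right_mono[of "norm (w t - prim y t)" e "norm (v t)"] by simp
  qed (intro integrable_continuous_real continuous_intros prim_continuous assms)+
  finally show ?thesis by simp
qed

lemma exists_loop_act_pos: "\<exists>y :: real \<Rightarrow> 'n::finite phase. loop y \<and> 0 < act y"
proof -
  obtain e :: "'n phase" where e: "e \<in> Basis" using nonempty_Basis by blast
  \<comment> \<open>A polynomial loop in the plane of \<open>e\<close> and \<open>J e\<close>. The
    constant 1/6 is the mean of \<open>t - t\<^sup>2\<close>, so both coefficients have mean zero;
    \<open>z\<close> is the primitive of \<open>J y\<close> from 0.\<close>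
  define y where "y t = (1 - 2*t) *\<^sub>R e + (t - t\<^sup>2 - 1/6) *\<^sub>R J e" for t :: real
  define z where "z t = (t - t\<^sup>2) *\<^sub>R J e - (t\<^sup>2/2 - t^3/3 - t/6) *\<^sub>R e" for t :: real
  have cont: "continuous_on {0..1} y" unfolding y_def by (intro continuous_intros)
  have "(z has_vector_derivative J (y t)) (at t within {0..1})" for t
    unfolding y_def z_def
    by (auto intro!: derivative_eq_intros simp: J_simps J_J algebra_simps power2_eq_square)
  then have prim: "prim y t = z t" if "t \<in> {0..1}" for t
    using prim_eqI[of z y t] that by (simp add: z_def)
  have "integral {0..1} y = 0"
    using integral_y_eq_prim[OF cont, of 1] prim[of 1] by (simp add: z_def J_simps)
  then have "loop y" using cont by (simp add: loop_def)
  have "e \<bullet> e = 1" "J e \<bullet> J e = 1" "e \<bullet> J e = 0" "J e \<bullet> e = 0"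
    using e J_inner_self[of e] J_inner[of e "J e"] by (simp_all add: J_J inner_commute)
  then have "z t \<bullet> y t = (t^2 - 2 * t^3 + t^4) / 3" for t
    unfolding z_def y_def
    by (simp add: inner_add_right inner_diff_left) (simp add: field_simps power2_eq_square power3_eq_cube power4_eq_xxxx)
  then have "cross y y = integral {0..1} (\<lambda>t::real. (t^2 - 2 * t^3 + t^4) / 3)"
    unfolding cross_def by (intro integral_cong) (simp add: prim)
  moreover have "((\<lambda>t::real. (t^2 - 2 * t^3 + t^4) / 3) has_integral
      ((1^3 / 9 - 1^4 / 6 + 1^5 / 15) - (0^3 / 9 - 0^4 / 6 + 0^5 / 15))) {0..1}"
  proof (rule fundamental_theorem_of_calculus)
    fix t :: real
    have "((\<lambda>t. t^3 / 9 - t^4 / 6 + t^5 / 15) has_real_derivative (t^2 - 2 * t^3 + t^4) / 3) (at t within {0..1})"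
      by (auto intro!: derivative_eq_intros simp: field_simps)
    then show "((\<lambda>t. t^3 / 9 - t^4 / 6 + t^5 / 15) has_vector_derivative (t^2 - 2 * t^3 + t^4) / 3) (at t within {0..1})"
      by (simp only: has_real_derivative_iff_has_vector_derivative)
  qed simp
  note integral_unique[OF this]
  ultimately have "cross y y = 1 / 90" by simp
  then have "0 < act y" by (simp add: act_def)
  with \<open>loop y\<close> show ?thesis by blast
qed

section \<open>The maximal action\<close>

context smooth_body
begin

text \<open>The gradient of half the squared gauge. Unlike \<open>N\<close> it is continuous at the
  origin too, so curves through the origin cause no trouble.\<close>

definition P :: "'a \<Rightarrow> 'a" where
  "P x = g x *\<^sub>R N x"

lemma P_inner: "P x \<bullet> x = (g x)\<^sup>2"
  by (simp add: P_def N_inner power2_eq_square)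

lemma P_subgradient: "(g y)\<^sup>2 / 2 \<ge> (g x)\<^sup>2 / 2 + P x \<bullet> (y - x)"
proof -
  have "P x \<bullet> y \<le> g x * g y"
    by (simp add: P_def N_le g_nonneg mult_left_mono)
  moreover have "0 \<le> (g y - g x)\<^sup>2" by simp
  ultimately show ?thesis
    by (simp add: inner_diff_right P_inner power2_diff mult.commute)
qed

lemma h_P_le: "h (P x) \<le> g x"
  using h_N_le[of x] g_nonneg[of x] by (simp add: P_def h_scaleR mult_left_le)

lemma norm_P_le:
  obtains C where "0 < C" "\<And>x. norm (P x) \<le> C * g x"
proof -
  obtain C where C: "0 < C" "\<And>x. g x \<le> C * norm x" by (rule g_le_norm) blast
  have "norm (N x) \<le> C" for x
  proof (cases "N x = 0")
    case False
    have "norm (N x) * norm (N x) \<le> C * norm (N x)"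
      using N_le[of x "N x"] C(2)[of "N x"] by (simp add: dot_square_norm power2_eq_square)
    with False show ?thesis by simp
  qed (use C in simp)
  then have "norm (P x) \<le> C * g x" for x
    using mult_right_mono[of "norm (N x)" C "g x"] g_nonneg[of x] by (simp add: P_def mult.commute)
  with C(1) that show thesis by blast
qed

lemma P_isCont: "isCont P x"
proof (cases "x = 0")
  case True
  obtain C where C: "0 < C" "\<And>x. norm (P x) \<le> C * g x" by (rule norm_P_le) blast
  have "isCont g 0"
    using g_continuous[of UNIV] by (simp add: continuous_on_eq_continuous_at)
  then have "((\<lambda>x. C * g x) \<longlongrightarrow> 0) (at 0)"
    unfolding isCont_def by (auto intro: tendsto_mult_right_zero simp: g_zero)
  then have "(P \<longlongrightarrow> 0) (at 0)"
    by (rule Lim_null_comparison[rotated]) (simp add: C(2))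
  then show ?thesis using True by (simp add: isCont_def P_def g_zero)
next
  case False
  have "continuous_on (- {0}) P"
    unfolding P_def by (intro continuous_intros g_continuous N_continuous)
  with False show ?thesis by (simp add: continuous_on_eq_continuous_at open_Compl)
qed

lemma P_continuous: "continuous_on S P"
  by (simp add: continuous_at_imp_continuous_on P_isCont)

lemma half_g_square_has_derivative: "((\<lambda>x. (g x)\<^sup>2 / 2) has_derivative (\<lambda>v. P x \<bullet> v)) (at x)"
  by (rule subgradient_selection_has_derivative[OF P_subgradient P_isCont])

text \<open>The Fenchel inequality for half the squared gauge and its conjugate, half the squared
  support function, with a weight \<open>a\<close> that will be \<open>maxact\<close>. Equality
  holds at \<open>y = P x / a\<close>.\<close>

lemma young:
  assumes "0 < a"
  shows "x \<bullet> y \<le> (g x)\<^sup>2 / 2 / a + a * ((h y)\<^sup>2 / 2)"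
proof -
  have "0 \<le> (g x - a * h y)\<^sup>2 / (2 * a)" using assms by simp
  also have "\<dots> = (g x)\<^sup>2 / 2 / a + a * ((h y)\<^sup>2 / 2) - g x * h y"
    using assms by (simp add: power2_eq_square field_simps)
  finally show ?thesis using inner_le_g_h[of x y] by linarith
qed

end

locale phase_body = smooth_body D for D :: "'n::finite phase set"
begin

text \<open>The dual energy of Clarke: the Legendre conjugate of half the squared gauge, evaluated
  along \<open>y\<close>.\<close>

definition en :: "(real \<Rightarrow> 'n phase) \<Rightarrow> real" where
  "en y = integral {0..1} (\<lambda>t. (h (y t))\<^sup>2 / 2)"

definition maxact :: real where
  "maxact = Sup (act ` {y. loop y \<and> en y \<le> 1})"

lemma h_comp_continuous: "continuous_on S y \<Longrightarrow> continuous_on S (\<lambda>t. h (y t))"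
  using continuous_on_compose2[OF h_continuous[of UNIV]] by blast

lemma g_comp_continuous: "continuous_on S y \<Longrightarrow> continuous_on S (\<lambda>t. g (y t))"
  using continuous_on_compose2[OF g_continuous[of UNIV]] by blast

lemma P_comp_continuous: "continuous_on S y \<Longrightarrow> continuous_on S (\<lambda>t. P (y t))"
  using continuous_on_compose2[OF P_continuous[of UNIV]] by blast

lemma en_integrable: "continuous_on {s..t::real} y \<Longrightarrow> (\<lambda>t. (h (y t))\<^sup>2 / 2) integrable_on {s..t}"
  by (intro integrable_continuous_real continuous_intros h_comp_continuous) auto

lemma en_nonneg: "continuous_on {0..1} y \<Longrightarrow> 0 \<le> en y"
  unfolding en_def by (intro integral_nonneg en_integrable) auto

lemma en_scaleR: "0 \<le> c \<Longrightarrow> en (\<lambda>t. c *\<^sub>R y t) = c\<^sup>2 * en y"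
  by (simp add: en_def h_scaleR power_mult_distrib flip: integral_mult_right)

lemma en_convex:
  assumes "continuous_on {0..1} y" "continuous_on {0..1} v" "0 \<le> s" "s \<le> 1"
  shows "en (\<lambda>t. (1 - s) *\<^sub>R y t + s *\<^sub>R v t) \<le> (1 - s) * en y + s * en v"
proof -
  have pt: "(h ((1 - s) *\<^sub>R x + s *\<^sub>R w))\<^sup>2 / 2 \<le> (1 - s) * ((h x)\<^sup>2 / 2) + s * ((h w)\<^sup>2 / 2)" for x w
  proof -
    have "h ((1 - s) *\<^sub>R x + s *\<^sub>R w) \<le> (1 - s) * h x + s * h w"
      using h_add_le[of "(1 - s) *\<^sub>R x" "s *\<^sub>R w"] assms by (simp add: h_scaleR)
    then have "(h ((1 - s) *\<^sub>R x + s *\<^sub>R w))\<^sup>2 \<le> ((1 - s) * h x + s * h w)\<^sup>2"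
      by (intro power_mono h_nonneg)
    moreover have "0 \<le> s * (1 - s) * (h x - h w)\<^sup>2" using assms by simp
    ultimately show ?thesis by (simp add: power2_eq_square field_simps)
  qed
  have "en (\<lambda>t. (1 - s) *\<^sub>R y t + s *\<^sub>R v t)
      \<le> integral {0..1} (\<lambda>t. (1 - s) * ((h (y t))\<^sup>2 / 2) + s * ((h (v t))\<^sup>2 / 2))"
    unfolding en_def
    by (intro integral_le pt en_integrable integrable_continuous_real continuous_intros h_comp_continuous assms) auto
  also have "\<dots> = (1 - s) * en y + s * en v"
    unfolding en_def
    by (subst Henstock_Kurzweil_Integration.integral_add)
      (simp_all only: integral_mult_right integrable_on_mult_right en_integrable assms)
  finally show ?thesis .
qed

text \<open>The bound \<open>\<bar>y\<bar> \<le> e \<bar>y\<bar>\<^sup>2 + 1 / (4 e)\<close> replaces the Cauchy-Schwarz inequality for integrals.\<close>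

lemma integral_norm_le:
  obtains K where "0 < K"
    "\<And>y e s t. loop y \<Longrightarrow> en y \<le> 1 \<Longrightarrow> 0 < e \<Longrightarrow> 0 \<le> s \<Longrightarrow> s \<le> t \<Longrightarrow> t \<le> 1 \<Longrightarrow>
      integral {s..t} (\<lambda>t. norm (y t)) \<le> e * K + (t - s) / (4 * e)"
proof -
  obtain r where r: "0 < r" "\<And>y. r * norm y \<le> h y" by (rule h_ge_norm) blast
  have "integral {s..t} (\<lambda>t. norm (y t)) \<le> e * (2 / r\<^sup>2) + (t - s) / (4 * e)"
    if y: "loop y" "en y \<le> 1" and e: "0 < e" and st: "0 \<le> s" "s \<le> t" "t \<le> 1" for y e s t
  proof -
    have cont: "continuous_on {s..t} y"
      by (rule continuous_on_subset[OF loop_continuous[OF y(1)]]) (use st in auto)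
    have pt: "norm x \<le> e * (2 / r\<^sup>2) * ((h x)\<^sup>2 / 2) + 1 / (4 * e)" for x
    proof -
      have "0 \<le> (2 * e * norm x - 1)\<^sup>2 / (4 * e)" using e by simp
      also have "\<dots> = e * (norm x)\<^sup>2 + 1 / (4 * e) - norm x"
        using e by (simp add: power2_eq_square field_simps)
      finally have "norm x \<le> e * (norm x)\<^sup>2 + 1 / (4 * e)" by simp
      moreover have "(norm x)\<^sup>2 \<le> (h x)\<^sup>2 / r\<^sup>2"
        using power_mono[OF r(2)[of x], of 2] r(1) by (simp add: power_mult_distrib field_simps)
      ultimately show ?thesis using mult_left_mono[of "(norm x)\<^sup>2" "(h x)\<^sup>2 / r\<^sup>2" e] e by simp
    qed
    have "integral {s..t} (\<lambda>t. norm (y t)) \<le> integral {s..t} (\<lambda>t. e * (2 / r\<^sup>2) * ((h (y t))\<^sup>2 / 2) + 1 / (4 * e))"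
      by (intro integral_le pt integrable_continuous_real continuous_intros h_comp_continuous cont) auto
    also have "\<dots> = e * (2 / r\<^sup>2) * integral {s..t} (\<lambda>t. (h (y t))\<^sup>2 / 2) + (t - s) / (4 * e)"
      by (subst Henstock_Kurzweil_Integration.integral_add)
        (use st in \<open>simp_all only: integral_mult_right integrable_on_mult_right en_integrable cont
          integrable_const_ivl integral_const_real content_real if_True simp_thms\<close>, simp_all)
    also have "\<dots> \<le> e * (2 / r\<^sup>2) * en y + (t - s) / (4 * e)"
    proof (intro add_right_mono mult_left_mono)
      show "integral {s..t} (\<lambda>t. (h (y t))\<^sup>2 / 2) \<le> en y"
        unfolding en_def
        by (rule integral_subset_le[OF _ en_integrable[OF cont] en_integrable[OF loop_continuous[OF y(1)]]])
          (use st in auto)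
    qed (use e in simp)
    finally show ?thesis
      using y(2) e r(1) mult_left_mono[of "en y" 1 "e * (2 / r\<^sup>2)"] by (simp add: mult_left_mono)
  qed
  moreover have "0 < 2 / r\<^sup>2" using r(1) by simp
  ultimately show thesis using that by blast
qed

lemma integral_norm_bound:
  obtains M where "0 < M" "\<And>y. loop y \<Longrightarrow> en y \<le> 1 \<Longrightarrow> integral {0..1} (\<lambda>t. norm (y t)) \<le> M"
proof -
  obtain K where K: "0 < K"
    "\<And>y e s t. loop y \<Longrightarrow> en y \<le> 1 \<Longrightarrow> 0 < e \<Longrightarrow> 0 \<le> s \<Longrightarrow> s \<le> t \<Longrightarrow> t \<le> 1 \<Longrightarrow>
      integral {s..t} (\<lambda>t. norm (y t)) \<le> e * K + (t - s) / (4 * e)"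
    by (rule integral_norm_le) blast
  have "integral {0..1} (\<lambda>t. norm (y t)) \<le> K + 1 / 4" if "loop y" "en y \<le> 1" for y
    using K(2)[of y 1 0 1] that by simp
  moreover have "0 < K + 1 / 4" using K(1) by simp
  ultimately show thesis using that by blast
qed

lemma norm_prim_le:
  assumes "loop y" "t \<in> {0..1}"
  shows "norm (prim y t) \<le> integral {0..1} (\<lambda>t. norm (y t))"
proof -
  note cont = loop_continuous[OF assms(1)]
  have "norm (prim y t - prim y 0) \<le> integral {0..t} (\<lambda>t. norm (y t))"
    using assms(2) by (intro prim_diff_le[OF cont] integrable_continuous_real continuous_intros
        continuous_on_subset[OF cont]) auto
  also have "\<dots> \<le> integral {0..1} (\<lambda>t. norm (y t))"
    using assms(2) by (intro integral_subset_le integrable_continuous_real continuous_intros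
        continuous_on_subset[OF cont]) auto
  finally show ?thesis by (simp add: prim_0)
qed

lemma bdd_above_act: "bdd_above (act ` {y. loop y \<and> en y \<le> 1})"
proof -
  obtain M where M: "0 < M" "\<And>y. loop y \<Longrightarrow> en y \<le> 1 \<Longrightarrow> integral {0..1} (\<lambda>t. norm (y t)) \<le> M"
    by (rule integral_norm_bound) blast
  have "act y \<le> M * M" if y: "loop y" "en y \<le> 1" for y
  proof -
    note cont = loop_continuous[OF y(1)]
    \<comment> \<open>The zero curve serves as approximation of \<open>prim y\<close>, with error at
      most \<open>M\<close>.\<close>
    have "\<bar>integral {0..1} (\<lambda>t. 0 \<bullet> y t) - cross y y\<bar> \<le> M * integral {0..1} (\<lambda>t. norm (y t))"
      using norm_prim_le[OF y(1)] M(2)[OF y] M(1) by (intro abs_cross_le cont) force+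
    also have "\<dots> \<le> M * M" using M(1) M(2)[OF y] by simp
    finally show ?thesis using M(1) by (simp add: act_def)
  qed
  then show ?thesis by (intro bdd_aboveI[of _ "M * M"]) auto
qed

lemma act_le_maxact: "loop y \<Longrightarrow> en y \<le> 1 \<Longrightarrow> act y \<le> maxact"
  unfolding maxact_def by (intro cSup_upper bdd_above_act) auto

text \<open>Action and energy are both quadratic, so normalise the energy. Dividing by
  \<open>sqrt e\<close> with \<open>e\<close> slightly above \<open>en y\<close> also covers zero
  energy; then \<open>e\<close> decreases to \<open>en y\<close>.\<close>

lemma act_le:
  assumes "loop y"
  shows "act y \<le> maxact * en y"
proof -
  have *: "act y \<le> maxact * e" if e: "en y < e" for e
  proof -
    have pos: "0 < e" using e en_nonneg[OF loop_continuous[OF assms]] by linarith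
    have "en (\<lambda>t. (1 / sqrt e) *\<^sub>R y t) \<le> 1"
      using pos e by (simp add: en_scaleR power_divide)
    then have "(1 / sqrt e)\<^sup>2 * act y \<le> maxact"
      using act_le_maxact[OF loop_scaleR[OF assms]] by (simp only: act_scaleR[OF assms])
    then show ?thesis using pos by (simp add: power_divide field_simps)
  qed
  have "((\<lambda>e. maxact * e) \<longlongrightarrow> maxact * en y) (at_right (en y))"
    by (intro tendsto_intros)
  moreover have "\<forall>\<^sub>F e in at_right (en y). act y \<le> maxact * e"
    using * by (auto simp: eventually_at_right_field intro!: exI[of _ "en y + 1"])
  ultimately show ?thesis by (rule tendsto_lowerbound) simp
qed

lemma maxact_pos: "0 < maxact"
proof -
  obtain y :: "real \<Rightarrow> 'n phase" where y: "loop y" "0 < act y" using exists_loop_act_pos by blast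
  then have "0 < maxact * en y" using act_le[OF y(1)] by linarith
  then show ?thesis using en_nonneg[OF loop_continuous[OF y(1)]] by (simp add: zero_less_mult_iff)
qed

text \<open>The energy bound makes the curves uniformly bounded and equicontinuous, which suffices
  for Arzela-Ascoli. Nothing is said about convergence of \<open>Y\<close> itself.\<close>

lemma maximising_sequence:
  obtains Y z where "\<And>k. loop (Y k)" "\<And>k. en (Y k) \<le> 1" "(\<lambda>k. act (Y k)) \<longlonglongrightarrow> maxact"
    "continuous_on {0..1} z" "z 0 = 0" "z 1 = 0"
    "\<And>e. 0 < e \<Longrightarrow> \<exists>n0. \<forall>k\<ge>n0. \<forall>t\<in>{0..1}. norm (prim (Y k) t - z t) < e"
proof -
  let ?S = "{y. loop y \<and> en y \<le> 1}"
  have "?S \<noteq> {}"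
  proof -
    have "loop (\<lambda>t. 0)" "en (\<lambda>t. 0) \<le> 1" by (simp_all add: loop_def en_def h_zero)
    then show ?thesis by blast
  qed
  have "\<exists>y. loop y \<and> en y \<le> 1 \<and> maxact - 1 / Suc k < act y" for k
  proof -
    have "maxact - 1 / Suc k < maxact" by simp
    then have "\<exists>a\<in>act ` ?S. maxact - 1 / Suc k < a"
      unfolding maxact_def using \<open>?S \<noteq> {}\<close> by (subst (asm) less_cSup_iff[OF _ bdd_above_act]) auto
    then show ?thesis by auto
  qed
  then obtain Y where Y: "\<And>k. loop (Y k)" "\<And>k. en (Y k) \<le> 1" "\<And>k. maxact - 1 / Suc k < act (Y k)"
    by metis
  have lim: "(\<lambda>k. act (Y k)) \<longlonglongrightarrow> maxact"
  proof (rule real_tendsto_sandwich)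
    show "(\<lambda>k. maxact - 1 / Suc k) \<longlonglongrightarrow> maxact"
      using tendsto_diff[OF tendsto_const LIMSEQ_inverse_real_of_nat] by (simp add: inverse_eq_divide)
    show "(\<lambda>k. maxact) \<longlonglongrightarrow> maxact" by simp
    show "\<forall>\<^sub>F k in sequentially. maxact - 1 / Suc k \<le> act (Y k)"
      using Y(3) less_imp_le by (intro always_eventually allI) blast
    show "\<forall>\<^sub>F k in sequentially. act (Y k) \<le> maxact"
      by (intro always_eventually allI act_le_maxact Y)
  qed
  obtain M where M: "0 < M" "\<And>y. loop y \<Longrightarrow> en y \<le> 1 \<Longrightarrow> integral {0..1} (\<lambda>t. norm (y t)) \<le> M"
    by (rule integral_norm_bound) blast
  obtain K where K: "0 < K"
    "\<And>y e s t. loop y \<Longrightarrow> en y \<le> 1 \<Longrightarrow> 0 < e \<Longrightarrow> 0 \<le> s \<Longrightarrow> s \<le> t \<Longrightarrow> t \<le> 1 \<Longrightarrow>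
      integral {s..t} (\<lambda>t. norm (y t)) \<le> e * K + (t - s) / (4 * e)"
    by (rule integral_norm_le) blast
  have diff: "norm (prim (Y k) t - prim (Y k) s) \<le> e * K + (t - s) / (4 * e)"
    if "0 < e" "0 \<le> s" "s \<le> t" "t \<le> 1" for k e s t
  proof -
    note cont = loop_continuous[OF Y(1)[of k]]
    have "norm (prim (Y k) t - prim (Y k) s) \<le> integral {s..t} (\<lambda>t. norm (Y k t))"
      using that by (intro prim_diff_le[OF cont] integrable_continuous_real continuous_intros
          continuous_on_subset[OF cont]) auto
    then show ?thesis using K(2)[OF Y(1,2) that, of k] by linarith
  qed
  obtain z \<sigma> where z: "continuous_on {0..1::real} z" "strict_mono (\<sigma> :: nat \<Rightarrow> nat)"
    "\<And>e. 0 < e \<Longrightarrow> \<exists>n0. \<forall>n x. n \<ge> n0 \<and> x \<in> {0..1} \<longrightarrow> norm (prim (Y (\<sigma> n)) x - z x) < e"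
  proof (rule Arzela_Ascoli[of "{0..1::real}" "\<lambda>k. prim (Y k)" M])
    show "norm (prim (Y n) x) \<le> M" if "x \<in> {0..1}" for n x
      using norm_prim_le[OF Y(1) that, of n] M(2)[OF Y(1,2), of n] by linarith
    fix x e :: real assume "x \<in> {0..1}" "0 < e"
    \<comment> \<open>Makes \<open>\<epsilon> * K\<close> equal to \<open>e / 2\<close>; the radius
      \<open>2 * \<epsilon> * e\<close> below makes the other term
      \<open>\<bar>x - y\<bar> / (4 * \<epsilon>)\<close> less than \<open>e / 2\<close>.\<close>
    define \<epsilon> where "\<epsilon> = e / (2 * K)"
    have eps: "0 < \<epsilon>" "\<epsilon> * K = e / 2" using \<open>0 < e\<close> K(1) by (auto simp: \<epsilon>_def)
    show "\<exists>d>0. \<forall>n y. y \<in> {0..1} \<and> norm (x - y) < d \<longrightarrow> norm (prim (Y n) x - prim (Y n) y) < e"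
    proof (intro exI[of _ "2 * \<epsilon> * e"] conjI allI impI)
      show "0 < 2 * \<epsilon> * e" using eps \<open>0 < e\<close> by simp
      fix n y assume y: "y \<in> {0..1} \<and> norm (x - y) < 2 * \<epsilon> * e"
      have *: "\<bar>x - y\<bar> / (4 * \<epsilon>) < e / 2" using y eps by (simp add: field_simps)
      show "norm (prim (Y n) x - prim (Y n) y) < e"
      proof (cases "x \<le> y")
        case True
        then have "\<bar>x - y\<bar> = y - x" by simp
        note *[unfolded this]
        moreover have "norm (prim (Y n) y - prim (Y n) x) \<le> e / 2 + (y - x) / (4 * \<epsilon>)"
          using diff[OF eps(1) _ True, of n] y \<open>x \<in> {0..1}\<close> eps(2) by simp
        ultimately show ?thesis
          unfolding norm_minus_commute[of "prim (Y n) x"] by linarith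
      next
        case False
        then have "\<bar>x - y\<bar> = x - y" by simp
        note *[unfolded this]
        moreover have "norm (prim (Y n) x - prim (Y n) y) \<le> e / 2 + (x - y) / (4 * \<epsilon>)"
          using diff[OF eps(1), of y x n] False y \<open>x \<in> {0..1}\<close> eps(2) by simp
        ultimately show ?thesis by linarith
      qed
    qed
  qed auto
  have zend: "z x = 0" if x: "x \<in> {0..1}" and p: "\<And>n. prim (Y n) x = 0" for x
  proof (rule ccontr)
    assume "z x \<noteq> 0"
    then obtain n0 where "\<forall>n u. n \<ge> n0 \<and> u \<in> {0..1} \<longrightarrow> norm (prim (Y (\<sigma> n)) u - z u) < norm (z x)"
      using z(3)[of "norm (z x)"] by auto
    then have "norm (prim (Y (\<sigma> n0)) x - z x) < norm (z x)" using x by blast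
    then show False using p by simp
  qed
  show thesis
  proof (rule that[of "\<lambda>k. Y (\<sigma> k)" z])
    show "(\<lambda>k. act (Y (\<sigma> k))) \<longlonglongrightarrow> maxact"
      using LIMSEQ_subseq_LIMSEQ[OF lim z(2)] by (simp add: o_def)
    show "z 0 = 0" "z 1 = 0" by (auto intro!: zend simp: prim_0 prim_1 Y(1))
    show "\<exists>n0. \<forall>k\<ge>n0. \<forall>t\<in>{0..1}. norm (prim (Y (\<sigma> k)) t - z t) < e" if "0 < e" for e
      using z(3)[OF that] by blast
  qed (use Y z in auto)
qed

end

section \<open>Maximisers satisfy the Hamiltonian equation\<close>

lemma eq_zero_if_inner_nonneg:
  fixes y :: "'a::real_inner"
  assumes "\<And>e. 0 \<le> e \<bullet> y"
  shows "y = 0"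
proof -
  have "y \<bullet> y \<le> 0" using assms[of "- y"] by simp
  then have "y \<bullet> y = 0" using inner_ge_zero[of y] by (rule antisym)
  then show ?thesis by simp
qed

context phase_body
begin

abbreviation Hm :: "'n phase \<Rightarrow> real" where
  "Hm x \<equiv> (g x)\<^sup>2 / 2"

lemma Hm_comp_continuous: "continuous_on S y \<Longrightarrow> continuous_on S (\<lambda>t. Hm (y t))"
  by (intro continuous_intros g_comp_continuous) auto

lemma Hm_integrable: "continuous_on {s..t::real} y \<Longrightarrow> (\<lambda>t. Hm (y t)) integrable_on {s..t}"
  by (intro integrable_continuous_real Hm_comp_continuous)

text \<open>At a minimising \<open>c\<close> the gradient \<open>P (z - c)\<close> has mean zero,
  that is, it is an admissible loop. Existence is coercivity together with compactness of a
  ball.\<close>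

lemma exists_min_translate:
  fixes z :: "real \<Rightarrow> 'n phase"
  assumes z: "continuous_on {0..1} z"
  obtains c where "\<And>c'. integral {0..1} (\<lambda>t. Hm (z t - c)) \<le> integral {0..1} (\<lambda>t. Hm (z t - c'))"
proof -
  define \<Phi> where "\<Phi> c = integral {0..1} (\<lambda>t. Hm (z t - c))" for c
  have zc: "continuous_on {0..1} (\<lambda>t. z t - c)" for c by (intro continuous_intros z)
  have "continuous_on (UNIV \<times> {0..1}) (\<lambda>x. z (snd x) - fst x)"
    by (intro continuous_intros continuous_on_compose2[OF z]) auto
  from Hm_comp_continuous[OF this] have "continuous_on UNIV \<Phi>"
    unfolding \<Phi>_def using integral_continuous_on_param[of UNIV 0 1 "\<lambda>c t. Hm (z t - c)"]
    by (simp add: case_prod_beta)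
  moreover obtain B where B: "\<And>t. t \<in> {0..1} \<Longrightarrow> norm (z t) \<le> B"
    using compact_imp_bounded[OF compact_continuous_image[OF z compact_Icc]] unfolding bounded_iff by blast
  obtain C where C: "0 < C" "\<And>x. norm x \<le> C * g x" by (rule norm_le_g) blast
  have pos: "0 \<le> \<Phi> 0" unfolding \<Phi>_def by (intro integral_nonneg Hm_integrable zc) auto
  \<comment> \<open>For \<open>c\<close> beyond this radius the integrand is at least
    \<open>\<Phi> 0\<close> at every single time, so nothing is lost by restricting to the
    ball.\<close>
  define R where "R = B + C * sqrt (2 * \<Phi> 0)"
  have far: "\<Phi> 0 \<le> \<Phi> c" if "R \<le> norm c" for c
  proof -
    have "\<Phi> 0 \<le> Hm (z t - c)" if "t \<in> {0..1}" for t
    proof -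
      have "C * sqrt (2 * \<Phi> 0) \<le> norm (z t - c)"
        using B[OF that] \<open>R \<le> norm c\<close> norm_triangle_ineq2[of c "z t"] by (simp add: R_def norm_minus_commute)
      also have "\<dots> \<le> C * g (z t - c)" by (rule C(2))
      finally have "sqrt (2 * \<Phi> 0) \<le> g (z t - c)" using C(1) by simp
      from power_mono[OF this, of 2] pos show ?thesis by simp
    qed
    then have "integral {0..1::real} (\<lambda>t. \<Phi> 0) \<le> integral {0..1} (\<lambda>t. Hm (z t - c))"
      by (intro integral_le Hm_integrable zc) auto
    then show ?thesis by (simp add: \<Phi>_def)
  qed
  have "0 \<le> R"
    using order_trans[OF norm_ge_zero B[of 0]] C(1) pos by (simp add: R_def)
  then have "\<exists>c\<in>cball 0 R. \<forall>c'\<in>cball 0 R. \<Phi> c \<le> \<Phi> c'"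
    by (intro continuous_attains_inf continuous_on_subset[OF \<open>continuous_on UNIV \<Phi>\<close>]) auto
  then obtain c where c: "\<And>c'. norm c' \<le> R \<Longrightarrow> \<Phi> c \<le> \<Phi> c'"
    by (metis mem_cball_0)
  have "\<Phi> c \<le> \<Phi> c'" for c'
    using c[of c'] c[of 0] far[of c'] \<open>0 \<le> R\<close> by (cases "norm c' \<le> R") auto
  then show thesis using that unfolding \<Phi>_def by blast
qed

lemma P_param_tendsto:
  fixes x :: "real \<Rightarrow> 'n phase"
  assumes x: "continuous_on {0..t} x"
  shows "((\<lambda>s. integral {0..t} (\<lambda>u. P (x u + s *\<^sub>R e) \<bullet> e)) \<longlongrightarrow> integral {0..t} (\<lambda>u. P (x u) \<bullet> e)) (at_right 0)"
proof -
  have "continuous_on (UNIV \<times> {0..t}) (\<lambda>y. x (snd y) + fst y *\<^sub>R e)"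
    by (intro continuous_intros continuous_on_compose2[OF x]) auto
  from P_comp_continuous[OF this]
  have "continuous_on (UNIV \<times> {0..t}) (\<lambda>y. P (x (snd y) + fst y *\<^sub>R e) \<bullet> e)"
    by (intro continuous_intros)
  then have "continuous_on UNIV (\<lambda>s. integral {0..t} (\<lambda>u. P (x u + s *\<^sub>R e) \<bullet> e))"
    using integral_continuous_on_param[of UNIV 0 t "\<lambda>s u. P (x u + s *\<^sub>R e) \<bullet> e"]
    by (simp add: case_prod_beta)
  then have "((\<lambda>s. integral {0..t} (\<lambda>u. P (x u + s *\<^sub>R e) \<bullet> e))
      \<longlongrightarrow> integral {0..t} (\<lambda>u. P (x u + 0 *\<^sub>R e) \<bullet> e)) (at 0)"
    by (simp only: continuous_on_eq_continuous_at[OF open_UNIV] isCont_def UNIV_I)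
  then show ?thesis by (simp add: filterlim_at_split)
qed

text \<open>The subgradient inequality at the shifted point replaces differentiation under the
  integral: only continuity of \<open>P\<close> is then needed to let \<open>s\<close> tend to
  0.\<close>

lemma Hm_increment_le:
  fixes x :: "real \<Rightarrow> 'n phase"
  assumes x: "continuous_on {0..t} x" and s: "0 \<le> s"
  shows "integral {0..t} (\<lambda>u. Hm (x u + s *\<^sub>R e) - Hm (x u))
    \<le> s * integral {0..t} (\<lambda>u. P (x u + s *\<^sub>R e) \<bullet> e)"
proof -
  have pt: "Hm (y + s *\<^sub>R e) - Hm y \<le> s * (P (y + s *\<^sub>R e) \<bullet> e)" for y
    using P_subgradient[of "y + s *\<^sub>R e" y] by simp
  have "integral {0..t} (\<lambda>u. Hm (x u + s *\<^sub>R e) - Hm (x u))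
      \<le> integral {0..t} (\<lambda>u. s * (P (x u + s *\<^sub>R e) \<bullet> e))"
    by (intro integral_le pt integrable_continuous_real continuous_intros g_comp_continuous P_comp_continuous x) auto
  then show ?thesis by simp
qed

end

section \<open>Optimality conditions in the limit of a maximising sequence\<close>

locale maximising_limit = phase_body D for D :: "'n::finite phase set" +
  fixes Y :: "nat \<Rightarrow> real \<Rightarrow> 'n phase" and z :: "real \<Rightarrow> 'n phase" and c :: "'n phase"
  assumes Y_loop: "\<And>k. loop (Y k)" and Y_en: "\<And>k. en (Y k) \<le> 1"
    and Y_act: "(\<lambda>k. act (Y k)) \<longlonglongrightarrow> maxact"
    and z_cont: "continuous_on {0..1} z" and z_0: "z 0 = 0" and z_1: "z 1 = 0"
    and z_lim: "\<And>e. 0 < e \<Longrightarrow> \<exists>n0. \<forall>k\<ge>n0. \<forall>t\<in>{0..1}. norm (prim (Y k) t - z t) < e"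
    and c_min: "\<And>c'. integral {0..1} (\<lambda>t. Hm (z t - c)) \<le> integral {0..1} (\<lambda>t. Hm (z t - c'))"
begin

definition x :: "real \<Rightarrow> 'n phase" where "x t = z t - c"

text \<open>The equality case of \<open>young\<close> with weight \<open>maxact\<close>. It is the
  candidate for \<open>- J z'\<close>, while \<open>z\<close> is not yet known to be
  differentiable.\<close>

definition v :: "real \<Rightarrow> 'n phase" where "v t = (1 / maxact) *\<^sub>R P (x t)"

lemma x_cont: "continuous_on {0..1} x"
  unfolding x_def by (intro continuous_intros z_cont)

lemma Y_cont: "continuous_on {0..1} (Y k)"
  by (rule loop_continuous[OF Y_loop])

text \<open>Allowing \<open>w\<close> to vary with \<open>k\<close> covers both a fixed test loop
  and \<open>Y k\<close> itself, whose norms are bounded only in the mean.\<close>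

lemma z_minus_cross_tendsto:
  assumes w: "\<And>k. continuous_on {0..1} (w k)" "\<And>k. integral {0..1} (\<lambda>t. norm (w k t)) \<le> M"
  shows "(\<lambda>k. integral {0..1} (\<lambda>t. z t \<bullet> w k t) - cross (Y k) (w k)) \<longlonglongrightarrow> 0"
proof (rule LIMSEQ_I)
  fix r :: real assume "0 < r"
  have M: "0 \<le> M"
    using w(2)[of 0] integral_nonneg[of "\<lambda>t. norm (w 0 t)" "{0..1}"] w(1)[of 0]
    by (auto intro!: order_trans[OF _ w(2)[of 0]] integral_nonneg integrable_continuous_real continuous_intros)
  define e where "e = r / (M + 1)"
  have e: "0 < e" "e * M < r" using \<open>0 < r\<close> M by (auto simp: e_def field_simps)
  obtain n0 where n0: "\<forall>k\<ge>n0. \<forall>t\<in>{0..1}. norm (prim (Y k) t - z t) < e" using z_lim[OF e(1)] by blast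
  show "\<exists>n0. \<forall>k\<ge>n0. norm (integral {0..1} (\<lambda>t. z t \<bullet> w k t) - cross (Y k) (w k) - 0) < r"
  proof (intro exI[of _ n0] allI impI)
    fix k assume "n0 \<le> k"
    have "\<bar>integral {0..1} (\<lambda>t. z t \<bullet> w k t) - cross (Y k) (w k)\<bar> \<le> e * integral {0..1} (\<lambda>t. norm (w k t))"
      using n0 \<open>n0 \<le> k\<close> e(1)
      by (intro abs_cross_le Y_cont w z_cont) (auto simp: norm_minus_commute less_imp_le)
    also have "\<dots> \<le> e * M" using w(2) e(1) by simp
    finally show "norm (integral {0..1} (\<lambda>t. z t \<bullet> w k t) - cross (Y k) (w k) - 0) < r" using e(2) by simp
  qed
qed

lemma cross_tendsto:
  assumes "continuous_on {0..1} w"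
  shows "(\<lambda>k. cross (Y k) w) \<longlonglongrightarrow> integral {0..1} (\<lambda>t. z t \<bullet> w t)"
proof -
  have "(\<lambda>k. integral {0..1} (\<lambda>t. z t \<bullet> w t) - cross (Y k) w) \<longlonglongrightarrow> 0"
    by (rule z_minus_cross_tendsto[OF assms order_refl])
  from tendsto_diff[OF tendsto_const this, of "integral {0..1} (\<lambda>t. z t \<bullet> w t)"] show ?thesis by simp
qed

lemma z_Y_tendsto: "(\<lambda>k. integral {0..1} (\<lambda>t. z t \<bullet> Y k t)) \<longlonglongrightarrow> 2 * maxact"
proof -
  obtain M where M: "0 < M" "\<And>y. loop y \<Longrightarrow> en y \<le> 1 \<Longrightarrow> integral {0..1} (\<lambda>t. norm (y t)) \<le> M"
    by (rule integral_norm_bound) blast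
  have "(\<lambda>k. integral {0..1} (\<lambda>t. z t \<bullet> Y k t) - cross (Y k) (Y k)) \<longlonglongrightarrow> 0"
    by (rule z_minus_cross_tendsto[OF Y_cont M(2)[OF Y_loop Y_en]])
  from tendsto_add[OF this tendsto_mult_left[OF Y_act, of 2]] show ?thesis by (simp add: act_def)
qed

lemma prim_Y_tendsto:
  assumes "t \<in> {0..1}"
  shows "(\<lambda>k. prim (Y k) t) \<longlonglongrightarrow> z t"
proof (rule LIMSEQ_I)
  fix r :: real assume "0 < r"
  from z_lim[OF this] assms show "\<exists>n0. \<forall>k\<ge>n0. norm (prim (Y k) t - z t) < r" by blast
qed

text \<open>Apply \<open>act \<le> maxact * en\<close> to \<open>(1 - s) Y k + s w\<close> and use
  convexity of \<open>en\<close>. Letting \<open>k\<close> tend to infinity first cancels the terms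
  of order 0 in \<open>s\<close>; then divide by \<open>s\<close> and let it tend to 0.\<close>

lemma first_order:
  assumes w: "loop w"
  shows "integral {0..1} (\<lambda>t. z t \<bullet> w t) \<le> maxact + maxact * en w"
proof -
  let ?C = "integral {0..1} (\<lambda>t. z t \<bullet> w t)"
  note wc = loop_continuous[OF w]
  have *: "(1 - s) * ?C + s * act w \<le> (1 - s) * maxact + maxact * en w" if s: "0 < s" "s < 1" for s
  proof -
    have "(1 - s)\<^sup>2 * act (Y k) + (1 - s) * s * cross (Y k) w + s\<^sup>2 * act w
        \<le> maxact * ((1 - s) + s * en w)" for k
    proof -
      have "act (\<lambda>t. (1 - s) *\<^sub>R Y k t + s *\<^sub>R w t) \<le> maxact * en (\<lambda>t. (1 - s) *\<^sub>R Y k t + s *\<^sub>R w t)"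
        by (intro act_le loop_lincomb Y_loop w)
      also have "\<dots> \<le> maxact * ((1 - s) * en (Y k) + s * en w)"
        using en_convex[OF Y_cont wc, of s k] s maxact_pos by simp
      also have "\<dots> \<le> maxact * ((1 - s) + s * en w)"
        using mult_left_mono[OF Y_en, of "1 - s" k] s maxact_pos by simp
      finally show ?thesis by (simp add: act_lincomb[OF Y_loop w])
    qed
    then have "(1 - s)\<^sup>2 * maxact + (1 - s) * s * ?C + s\<^sup>2 * act w \<le> maxact * ((1 - s) + s * en w)"
      by (intro LIMSEQ_le_const2[OF tendsto_add[OF tendsto_add[OF tendsto_mult_left[OF Y_act]
              tendsto_mult_left[OF cross_tendsto[OF wc]]] tendsto_const]]) auto
    then have "s * ((1 - s) * ?C + s * act w) \<le> s * ((1 - s) * maxact + maxact * en w)"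
      by (simp add: power2_eq_square algebra_simps)
    with s show ?thesis by simp
  qed
  have 1: "((\<lambda>s. (1 - s) * ?C + s * act w) \<longlongrightarrow> (1 - 0) * ?C + 0 * act w) (at_right 0)"
    by (intro tendsto_intros)
  have 2: "((\<lambda>s. (1 - s) * maxact + maxact * en w) \<longlongrightarrow> (1 - 0) * maxact + maxact * en w) (at_right 0)"
    by (intro tendsto_intros)
  have 3: "\<forall>\<^sub>F s in at_right 0. (1 - s) * ?C + s * act w \<le> (1 - s) * maxact + maxact * en w"
    using * by (auto simp: eventually_at_right_field intro!: exI[of _ 1])
  from tendsto_le[OF trivial_limit_at_right_real 2 1 3] show ?thesis by simp
qed

text \<open>Moving \<open>c\<close> in the direction \<open>- e\<close> cannot lower the integral,
  so the one-sided derivative is nonnegative for every \<open>e\<close>, hence zero.\<close>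

lemma P_stationary: "integral {0..1} (\<lambda>t. P (x t)) = 0"
proof -
  have nonneg: "0 \<le> integral {0..1} (\<lambda>u. P (x u) \<bullet> e)" for e
  proof (rule tendsto_lowerbound[OF P_param_tendsto[OF x_cont]])
    have "0 \<le> integral {0..1} (\<lambda>u. P (x u + s *\<^sub>R e) \<bullet> e)" if "0 < s" for s
    proof -
      have xs: "continuous_on {0..1} (\<lambda>u. x u + s *\<^sub>R e)" by (intro continuous_intros x_cont)
      have "integral {0..1} (\<lambda>u. Hm (x u)) \<le> integral {0..1} (\<lambda>u. Hm (x u + s *\<^sub>R e))"
        using c_min[of "c - s *\<^sub>R e"] by (simp add: x_def algebra_simps)
      then have "0 \<le> integral {0..1} (\<lambda>u. Hm (x u + s *\<^sub>R e) - Hm (x u))"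
        using Henstock_Kurzweil_Integration.integral_diff[OF Hm_integrable[OF xs] Hm_integrable[OF x_cont]]
        by simp
      also note Hm_increment_le[OF x_cont, of s e]
      finally show ?thesis using that by (simp add: zero_le_mult_iff)
    qed
    then show "\<forall>\<^sub>F s in at_right 0. 0 \<le> integral {0..1} (\<lambda>u. P (x u + s *\<^sub>R e) \<bullet> e)"
      by (auto simp: eventually_at_right_field intro!: exI[of _ 1])
  qed simp
  have int: "(\<lambda>t. P (x t)) integrable_on {0..1}"
    by (intro integrable_continuous_real P_comp_continuous x_cont)
  have "0 \<le> e \<bullet> integral {0..1} (\<lambda>t. P (x t))" for e
    using nonneg[of e] integral_inner_right[OF int, of e] by (simp add: inner_commute)
  then show ?thesis by (rule eq_zero_if_inner_nonneg)
qed

lemma v_cont: "continuous_on {0..1} v"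
  unfolding v_def by (intro continuous_intros P_comp_continuous x_cont)

lemma v_loop: "loop v"
  using v_cont P_stationary unfolding loop_def v_def by simp

lemma integral_x_eq_z:
  assumes "loop w"
  shows "integral {0..1} (\<lambda>t. x t \<bullet> w t) = integral {0..1} (\<lambda>t. z t \<bullet> w t)"
proof -
  have w: "w integrable_on {0..1}" by (intro integrable_continuous_real loop_continuous assms)
  have "integral {0..1} (\<lambda>t. x t \<bullet> w t) = integral {0..1} (\<lambda>t. z t \<bullet> w t) - integral {0..1} (\<lambda>t. c \<bullet> w t)"
    unfolding x_def inner_diff_left
    by (intro Henstock_Kurzweil_Integration.integral_diff integrable_continuous_real continuous_intros
        z_cont loop_continuous assms)
  then show ?thesis using assms by (simp add: integral_inner_right[OF w] loop_def)
qed

lemma integral_z_v: "integral {0..1} (\<lambda>t. z t \<bullet> v t) = 2 * integral {0..1} (\<lambda>t. Hm (x t)) / maxact"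
proof -
  have "integral {0..1} (\<lambda>t. z t \<bullet> v t) = integral {0..1} (\<lambda>t. (2 / maxact) * Hm (x t))"
    unfolding integral_x_eq_z[OF v_loop, symmetric]
    by (rule integral_cong) (simp add: v_def inner_commute[of "x _"] P_inner)
  then show ?thesis by simp
qed

lemma en_v_le: "en v \<le> integral {0..1} (\<lambda>t. Hm (x t)) / maxact\<^sup>2"
proof -
  have "en v = (1 / maxact)\<^sup>2 * en (\<lambda>t. P (x t))"
    unfolding v_def using maxact_pos by (intro en_scaleR) simp
  also have "\<dots> \<le> (1 / maxact)\<^sup>2 * integral {0..1} (\<lambda>t. Hm (x t))"
    unfolding en_def
    by (intro mult_left_mono integral_le en_integrable Hm_integrable P_comp_continuous x_cont)
      (simp_all add: power_mono h_P_le h_nonneg)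
  finally show ?thesis by (simp add: power_divide)
qed

text \<open>Test \<open>first_order\<close> with \<open>w = v\<close>, which is a loop by the choice
  of \<open>c\<close>. With \<open>I\<close> for the integral this reads
  \<open>2 * I / maxact \<le> maxact + I / maxact\<close>.\<close>

lemma integral_Hm_le: "integral {0..1} (\<lambda>t. Hm (x t)) \<le> maxact\<^sup>2"
proof -
  let ?I = "integral {0..1} (\<lambda>t. Hm (x t))"
  have "2 * ?I / maxact \<le> maxact + maxact * en v"
    using first_order[OF v_loop] by (simp only: integral_z_v)
  also have "\<dots> \<le> maxact + maxact * (?I / maxact\<^sup>2)"
    using mult_left_mono[OF en_v_le, of maxact] maxact_pos by simp
  finally show ?thesis using maxact_pos by (simp add: field_simps power2_eq_square)
qed

text \<open>Integrate \<open>young\<close> along \<open>Y k\<close>, with argument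
  \<open>x + s e\<close> up to time \<open>t\<close> and \<open>x\<close> afterwards. The shift
  contributes \<open>s e\<close> paired with the integral of \<open>Y k\<close> over
  \<open>{0..t}\<close>, which is \<open>- J (prim (Y k) t)\<close>; hence the limit sees the value
  of \<open>z\<close> at \<open>t\<close>.\<close>

lemma variation:
  assumes t: "t \<in> {0..1}" and s: "0 \<le> s"
  shows "2 * maxact - s * (e \<bullet> J (z t))
    \<le> (integral {0..1} (\<lambda>u. Hm (x u)) + integral {0..t} (\<lambda>u. Hm (x u + s *\<^sub>R e) - Hm (x u))) / maxact + maxact"
    (is "_ \<le> (?I + ?D) / maxact + maxact")
proof -
  note a = maxact_pos
  have sub: "{0..t} \<subseteq> {0..1}" "{t..1} \<subseteq> {0..1}" and t01: "0 \<le> t" "t \<le> 1" using t by auto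
  note xc = continuous_on_subset[OF x_cont sub(1)] continuous_on_subset[OF x_cont sub(2)]
  have xs: "continuous_on {0..t} (\<lambda>u. x u + s *\<^sub>R e)" by (intro continuous_intros xc)
  have "integral {0..1} (\<lambda>u. z u \<bullet> Y k u) - s * (e \<bullet> J (prim (Y k) t)) \<le> (?I + ?D) / maxact + maxact" for k
  proof -
    note yc = continuous_on_subset[OF Y_cont[of k] sub(1)] continuous_on_subset[OF Y_cont[of k] sub(2)]
    let ?h = "\<lambda>u. (h (Y k u))\<^sup>2 / 2"
    have yi: "Y k integrable_on {0..t}" by (intro integrable_continuous_real yc)
    have i1: "(\<lambda>u. x u \<bullet> Y k u) integrable_on {0..1}"
      by (intro integrable_continuous_real continuous_intros x_cont Y_cont)
    have A1: "integral {0..t} (\<lambda>u. (x u + s *\<^sub>R e) \<bullet> Y k u)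
        \<le> integral {0..t} (\<lambda>u. Hm (x u + s *\<^sub>R e)) / maxact + maxact * integral {0..t} ?h"
    proof -
      have "integral {0..t} (\<lambda>u. (x u + s *\<^sub>R e) \<bullet> Y k u)
          \<le> integral {0..t} (\<lambda>u. Hm (x u + s *\<^sub>R e) / maxact + maxact * ?h u)"
        by (intro integral_le young a integrable_continuous_real continuous_intros Hm_comp_continuous
            h_comp_continuous xc yc) (use a in auto)
      then show ?thesis
        by (subst (asm) Henstock_Kurzweil_Integration.integral_add)
          (simp_all only: Hm_integrable xs en_integrable yc integrable_on_divide integrable_on_mult_right
            integral_divide integral_mult_right)
    qed
    have A2: "integral {t..1} (\<lambda>u. x u \<bullet> Y k u)
        \<le> integral {t..1} (\<lambda>u. Hm (x u)) / maxact + maxact * integral {t..1} ?h"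
    proof -
      have "integral {t..1} (\<lambda>u. x u \<bullet> Y k u) \<le> integral {t..1} (\<lambda>u. Hm (x u) / maxact + maxact * ?h u)"
        by (intro integral_le young a integrable_continuous_real continuous_intros Hm_comp_continuous
            h_comp_continuous xc yc) (use a in auto)
      then show ?thesis
        by (subst (asm) Henstock_Kurzweil_Integration.integral_add)
          (simp_all only: Hm_integrable xc en_integrable yc integrable_on_divide integrable_on_mult_right
            integral_divide integral_mult_right)
    qed
    have "integral {0..t} (\<lambda>u. (x u + s *\<^sub>R e) \<bullet> Y k u)
        = integral {0..t} (\<lambda>u. x u \<bullet> Y k u) + integral {0..t} (\<lambda>u. (s *\<^sub>R e) \<bullet> Y k u)"
      unfolding inner_add_left
      by (intro Henstock_Kurzweil_Integration.integral_add integrable_continuous_real continuous_intros xc yc)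
    also have "integral {0..t} (\<lambda>u. (s *\<^sub>R e) \<bullet> Y k u) = - (s * (e \<bullet> J (prim (Y k) t)))"
      using integral_inner_right[OF yi, of "s *\<^sub>R e"] integral_y_eq_prim[OF Y_cont t, of k] by simp
    finally have L: "integral {0..t} (\<lambda>u. (x u + s *\<^sub>R e) \<bullet> Y k u) + integral {t..1} (\<lambda>u. x u \<bullet> Y k u)
        = integral {0..1} (\<lambda>u. z u \<bullet> Y k u) - s * (e \<bullet> J (prim (Y k) t))"
      using Henstock_Kurzweil_Integration.integral_combine[OF t01 i1] integral_x_eq_z[OF Y_loop[of k]] by simp
    have D: "?D = integral {0..t} (\<lambda>u. Hm (x u + s *\<^sub>R e)) - integral {0..t} (\<lambda>u. Hm (x u))"
      by (intro Henstock_Kurzweil_Integration.integral_diff Hm_integrable xs xc)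
    have I: "integral {0..t} (\<lambda>u. Hm (x u)) + integral {t..1} (\<lambda>u. Hm (x u)) = ?I"
      by (intro Henstock_Kurzweil_Integration.integral_combine t01 Hm_integrable x_cont)
    have E: "integral {0..t} ?h + integral {t..1} ?h = en (Y k)"
      unfolding en_def by (intro Henstock_Kurzweil_Integration.integral_combine t01 en_integrable Y_cont)
    have "(?I + ?D) / maxact + maxact * en (Y k)
        = (integral {0..t} (\<lambda>u. Hm (x u + s *\<^sub>R e)) / maxact + maxact * integral {0..t} ?h)
          + (integral {t..1} (\<lambda>u. Hm (x u)) / maxact + maxact * integral {t..1} ?h)"
      unfolding D I[symmetric] E[symmetric] using a by (simp add: field_simps)
    moreover have "maxact * en (Y k) \<le> maxact" using Y_en[of k] a by simp
    ultimately show ?thesis using A1 A2 L by linarith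
  qed
  then show ?thesis
    by (intro LIMSEQ_le_const2[OF tendsto_diff[OF z_Y_tendsto tendsto_mult_left[OF tendsto_inner[OF tendsto_const
          bounded_linear.tendsto[OF bounded_linear_J prim_Y_tendsto[OF t]]]]]]) auto
qed

text \<open>Without perturbation, \<open>variation\<close> is the integrated Fenchel inequality and
  gives the missing lower bound. With this equality the terms of order 0 in \<open>variation\<close>
  cancel for every \<open>s\<close>.\<close>

lemma integral_Hm_eq: "integral {0..1} (\<lambda>t. Hm (x t)) = maxact\<^sup>2"
proof (rule antisym[OF integral_Hm_le])
  have "maxact \<le> integral {0..1} (\<lambda>u. Hm (x u)) / maxact"
    using variation[of 0 0 0] by simp
  then show "maxact\<^sup>2 \<le> integral {0..1} (\<lambda>t. Hm (x t))"
    using maxact_pos by (simp add: field_simps power2_eq_square)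
qed

text \<open>Dividing \<open>variation\<close> by \<open>s\<close> and letting \<open>s\<close> tend
  to 0 leaves an inequality linear in \<open>e\<close>. Holding for all \<open>e\<close>, it is an
  equality, and it exhibits \<open>z\<close> as the primitive of the continuous \<open>J v\<close>:
  here differentiability is gained.\<close>

lemma z_eq_prim:
  assumes t: "t \<in> {0..1}"
  shows "z t = prim v t"
proof -
  have xc: "continuous_on {0..t} x" using t by (intro continuous_on_subset[OF x_cont]) auto
  have le: "- (e \<bullet> J (z t)) \<le> integral {0..t} (\<lambda>u. P (x u) \<bullet> e) / maxact" for e
  proof (rule tendsto_lowerbound[OF tendsto_divide[OF P_param_tendsto[OF xc] tendsto_const]])
    have "- (e \<bullet> J (z t)) \<le> integral {0..t} (\<lambda>u. P (x u + s *\<^sub>R e) \<bullet> e) / maxact" if s: "0 < s" for s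
    proof -
      let ?D = "integral {0..t} (\<lambda>u. Hm (x u + s *\<^sub>R e) - Hm (x u))"
      have "(maxact\<^sup>2 + ?D) / maxact = maxact + ?D / maxact"
        using maxact_pos by (simp add: field_simps power2_eq_square)
      then have "s * - (e \<bullet> J (z t)) \<le> ?D / maxact"
        using variation[OF t, of s e] s unfolding integral_Hm_eq by simp
      also have "\<dots> \<le> s * integral {0..t} (\<lambda>u. P (x u + s *\<^sub>R e) \<bullet> e) / maxact"
        using Hm_increment_le[OF xc, of s e] s maxact_pos by (intro divide_right_mono) auto
      finally have "s * - (e \<bullet> J (z t)) \<le> s * (integral {0..t} (\<lambda>u. P (x u + s *\<^sub>R e) \<bullet> e) / maxact)"
        by simp
      then show ?thesis using s by (simp only: mult_le_cancel_left_pos)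
    qed
    then show "\<forall>\<^sub>F s in at_right 0. - (e \<bullet> J (z t)) \<le> integral {0..t} (\<lambda>u. P (x u + s *\<^sub>R e) \<bullet> e) / maxact"
      by (auto simp: eventually_at_right_field intro!: exI[of _ 1])
  qed (use maxact_pos in auto)
  have int: "(\<lambda>t. P (x t)) integrable_on {0..t}"
    by (intro integrable_continuous_real P_comp_continuous xc)
  have pv: "integral {0..t} v = - J (prim v t)" by (rule integral_y_eq_prim[OF v_cont t])
  have "e \<bullet> integral {0..t} v = integral {0..t} (\<lambda>u. P (x u) \<bullet> e) / maxact" for e
    using integral_inner_right[OF int, of e] unfolding v_def by (simp add: inner_commute)
  then have "0 \<le> e \<bullet> (J (z t) - J (prim v t))" for e
    using le[of e] unfolding pv by (simp add: inner_diff_right) (metis minus_le_iff minus_minus)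
  then have "J (z t) - J (prim v t) = 0" by (rule eq_zero_if_inner_nonneg)
  then have "J (J (z t)) = J (J (prim v t))" by simp
  then show ?thesis by (simp add: J_J)
qed

lemma x_has_vector_derivative:
  assumes "t \<in> {0..1}"
  shows "(x has_vector_derivative J (v t)) (at t within {0..1})"
proof -
  have "((\<lambda>t. prim v t - c) has_vector_derivative J (v t)) (at t within {0..1})"
    using prim_has_vector_derivative[OF v_cont assms] by (auto intro!: derivative_eq_intros)
  then show ?thesis
    by (rule has_vector_derivative_transform[OF assms, rotated]) (simp add: x_def z_eq_prim)
qed

text \<open>Conservation of energy, as \<open>P x\<close> is orthogonal to \<open>J (P x)\<close>.
  The constant must be the mean value already computed.\<close>

lemma Hm_x_const:
  assumes "t \<in> {0..1}"
  shows "Hm (x t) = maxact\<^sup>2"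
proof -
  have der: "((\<lambda>t. Hm (x t)) has_vector_derivative 0) (at t within {0..1})" if "t \<in> {0..1}" for t
  proof -
    have "((\<lambda>t. Hm (x t)) has_derivative (\<lambda>s. P (x t) \<bullet> (s *\<^sub>R J (v t)))) (at t within {0..1})"
      using has_derivative_compose[OF x_has_vector_derivative[OF that, unfolded has_vector_derivative_def]
          half_g_square_has_derivative] .
    then show ?thesis
      by (simp add: has_vector_derivative_def v_def J_simps J_inner_self)
  qed
  have "Hm (x t) = Hm (x 0)" if "t \<in> {0..1}" for t
    using has_vector_derivative_zero_constant[OF convex_real_interval(5) der] that
    by (metis atLeastAtMost_iff order_refl zero_le_one)
  then have const: "Hm (x u) = Hm (x t)" if "u \<in> {0..1}" for u using that assms by metis
  have "integral {0..1} (\<lambda>u. Hm (x u)) = integral {0..1::real} (\<lambda>u. Hm (x t))"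
    by (rule integral_cong) (rule const)
  then show ?thesis by (simp only: integral_Hm_eq) simp
qed

end

section \<open>Closed characteristics\<close>

context centered_body
begin

text \<open>Although \<open>N\<close> is a choice, the predicates chosen from at \<open>x\<close>
  and at \<open>r x\<close> coincide, so the choices do as well.\<close>

lemma N_scaleR:
  assumes "0 < r"
  shows "N (r *\<^sub>R x) = N x"
proof -
  have "n \<bullet> (r *\<^sub>R x) = g (r *\<^sub>R x) \<longleftrightarrow> n \<bullet> x = g x" for n
    using assms by (simp add: g_scaleR)
  then show ?thesis by (simp add: N_def)
qed

end

lemma smooth_on_line: "smooth_on UNIV (\<lambda>s::real. x + s *\<^sub>R v)"
  unfolding smooth_on_def
  by (intro allI Ck_on_add Ck_on_const Ck_on_bounded_linear bounded_linear_scaleR_left open_UNIV)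

context smooth_body
begin

text \<open>A frontier curve through \<open>x\<close> maximises \<open>N x\<close> at
  \<open>x\<close>, so its velocity is orthogonal to \<open>N x\<close>. Conversely, the straight
  line in direction \<open>v\<close>, projected radially to the frontier, keeps the velocity
  \<open>v\<close>, because the derivative of \<open>g\<close> at \<open>x\<close> vanishes on
  \<open>v\<close>.\<close>

lemma tangent_space_frontier:
  assumes x: "x \<in> frontier D"
  shows "tangent_space (frontier D) x = {v. N x \<bullet> v = 0}"
proof (intro equalityI subsetI)
  fix v assume "v \<in> tangent_space (frontier D) x"
  then obtain c \<epsilon> where c: "0 < \<epsilon>" "\<And>t. t \<in> {-\<epsilon><..<\<epsilon>} \<Longrightarrow> c t \<in> frontier D"
    "c (0::real) = x" "(c has_vector_derivative v) (at 0)"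
    unfolding tangent_space_def by blast
  have "((\<lambda>t. N x \<bullet> c t) has_vector_derivative N x \<bullet> v) (at 0)"
    by (rule bounded_linear.has_vector_derivative[OF bounded_linear_inner_right c(4)])
  then have "DERIV (\<lambda>t. N x \<bullet> c t) 0 :> N x \<bullet> v"
    by (simp add: has_real_derivative_iff_has_vector_derivative)
  moreover have "N x \<bullet> c t \<le> N x \<bullet> c 0" if "\<bar>0 - t\<bar> < \<epsilon>" for t
  proof -
    have "t \<in> {-\<epsilon><..<\<epsilon>}" using that by auto
    from N_le[of x "c t"] c(2)[OF this] x show ?thesis by (simp add: c(3) N_inner frontier_iff_g)
  qed
  ultimately have "N x \<bullet> v = 0" using DERIV_local_max[OF _ c(1)] by blast
  then show "v \<in> {v. N x \<bullet> v = 0}" by simp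
next
  fix v assume "v \<in> {v. N x \<bullet> v = 0}"
  then have v: "N x \<bullet> v = 0" by simp
  have gx: "g x = 1" using x by (simp add: frontier_iff_g)
  then have x0: "x \<noteq> 0" by (auto simp: g_zero)
  \<comment> \<open>Keeps the line away from the origin; the added 1 covers
    \<open>v = 0\<close>.\<close>
  define \<epsilon> where "\<epsilon> = norm x / (norm v + 1)"
  have eps: "0 < \<epsilon>" using x0 by (simp add: \<epsilon>_def add_nonneg_pos)
  let ?l = "\<lambda>s::real. x + s *\<^sub>R v" and ?I = "{-\<epsilon><..<\<epsilon>}"
  have l0: "?l s \<noteq> 0" if "s \<in> ?I" for s
  proof
    assume "?l s = 0"
    then have "norm x = \<bar>s\<bar> * norm v" by (metis add_eq_0_iff norm_minus_cancel norm_scaleR)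
    also have "\<dots> \<le> \<bar>s\<bar> * (norm v + 1)" by (intro mult_left_mono) auto
    also have "\<dots> < norm x"
      using that by (simp add: \<epsilon>_def pos_less_divide_eq add_nonneg_pos abs_less_iff)
        (metis abs_less_iff add_nonneg_pos minus_divide_left norm_ge_zero pos_less_divide_eq zero_less_one
          \<epsilon>_def greaterThanLessThan_iff minus_less_iff that)
    finally show False by simp
  qed
  define c where "c s = inverse (g (?l s)) *\<^sub>R ?l s" for s
  have "smooth_on ?I c"
    unfolding smooth_on_def c_def
  proof
    fix k
    have l: "Ck_on k ?I ?l"
      by (rule Ck_on_subset[OF smooth_on_Ck_on[OF smooth_on_line]]) simp
    have "Ck_on k ?I (\<lambda>s. g (?l s))"
      by (rule Ck_on_compose[OF _ _ _ smooth_on_Ck_on[OF g_smooth] l]) (use l0 in \<open>auto simp: open_Compl\<close>)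
    then have "Ck_on k ?I (\<lambda>s. inverse (g (?l s)))"
      using l0 g_pos by (intro Ck_on_inverse) (auto simp: less_imp_neq[symmetric])
    then show "Ck_on k ?I (\<lambda>s. inverse (g (?l s)) *\<^sub>R ?l s)"
      by (intro Ck_on_scaleR l) auto
  qed
  moreover have "c s \<in> frontier D" if "s \<in> ?I" for s
    using frontier_normalize[OF l0[OF that]] by (simp add: c_def inverse_eq_divide)
  moreover have "c 0 = x" by (simp add: c_def gx)
  moreover have "(c has_vector_derivative v) (at 0)"
  proof -
    have l: "(?l has_derivative (\<lambda>s. s *\<^sub>R v)) (at 0)" by (auto intro!: derivative_eq_intros)
    have "(g has_derivative (\<lambda>w. N x \<bullet> w)) (at (?l 0))" using g_has_derivative[OF x0] by simp
    from has_derivative_compose[OF l this]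
    have "((\<lambda>s. g (?l s)) has_derivative (\<lambda>s. 0)) (at 0)" by (simp add: v)
    from Deriv.has_derivative_inverse[OF _ this] gx
    have "((\<lambda>s. inverse (g (?l s))) has_derivative (\<lambda>s. 0)) (at 0)" by simp
    from has_derivative_scaleR[OF this l] gx
    have "(c has_derivative (\<lambda>s. s *\<^sub>R v)) (at 0)" by (simp add: c_def[abs_def])
    then show ?thesis by (simp add: has_vector_derivative_def)
  qed
  ultimately show "v \<in> tangent_space (frontier D) x"
    unfolding tangent_space_def using eps by blast
qed

end

lemma omega_st_eq: "omega_st \<zeta> \<eta> = J \<zeta> \<bullet> \<eta>"
  by (simp add: omega_st_def J_def inner_prod_def inner_vec_def sum_subtractf sum_negf)

context phase_body
begin

lemma characteristic_line_frontier:
  assumes x: "x \<in> frontier D"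
  shows "characteristic_line D x = range (\<lambda>r. r *\<^sub>R J (N x))"
proof (intro equalityI subsetI)
  have "N x \<bullet> x = 1" using x by (simp add: N_inner frontier_iff_g)
  then have nz: "N x \<bullet> N x \<noteq> 0" by auto
  fix \<zeta> assume "\<zeta> \<in> characteristic_line D x"
  then have z: "\<And>\<eta>. N x \<bullet> \<eta> = 0 \<Longrightarrow> J \<zeta> \<bullet> \<eta> = 0"
    unfolding characteristic_line_def tangent_space_frontier[OF x] omega_st_eq by blast
  define r where "r = (J \<zeta> \<bullet> N x) / (N x \<bullet> N x)"
  define w where "w = J \<zeta> - r *\<^sub>R N x"
  have Nw: "N x \<bullet> w = 0" using nz by (simp add: w_def r_def inner_diff_right inner_commute)
  have "w \<bullet> w = J \<zeta> \<bullet> w - r * (N x \<bullet> w)" unfolding w_def by (simp add: inner_diff_left)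
  then have "w = 0" using z[OF Nw] Nw by simp
  then have "J (J \<zeta>) = r *\<^sub>R J (N x)" by (simp add: w_def J_simps)
  then have "\<zeta> = (- r) *\<^sub>R J (N x)" by (simp add: J_J) (metis minus_minus)
  then show "\<zeta> \<in> range (\<lambda>r. r *\<^sub>R J (N x))" by blast
next
  fix \<zeta> assume "\<zeta> \<in> range (\<lambda>r. r *\<^sub>R J (N x))"
  then obtain r where r: "\<zeta> = r *\<^sub>R J (N x)" by blast
  show "\<zeta> \<in> characteristic_line D x"
    unfolding characteristic_line_def
    by (simp add: tangent_space_frontier[OF x] omega_st_eq r J_simps J_J J_inner_self)
qed

lemma exists_maximising_arc:
  obtains u where "\<And>t. t \<in> {0..1} \<Longrightarrow> (u has_vector_derivative (1 / maxact) *\<^sub>R J (N (u t))) (at t within {0..1})"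
    "u 0 = u 1" "\<And>t. t \<in> {0..1} \<Longrightarrow> g (u t) = 1"
proof -
  obtain Y z where Y: "\<And>k. loop (Y k)" "\<And>k. en (Y k) \<le> 1" "(\<lambda>k. act (Y k)) \<longlonglongrightarrow> maxact"
    "continuous_on {0..1} z" "z 0 = 0" "z 1 = 0"
    "\<And>e. 0 < e \<Longrightarrow> \<exists>n0. \<forall>k\<ge>n0. \<forall>t\<in>{0..1}. norm (prim (Y k) t - z t) < e"
    by (rule maximising_sequence) blast
  obtain c where c: "\<And>c'. integral {0..1} (\<lambda>t. Hm (z t - c)) \<le> integral {0..1} (\<lambda>t. Hm (z t - c'))"
    using exists_min_translate[OF Y(4)] by blast
  interpret maximising_limit D Y z c
    by unfold_locales (fact Y c)+
  \<comment> \<open>The constant gauge of \<open>x\<close>, read off from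
    \<open>Hm (x t) = maxact\<^sup>2\<close>; dividing by it puts the curve on the frontier.\<close>
  define r where "r = sqrt 2 * maxact"
  have r: "0 < r" using maxact_pos by (simp add: r_def)
  have gx: "g (x t) = r" if "t \<in> {0..1}" for t
  proof -
    have "(g (x t))\<^sup>2 = r\<^sup>2"
      using Hm_x_const[OF that] by (simp add: r_def power_mult_distrib)
    then show ?thesis using r g_nonneg[of "x t"] by (simp add: power2_eq_iff_nonneg)
  qed
  define u where "u t = (1 / r) *\<^sub>R x t" for t
  show thesis
  proof (rule that)
    fix t :: real assume t: "t \<in> {0..1}"
    show "g (u t) = 1" using r gx[OF t] by (simp add: u_def g_scaleR)
    have "(1 / r) *\<^sub>R J (v t) = (1 / maxact) *\<^sub>R J (N (u t))"
      using r gx[OF t] by (simp add: v_def P_def u_def N_scaleR J_simps)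
    moreover have "(u has_vector_derivative (1 / r) *\<^sub>R J (v t)) (at t within {0..1})"
      unfolding u_def using x_has_vector_derivative[OF t] by (auto intro!: derivative_eq_intros)
    ultimately show "(u has_vector_derivative (1 / maxact) *\<^sub>R J (N (u t))) (at t within {0..1})" by simp
  next
    show "u 0 = u 1" by (simp add: u_def x_def z_0 z_1)
  qed
qed

text \<open>A proper closed subarc has too much action for its length, by maximality.\<close>

lemma arc_no_proper_closed_subarc:
  assumes u: "\<And>t. t \<in> {0..1} \<Longrightarrow> (u has_vector_derivative (1 / maxact) *\<^sub>R J (N (u t))) (at t within {0..1})"
    and gu: "\<And>t. t \<in> {0..1} \<Longrightarrow> g (u t) = 1"
    and st: "0 \<le> s" "s < t" "t \<le> 1" "u s = u t"
  shows "1 \<le> t - s"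
proof -
  note a = maxact_pos
  define p where "p \<tau> = s + \<tau> * (t - s)" for \<tau>
  have p: "p \<tau> \<in> {0..1}" if "\<tau> \<in> {0..1}" for \<tau>
  proof -
    define q where "q = \<tau> * (t - s)"
    have "q \<le> 1 * (t - s)" unfolding q_def using that st by (intro mult_right_mono) auto
    moreover have "0 \<le> q" using that st by (simp add: q_def)
    ultimately show ?thesis using st by (simp add: p_def flip: q_def)
  qed
  define w where "w \<tau> = ((t - s) / maxact) *\<^sub>R N (u (p \<tau>))" for \<tau>
  have uc: "continuous_on {0..1} u" by (rule continuous_on_vector_derivative[OF u])
  have pc: "continuous_on {0..1} p" unfolding p_def by (intro continuous_intros)
  have upc: "continuous_on {0..1} (\<lambda>\<tau>. u (p \<tau>))"
    by (rule continuous_on_compose2[OF uc pc]) (rule image_subsetI, rule p)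
  have "u (p \<tau>) \<noteq> 0" if "\<tau> \<in> {0..1}" for \<tau> using gu[OF p[OF that]] by (auto simp: g_zero)
  then have "continuous_on {0..1} (\<lambda>\<tau>. N (u (p \<tau>)))"
    by (intro continuous_on_compose2[OF N_continuous upc]) auto
  then have wc: "continuous_on {0..1} w" unfolding w_def by (intro continuous_intros)
  have "((\<lambda>\<tau>. u (p \<tau>)) has_vector_derivative J (w \<tau>)) (at \<tau> within {0..1})" if "\<tau> \<in> {0..1}" for \<tau>
  proof -
    have "(p has_vector_derivative (t - s)) (at \<tau> within {0..1})"
      unfolding p_def has_real_derivative_iff_has_vector_derivative[symmetric]
      by (auto intro!: derivative_eq_intros)
    moreover have "(u has_vector_derivative (1 / maxact) *\<^sub>R J (N (u (p \<tau>)))) (at (p \<tau>) within p ` {0..1})"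
      by (rule has_vector_derivative_within_subset[OF u[OF p[OF that]]]) (rule image_subsetI, rule p)
    ultimately have "((u \<circ> p) has_vector_derivative (t - s) *\<^sub>R (1 / maxact) *\<^sub>R J (N (u (p \<tau>)))) (at \<tau> within {0..1})"
      by (rule vector_diff_chain_within)
    then show ?thesis by (simp add: o_def w_def J_simps)
  qed
  then have prim: "prim w \<tau> = u (p \<tau>) - u s" if "\<tau> \<in> {0..1}" for \<tau>
    using prim_eqI[of "\<lambda>\<tau>. u (p \<tau>)" w \<tau>] that by (simp add: p_def)
  have "integral {0..1} w = 0"
    using integral_y_eq_prim[OF wc, of 1] prim[of 1] st by (simp add: p_def J_simps)
  then have w: "loop w" using wc by (simp add: loop_def)
  have wi: "w integrable_on {0..1}" by (intro integrable_continuous_real wc)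
  have "cross w w = integral {0..1} (\<lambda>\<tau>. u (p \<tau>) \<bullet> w \<tau> - u s \<bullet> w \<tau>)"
    unfolding cross_def by (rule integral_cong) (simp add: prim inner_diff_left)
  also have "\<dots> = integral {0..1} (\<lambda>\<tau>. u (p \<tau>) \<bullet> w \<tau>) - u s \<bullet> integral {0..1} w"
    unfolding integral_inner_right[OF wi, symmetric]
    by (intro Henstock_Kurzweil_Integration.integral_diff integrable_continuous_real continuous_intros upc wc)
  also have "integral {0..1} (\<lambda>\<tau>. u (p \<tau>) \<bullet> w \<tau>) = integral {0..1::real} (\<lambda>\<tau>. (t - s) / maxact)"
    by (rule integral_cong) (simp add: w_def inner_commute[of "u _"] N_inner gu[OF p])
  finally have act: "act w = (t - s) / maxact / 2"
    using w by (simp add: loop_def act_def)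
  have "en w \<le> integral {0..1::real} (\<lambda>\<tau>. ((t - s) / maxact)\<^sup>2 / 2)"
    unfolding en_def
  proof (rule integral_le[OF en_integrable[OF wc] integrable_const_ivl])
    fix \<tau> :: real assume "\<tau> \<in> {0..1}"
    have "h (w \<tau>) \<le> (t - s) / maxact"
      using h_N_le[of "u (p \<tau>)"] st a mult_left_le[of "h (N (u (p \<tau>)))" "(t - s) / maxact"]
      by (simp add: w_def h_scaleR)
    then show "(h (w \<tau>))\<^sup>2 / 2 \<le> ((t - s) / maxact)\<^sup>2 / 2"
      by (intro divide_right_mono power_mono h_nonneg) auto
  qed
  then have "maxact * en w \<le> maxact * (((t - s) / maxact)\<^sup>2 / 2)" using a by simp
  \<comment> \<open>The action of the subarc is linear in \<open>t - s\<close>, the bound on its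
    energy quadratic; so \<open>act \<le> maxact * en\<close> forbids short closed subarcs.\<close>
  with act_le[OF w] have "(t - s) / maxact / 2 \<le> maxact * (((t - s) / maxact)\<^sup>2 / 2)"
    unfolding act by linarith
  also have "\<dots> = (t - s) * ((t - s) / maxact / 2)" using a by (simp add: power2_eq_square)
  finally have "1 * ((t - s) / maxact / 2) \<le> (t - s) * ((t - s) / maxact / 2)" by simp
  then show ?thesis using a st by (simp only: mult_le_cancel_right) auto
qed

end

section \<open>Periodic extension of the maximising arc\<close>

lemma has_vector_derivative_within_Un:
  assumes "(f has_vector_derivative d) (at x within S)" "(f has_vector_derivative d) (at x within T)"
  shows "(f has_vector_derivative d) (at x within S \<union> T)"
  unfolding has_vector_derivative_def has_derivative_within_alt
proof (intro conjI allI impI)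
  fix e :: real assume e: "0 < e"
  let ?R = "\<lambda>y. norm (f y - f x - (y - x) *\<^sub>R d) \<le> e * norm (y - x)"
  obtain d1 where d1: "0 < d1" "\<And>y. y \<in> S \<Longrightarrow> norm (y - x) < d1 \<Longrightarrow> ?R y"
    using assms(1) e unfolding has_vector_derivative_def has_derivative_within_alt by metis
  obtain d2 where d2: "0 < d2" "\<And>y. y \<in> T \<Longrightarrow> norm (y - x) < d2 \<Longrightarrow> ?R y"
    using assms(2) e unfolding has_vector_derivative_def has_derivative_within_alt by metis
  show "\<exists>d0>0. \<forall>y\<in>S \<union> T. norm (y - x) < d0 \<longrightarrow> ?R y"
    using d1 d2 by (intro exI[of _ "min d1 d2"]) auto
qed (rule bounded_linear_scaleR_left)

text \<open>At integers the one-sided derivatives are \<open>F (u 1)\<close> and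
  \<open>F (u 0)\<close>. They agree because the equation is autonomous and the arc closes
  up.\<close>

lemma periodic_extension:
  fixes u :: "real \<Rightarrow> 'a::real_normed_vector"
  assumes u: "\<And>t. t \<in> {0..1} \<Longrightarrow> (u has_vector_derivative F (u t)) (at t within {0..1})" and per: "u 0 = u 1"
  shows "((\<lambda>t. u (frac t)) has_vector_derivative F (u (frac t))) (at t)"
proof -
  have piece: "((\<lambda>t. u (frac t)) has_vector_derivative F (u (frac t))) (at t within {of_int n..of_int n + 1})"
    if t: "t \<in> {of_int n..of_int n + 1}" for n t
  proof -
    have eq: "u (frac s) = u (s - of_int n)" if "s \<in> {of_int n..of_int n + 1}" for s
    proof (cases "s = of_int n + 1")
      \<comment> \<open>At the right endpoint \<open>frac s\<close> is 0 while
        \<open>s - of_int n\<close> is 1.\<close>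
      case True
      then show ?thesis using per by (simp add: frac_def)
    next
      case False
      then have "\<lfloor>s\<rfloor> = n" using that by (simp add: floor_eq_iff)
      then show ?thesis by (simp add: frac_def)
    qed
    have "((\<lambda>s. s - of_int n) has_vector_derivative 1) (at t within {of_int n..of_int n + 1})"
      unfolding has_real_derivative_iff_has_vector_derivative[symmetric]
      by (auto intro!: derivative_eq_intros)
    moreover have "(u has_vector_derivative F (u (t - of_int n))) (at (t - of_int n) within (\<lambda>s. s - of_int n) ` {of_int n..of_int n + 1})"
      by (rule has_vector_derivative_within_subset[OF u]) (use t in auto)
    ultimately have "((u \<circ> (\<lambda>s. s - of_int n)) has_vector_derivative 1 *\<^sub>R F (u (t - of_int n))) (at t within {of_int n..of_int n + 1})"
      by (rule vector_diff_chain_within)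
    then have "((\<lambda>s. u (s - of_int n)) has_vector_derivative F (u (frac t))) (at t within {of_int n..of_int n + 1})"
      by (simp add: o_def eq[OF t])
    then show ?thesis
      by (rule has_vector_derivative_transform[OF t, rotated]) (rule eq)
  qed
  define n where "n = \<lfloor>t\<rfloor>"
  have t: "of_int n \<le> t" "t < of_int n + 1" unfolding n_def by linarith+
  show ?thesis
  proof (cases "t = of_int n")
    case False
    then have "t \<in> interior {of_int n..of_int n + 1}" using t by simp
    from at_within_interior[OF this] piece[of t n] t show ?thesis by simp
  next
    case True
    have "((\<lambda>t. u (frac t)) has_vector_derivative F (u (frac t)))
        (at t within {of_int (n - 1)..of_int (n - 1) + 1} \<union> {of_int n..of_int n + 1})"
      using True by (intro has_vector_derivative_within_Un piece) auto
    moreover have "{of_int (n - 1)..of_int (n - 1) + 1} \<union> {of_int n..of_int n + 1} = {t - 1..t + 1}"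
      using True by auto
    moreover have "t \<in> interior {t - 1..t + 1}" by simp
    ultimately show ?thesis by (simp only: at_within_interior)
  qed
qed

context phase_body
begin

text \<open>Smoothness follows by bootstrapping the equation for the smooth field \<open>N\<close>,
  and injectivity from the exclusion of closed subarcs. Since
  \<open>N \<bullet> \<gamma> = 1\<close>, the action integrand is the constant speed factor
  \<open>1 / (2 * pi * maxact)\<close>.\<close>

theorem exists_closed_characteristic:
  obtains \<gamma> where "closed_characteristic D \<gamma>" "action \<gamma> = 1 / (2 * maxact)"
proof -
  note a = maxact_pos
  obtain u where u: "\<And>t. t \<in> {0..1} \<Longrightarrow> (u has_vector_derivative (1 / maxact) *\<^sub>R J (N (u t))) (at t within {0..1})"
    and per: "u 0 = u 1" and gu: "\<And>t. t \<in> {0..1} \<Longrightarrow> g (u t) = 1"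
    by (rule exists_maximising_arc) blast
  define \<gamma> where "\<gamma> t = u (frac (t / (2 * pi)))" for t
  define X where "X x = (1 / (2 * pi * maxact)) *\<^sub>R J (N x)" for x
  have frac01: "frac t \<in> {0..1::real}" for t :: real using frac_ge_0[of t] frac_lt_1[of t] by simp
  have der: "(\<gamma> has_vector_derivative X (\<gamma> t)) (at t)" for t
  proof -
    have "((\<lambda>t. t / (2 * pi)) has_vector_derivative 1 / (2 * pi)) (at t)"
      unfolding has_real_derivative_iff_has_vector_derivative[symmetric]
      by (auto intro!: derivative_eq_intros)
    from vector_diff_chain_at[OF this periodic_extension[where F = "\<lambda>x. (1 / maxact) *\<^sub>R J (N x)", OF u per]]
    show ?thesis by (simp add: o_def \<gamma>_def[abs_def] X_def field_simps)
  qed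
  have vd: "vector_derivative \<gamma> (at t) = X (\<gamma> t)" for t
    by (rule vector_derivative_at[OF der])
  have fr: "\<gamma> t \<in> frontier D" for t
    by (simp add: \<gamma>_def frontier_iff_g gu[OF frac01])
  have nz: "\<gamma> t \<noteq> 0" for t using fr[of t] by (auto simp: frontier_iff_g g_zero)
  have Ng: "N (\<gamma> t) \<bullet> \<gamma> t = 1" for t using fr[of t] by (simp add: N_inner frontier_iff_g)
  have "smooth_on (- {0}) X"
    unfolding smooth_on_def X_def
    by (intro allI Ck_on_scaleR Ck_on_const Ck_on_compose_bounded_linear[OF bounded_linear_J]
        smooth_on_Ck_on[OF N_smooth]) (simp_all add: open_Compl)
  then have smooth: "smooth_on UNIV \<gamma>"
    by (rule smooth_on_ode_solution[OF open_UNIV _ _ _ der, rotated]) (simp_all add: open_Compl nz)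
  have "closed_characteristic D \<gamma>"
    unfolding closed_characteristic_def
  proof (intro conjI allI smooth fr)
    show "\<gamma> (t + 2 * pi) = \<gamma> t" for t by (simp add: \<gamma>_def add_divide_distrib frac_def)
    show "vector_derivative \<gamma> (at t) \<in> characteristic_line D (\<gamma> t)" for t
      unfolding characteristic_line_frontier[OF fr] vd X_def by blast
    show "vector_derivative \<gamma> (at t) \<noteq> 0" for t
    proof -
      have "N (\<gamma> t) \<noteq> 0" using Ng[of t] by auto
      then show ?thesis using a norm_J[of "N (\<gamma> t)"] by (auto simp: vd X_def)
    qed
    have key: False if "\<gamma> s = \<gamma> t" "0 \<le> s" "s < t" "t < 2 * pi" for s t
    proof -
      have 1: "frac (s / (2 * pi)) = s / (2 * pi)" "frac (t / (2 * pi)) = t / (2 * pi)"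
        using that by (auto simp: frac_eq)
      have "1 \<le> t / (2 * pi) - s / (2 * pi)"
        by (rule arc_no_proper_closed_subarc[OF u gu])
          (use that 1 in \<open>auto simp: \<gamma>_def divide_strict_right_mono\<close>)
      then show False using that by (simp add: field_simps)
    qed
    show "inj_on \<gamma> {0..<2 * pi}"
      by (rule inj_onI) (metis atLeastLessThan_iff key linorder_neqE_linordered_idom)
  qed
  moreover have "action \<gamma> = 1 / (2 * maxact)"
  proof -
    have "J (\<gamma> t) \<bullet> vector_derivative \<gamma> (at t) = 1 / (2 * pi * maxact)" for t
      using Ng[of t] by (simp add: vd X_def J_inner J_J inner_commute)
    then show ?thesis by (simp add: action_def)
  qed
  ultimately show thesis by (rule that)
qed

end

section \<open>The capacity of a smooth convex body\<close>

context phase_body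
begin

text \<open>Reparametrising by the length \<open>h\<close> turns the energy into half the squared length.\<close>

lemma act_le_length:
  assumes y: "loop y" and nz: "\<And>t. t \<in> {0..1} \<Longrightarrow> y t \<noteq> 0"
  shows "act y \<le> maxact * ((integral {0..1} (\<lambda>t. h (y t)))\<^sup>2 / 2)"
proof -
  note yc = loop_continuous[OF y]
  define L where "L = integral {0..1} (\<lambda>t. h (y t))"
  define S where "S t = integral {0..t} (\<lambda>t. h (y t)) / L" for t
  have hc: "continuous_on {0..1} (\<lambda>t. h (y t))" by (rule h_comp_continuous[OF yc])
  have "\<exists>t\<in>{0..1}. \<forall>s\<in>{0..1}. h (y t) \<le> h (y s)"
    by (rule continuous_attains_inf[OF _ _ hc]) auto
  then obtain m where m: "0 < m" "\<And>s. s \<in> {0..1} \<Longrightarrow> m \<le> h (y s)"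
    using h_pos nz by metis
  have inc: "m * (t - s) \<le> integral {0..t} (\<lambda>t. h (y t)) - integral {0..s} (\<lambda>t. h (y t))"
    if "0 \<le> s" "s \<le> t" "t \<le> 1" for s t
  proof -
    have sub: "{0..t} \<subseteq> {0..1}" "{s..t} \<subseteq> {0..1}" using that by auto
    note int = integrable_continuous_real[OF continuous_on_subset[OF hc sub(1)]]
      integrable_continuous_real[OF continuous_on_subset[OF hc sub(2)]]
    have "integral {s..t} (\<lambda>t. m) \<le> integral {s..t} (\<lambda>t. h (y t))"
      using sub(2) m(2) by (intro integral_le int) auto
    then show ?thesis
      using Henstock_Kurzweil_Integration.integral_combine[OF that(1,2) int(1)] that by (simp add: mult.commute)
  qed
  have l: "0 < L" using inc[of 0 1] m(1) by (simp add: L_def)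
  have S01: "S 0 = 0" "S 1 = 1" using l by (auto simp: S_def L_def)
  have S_less: "S s < S t" if "0 \<le> s" "s < t" "t \<le> 1" for s t
  proof -
    have "0 < m * (t - s)" using m(1) that by simp
    also have "\<dots> \<le> integral {0..t} (\<lambda>t. h (y t)) - integral {0..s} (\<lambda>t. h (y t))"
      using inc that by simp
    finally show ?thesis using l by (simp add: S_def divide_strict_right_mono)
  qed
  have dS: "(S has_vector_derivative h (y t) / L) (at t within {0..1})" if "t \<in> {0..1}" for t
    unfolding S_def has_real_derivative_iff_has_vector_derivative[symmetric]
    by (intro DERIV_cdivide)
      (use integral_has_vector_derivative[OF hc that] in \<open>simp add: has_real_derivative_iff_has_vector_derivative\<close>)
  have Sc: "continuous_on {0..1} S" by (rule continuous_on_vector_derivative[OF dS])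
  have inj: "inj_on S {0..1}"
    by (rule inj_onI) (metis S_less atLeastAtMost_iff linorder_neqE_linordered_idom order_less_irrefl)
  have S_mem: "S t \<in> {0..1}" if "t \<in> {0..1}" for t
    using that S_less[of 0 t] S_less[of t 1] S01 by (cases "t = 0"; cases "t = 1") auto
  have img: "S ` {0..1} = {0..1}"
  proof
    show "{0..1} \<subseteq> S ` {0..1}"
    proof
      fix r :: real assume "r \<in> {0..1}"
      then have "\<exists>t\<ge>0. t \<le> 1 \<and> S t = r" using S01 by (intro IVT'[OF _ _ _ Sc]) auto
      then show "r \<in> S ` {0..1}" by auto
    qed
  qed (rule image_subsetI, rule S_mem)
  define T where "T = inv_into {0..1} S"
  have TS: "T (S t) = t" if "t \<in> {0..1}" for t using inj that by (simp add: T_def)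
  have T_mem: "T r \<in> {0..1}" if "r \<in> {0..1}" for r
    unfolding T_def by (rule inv_into_into) (use that img in simp)
  have Tc: "continuous_on {0..1} T"
    using continuous_on_inv[OF Sc compact_Icc] TS by (simp add: img)
  \<comment> \<open>The factor makes \<open>h (w r)\<close> constantly \<open>L\<close>, and it is
    the derivative of the inverse \<open>T\<close>, so that \<open>w\<close> describes the same
    curve at the new speed.\<close>
  define w where "w r = (L / h (y (T r))) *\<^sub>R y (T r)" for r
  have yT: "continuous_on {0..1} (\<lambda>r. y (T r))"
    by (rule continuous_on_compose2[OF yc Tc]) (rule image_subsetI, rule T_mem)
  have hyT: "0 < h (y (T r))" if "r \<in> {0..1}" for r by (rule h_pos[OF nz[OF T_mem[OF that]]])
  have wc: "continuous_on {0..1} w"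
    unfolding w_def by (intro continuous_intros yT h_comp_continuous) (use hyT in force)
  have chain: "((\<lambda>t. f (S t)) has_vector_derivative (h (y t) / L) *\<^sub>R f' (S t)) (at t within {0..1})"
    if f: "\<And>r. r \<in> {0..1} \<Longrightarrow> (f has_vector_derivative f' r) (at r within {0..1})" and t: "t \<in> {0..1}"
    for f f' :: "real \<Rightarrow> 'e::real_normed_vector" and t
    using vector_diff_chain_within[OF dS[OF t], of f "f' (S t)"] f[OF S_mem[OF t]]
    by (simp add: img o_def)
  have wS: "(h (y t) / L) *\<^sub>R w (S t) = y t" if "t \<in> {0..1}" for t
    using h_pos[OF nz[OF that]] l by (simp add: w_def TS[OF that])
  have prim: "prim y t = prim w (S t)" if "t \<in> {0..1}" for t
  proof -
    have "((\<lambda>t. prim w (S t)) has_vector_derivative J (y t)) (at t within {0..1})" if "t \<in> {0..1}" for t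
      using chain[OF prim_has_vector_derivative[OF wc] that] wS[OF that] by (simp flip: J_simps)
    from prim_eqI[OF this that] show ?thesis by (simp add: S01 prim_0)
  qed
  have "integral {0..1} w = 0"
    using integral_y_eq_prim[OF wc, of 1] prim[of 1] prim_1[OF y] by (simp add: S01 J_simps)
  then have w: "loop w" using wc by (simp add: loop_def)
  have "cross w w = cross y y"
  proof -
    \<comment> \<open>The substitution rule, obtained by differentiating the primitive
      \<open>Q\<close> along \<open>S\<close>.\<close>
    define Q where "Q r = integral {0..r} (\<lambda>r. prim w r \<bullet> w r)" for r
    have "continuous_on {0..1} (\<lambda>r. prim w r \<bullet> w r)" by (intro continuous_intros prim_continuous wc)
    then have dQ: "(Q has_vector_derivative prim w r \<bullet> w r) (at r within {0..1})" if "r \<in> {0..1}" for r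
      unfolding Q_def using that by (rule integral_has_vector_derivative)
    have "((\<lambda>t. Q (S t)) has_vector_derivative prim y t \<bullet> y t) (at t within {0..1})" if "t \<in> {0..1}" for t
    proof -
      have "(h (y t) / L) *\<^sub>R (prim w (S t) \<bullet> w (S t)) = prim w (S t) \<bullet> ((h (y t) / L) *\<^sub>R w (S t))"
        by simp
      also have "\<dots> = prim y t \<bullet> y t" by (simp only: wS[OF that] prim[OF that])
      finally show ?thesis using chain[OF dQ that] by simp
    qed
    then have "((\<lambda>t. prim y t \<bullet> y t) has_integral (Q (S 1) - Q (S 0))) {0..1}"
      by (intro fundamental_theorem_of_calculus) auto
    then show ?thesis by (simp add: cross_def Q_def S01 integral_unique)
  qed
  then have "act y = act w" by (simp add: act_def)
  also have "\<dots> \<le> maxact * en w" by (rule act_le[OF w])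
  also have "en w = integral {0..1::real} (\<lambda>r. L\<^sup>2 / 2)"
    unfolding en_def
  proof (rule integral_cong)
    fix r :: real assume "r \<in> {0..1}"
    from hyT[OF this] have "h (w r) = L" using l by (simp add: w_def h_scaleR)
    then show "(h (w r))\<^sup>2 / 2 = L\<^sup>2 / 2" by simp
  qed
  finally show ?thesis by (simp add: L_def)
qed

lemma inverse_maxact_le:
  assumes "loop y" "\<And>t. t \<in> {0..1} \<Longrightarrow> y t \<noteq> 0" "0 < act y"
  shows "1 / (2 * maxact) \<le> (integral {0..1} (\<lambda>t. h (y t)))\<^sup>2 / (4 * act y)"
proof -
  let ?M = "(integral {0..1} (\<lambda>t. h (y t)))\<^sup>2"
  have "2 * act y / maxact \<le> ?M"
    using act_le_length[OF assms(1,2)] maxact_pos by (simp add: pos_divide_le_eq mult.commute)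
  then have "2 * act y / maxact / (4 * act y) \<le> ?M / (4 * act y)"
    using assms(3) by (intro divide_right_mono) auto
  moreover have "2 * act y / maxact / (4 * act y) = 1 / (2 * maxact)" using assms(3) by (simp add: field_simps)
  ultimately show ?thesis by (simp only:)
qed

end

lemma smooth_on_vector_derivative:
  assumes "smooth_on UNIV (\<gamma> :: real \<Rightarrow> 'a::real_normed_vector)"
  shows "(\<gamma> has_vector_derivative vector_derivative \<gamma> (at t)) (at t)"
    and "continuous_on S (\<lambda>t. vector_derivative \<gamma> (at t))"
proof -
  have *: "(\<gamma> has_vector_derivative frechet_derivative \<gamma> (at t) 1) (at t)" for t
  proof -
    have d: "(\<gamma> has_derivative frechet_derivative \<gamma> (at t)) (at t)"
      by (rule smooth_on_has_derivative[OF assms UNIV_I])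
    have "frechet_derivative \<gamma> (at t) s = s *\<^sub>R frechet_derivative \<gamma> (at t) 1" for s
      by (rule linear_scale[OF has_derivative_linear[OF d], of s 1, unfolded real_scaleR_def mult_1_right])
    then show ?thesis
      unfolding has_vector_derivative_def by (intro has_derivative_eq_rhs[OF d] ext)
  qed
  then have eq: "vector_derivative \<gamma> (at t) = frechet_derivative \<gamma> (at t) 1" for t
    by (rule vector_derivative_at)
  show "(\<gamma> has_vector_derivative vector_derivative \<gamma> (at t)) (at t)" using * by (simp add: eq)
  show "continuous_on S (\<lambda>t. vector_derivative \<gamma> (at t))"
    unfolding eq
    using smooth_on_imp_continuous_on[OF smooth_on_frechet_derivative[OF assms, of 1]] continuous_on_subset
    by blast
qed

context phase_body
begin

text \<open>After orienting the curve along \<open>J N\<close>, it is given by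
  \<open>y = lam N\<close> with \<open>lam > 0\<close>. Because
  \<open>N \<bullet> \<gamma> = 1\<close> and \<open>h (N \<gamma>) = 1\<close>, the length and
  twice the action both equal the integral of \<open>lam\<close>.\<close>

lemma closed_characteristic_loop:
  assumes \<gamma>: "closed_characteristic D \<gamma>"
  obtains y where "loop y" "\<And>t. t \<in> {0..1} \<Longrightarrow> y t \<noteq> 0" "act y = \<bar>action \<gamma>\<bar>" "0 < act y"
    "integral {0..1} (\<lambda>t. h (y t)) = 2 * act y"
proof -
  have smooth: "smooth_on UNIV \<gamma>" and per: "\<And>t. \<gamma> (t + 2*pi) = \<gamma> t"
    and nz: "\<And>t. vector_derivative \<gamma> (at t) \<noteq> 0" and fr: "\<And>t. \<gamma> t \<in> frontier D"
    and char: "\<And>t. vector_derivative \<gamma> (at t) \<in> characteristic_line D (\<gamma> t)"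
    using \<gamma> unfolding closed_characteristic_def by blast+
  note der = smooth_on_vector_derivative[OF smooth]
  have gc: "continuous_on S \<gamma>" for S
    using smooth_on_imp_continuous_on[OF smooth] continuous_on_subset by blast
  have g1: "g (\<gamma> t) = 1" for t using fr by (simp add: frontier_iff_g)
  have Ng: "N (\<gamma> t) \<bullet> \<gamma> t = 1" for t by (simp add: N_inner g1)
  have g0: "\<gamma> t \<noteq> 0" for t using g1[of t] by (auto simp: g_zero)
  define c where "c t = J (\<gamma> t) \<bullet> vector_derivative \<gamma> (at t)" for t
  have vd: "vector_derivative \<gamma> (at t) = c t *\<^sub>R J (N (\<gamma> t))" for t
  proof -
    obtain r where r: "vector_derivative \<gamma> (at t) = r *\<^sub>R J (N (\<gamma> t))"
      using char[of t] unfolding characteristic_line_frontier[OF fr] by blast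
    then have "c t = r" using Ng[of t] by (simp add: c_def J_inner J_J inner_commute)
    with r show ?thesis by simp
  qed
  have cnz: "c t \<noteq> 0" for t using vd[of t] nz[of t] by auto
  have cc: "continuous_on S c" for S
    unfolding c_def by (intro continuous_intros gc der(2))
  \<comment> \<open>The factor \<open>c\<close> is continuous and without zeros, so it has one sign;
    \<open>\<sigma> = - 1\<close> means that the parametrisation runs against
    \<open>J N\<close>.\<close>
  obtain \<sigma> where \<sigma>: "\<sigma> = 1 \<or> \<sigma> = - 1" "\<And>t. 0 < \<sigma> * c t"
  proof (cases "0 < c 0")
    case True
    have "0 < 1 * c t" for t
    proof (rule ccontr)
      assume "\<not> 0 < 1 * c t"
      then have "0 \<in> closed_segment (c 0) (c t)" using True by (simp add: closed_segment_eq_real_ivl)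
      from IVT'_closed_segment_real[OF this cc] cnz show False by blast
    qed
    then show ?thesis using that by blast
  next
    case False
    have "0 < - 1 * c t" for t
    proof (rule ccontr)
      assume "\<not> 0 < - 1 * c t"
      then have "0 \<in> closed_segment (c 0) (c t)" using False by (simp add: closed_segment_eq_real_ivl)
      from IVT'_closed_segment_real[OF this cc] cnz show False by blast
    qed
    then show ?thesis using that by blast
  qed
  \<comment> \<open>The starting time: a reversed curve runs from \<open>2 * pi\<close> back to 0,
    so that \<open>\<phi>\<close> stays in one period and the action integral is recovered
    exactly.\<close>
  define p where "p = (if \<sigma> = 1 then 0 else 2 * pi)"
  define \<phi> where "\<phi> t = p + (\<sigma> * (2 * pi)) * t" for t
  have phi01: "\<phi> 0 = p" "\<phi> 1 = 2 * pi - p" using \<sigma>(1) by (auto simp: \<phi>_def p_def)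
  have phi_mem: "\<phi> t \<in> {0..2 * pi}" if "t \<in> {0..1}" for t
    using \<sigma>(1) that by (auto simp: \<phi>_def p_def)
  have dphi: "(\<phi> has_vector_derivative \<sigma> * (2 * pi)) (at t within S)" for t S
    unfolding \<phi>_def has_real_derivative_iff_has_vector_derivative[symmetric]
    by (auto intro!: derivative_eq_intros)
  have phic: "continuous_on S \<phi>" for S unfolding \<phi>_def by (intro continuous_intros)
  define lam where "lam t = \<sigma> * (2 * pi) * c (\<phi> t)" for t
  have lpos: "0 < lam t" for t
    using mult_pos_pos[OF \<sigma>(2)[of "\<phi> t"], of "2 * pi"] by (simp add: lam_def mult_ac)
  have lc: "continuous_on S lam" for S
    unfolding lam_def by (intro continuous_intros continuous_on_compose2[OF cc[of UNIV] phic]) auto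
  define y where "y t = lam t *\<^sub>R N (\<gamma> (\<phi> t))" for t
  have gphi: "continuous_on S (\<lambda>t. \<gamma> (\<phi> t))" for S
    by (rule continuous_on_compose2[OF gc[of UNIV] phic]) auto
  have "continuous_on {0..1} (\<lambda>t. N (\<gamma> (\<phi> t)))"
    by (intro continuous_on_compose2[OF N_continuous gphi]) (use g0 in auto)
  then have yc: "continuous_on {0..1} y" unfolding y_def by (intro continuous_intros lc)
  have "((\<lambda>t. \<gamma> (\<phi> t)) has_vector_derivative J (y t)) (at t within {0..1})" for t
    using vector_diff_chain_within[OF dphi[of t "{0..1}"] has_vector_derivative_at_within[OF der(1)[of "\<phi> t"]]]
    by (simp add: o_def vd y_def lam_def J_simps)
  then have prim: "prim y t = \<gamma> (\<phi> t) - \<gamma> p" if "t \<in> {0..1}" for t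
    using prim_eqI[of "\<lambda>t. \<gamma> (\<phi> t)" y t] that by (simp add: phi01)
  have "\<gamma> (2 * pi - p) = \<gamma> p" using per[of 0] \<sigma>(1) by (auto simp: p_def)
  then have "integral {0..1} y = 0"
    using integral_y_eq_prim[OF yc, of 1] prim[of 1] by (simp add: phi01 J_simps)
  then have y: "loop y" using yc by (simp add: loop_def)
  have yi: "y integrable_on {0..1}" by (intro integrable_continuous_real yc)
  have "cross y y = integral {0..1} (\<lambda>t. \<gamma> (\<phi> t) \<bullet> y t - \<gamma> p \<bullet> y t)"
    unfolding cross_def by (rule integral_cong) (simp add: prim inner_diff_left)
  also have "\<dots> = integral {0..1} (\<lambda>t. \<gamma> (\<phi> t) \<bullet> y t) - \<gamma> p \<bullet> integral {0..1} y"
    unfolding integral_inner_right[OF yi, symmetric]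
    by (intro Henstock_Kurzweil_Integration.integral_diff integrable_continuous_real continuous_intros gphi yc)
  also have "integral {0..1} (\<lambda>t. \<gamma> (\<phi> t) \<bullet> y t) = integral {0..1} lam"
    by (rule integral_cong) (simp add: y_def inner_commute[of "\<gamma> _"] Ng)
  finally have act: "act y = integral {0..1} lam / 2"
    using y by (simp add: loop_def act_def)
  have hy: "h (y t) = lam t" for t
  proof -
    have "\<gamma> (\<phi> t) \<bullet> N (\<gamma> (\<phi> t)) \<le> g (\<gamma> (\<phi> t)) * h (N (\<gamma> (\<phi> t)))" by (rule inner_le_g_h)
    then have "h (N (\<gamma> (\<phi> t))) = 1"
      using h_N_le[of "\<gamma> (\<phi> t)"] Ng[of "\<phi> t"] by (simp add: g1 inner_commute)
    then show ?thesis using lpos[of t] by (simp add: y_def h_scaleR)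
  qed
  have ih: "integral {0..1} (\<lambda>t. h (y t)) = 2 * act y" by (simp add: hy act)
  have "0 < integral {0..1} lam"
  proof -
    have "\<exists>t\<in>{0..1}. \<forall>s\<in>{0..1}. lam t \<le> lam s"
      by (rule continuous_attains_inf[OF _ _ lc]) auto
    then obtain m where m: "0 < m" "\<And>s. s \<in> {0..1} \<Longrightarrow> m \<le> lam s" using lpos by metis
    then have "integral {0..1::real} (\<lambda>t. m) \<le> integral {0..1} lam"
      by (intro integral_le integrable_continuous_real lc) auto
    with m(1) show ?thesis by simp
  qed
  then have pos: "0 < act y" by (simp add: act)
  have "integral {0..1} lam = \<sigma> * integral {0..2 * pi} c"
  proof -
    define C where "C t = integral {0..t} c" for t
    have dC: "(C has_vector_derivative c t) (at t within {0..2 * pi})" if "t \<in> {0..2 * pi}" for t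
      unfolding C_def using that by (intro integral_has_vector_derivative cc)
    have "((\<lambda>t. C (\<phi> t)) has_vector_derivative lam t) (at t within {0..1})" if "t \<in> {0..1}" for t
    proof -
      have "(C has_vector_derivative c (\<phi> t)) (at (\<phi> t) within \<phi> ` {0..1})"
        by (rule has_vector_derivative_within_subset[OF dC[OF phi_mem[OF that]]])
          (rule image_subsetI, rule phi_mem)
      from vector_diff_chain_within[OF dphi this] show ?thesis
        by (simp add: o_def lam_def)
    qed
    then have "(lam has_integral (C (\<phi> 1) - C (\<phi> 0))) {0..1}"
      by (intro fundamental_theorem_of_calculus) auto
    moreover have "C (\<phi> 1) - C (\<phi> 0) = \<sigma> * C (2 * pi)"
      using \<sigma>(1) by (auto simp: phi01 p_def C_def)
    ultimately show ?thesis by (simp add: integral_unique C_def)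
  qed
  then have "act y = \<sigma> * action \<gamma>" by (simp add: act action_def c_def[abs_def])
  with pos \<sigma>(1) have "act y = \<bar>action \<gamma>\<bar>" by auto
  moreover have "y t \<noteq> 0" for t
    using lpos[of t] hy[of t] by (auto simp: h_zero)
  ultimately show thesis using that[OF y _ _ pos ih] by blast
qed

text \<open>On a closed characteristic the length is twice the action, so the quotient bounded by
  \<open>inverse_maxact_le\<close> is the action itself.\<close>

lemma abs_action_ge:
  assumes "closed_characteristic D \<gamma>"
  shows "1 / (2 * maxact) \<le> \<bar>action \<gamma>\<bar>"
proof -
  obtain y where y: "loop y" "\<And>t. t \<in> {0..1} \<Longrightarrow> y t \<noteq> 0" "act y = \<bar>action \<gamma>\<bar>" "0 < act y"
    "integral {0..1} (\<lambda>t. h (y t)) = 2 * act y"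
    using closed_characteristic_loop[OF assms] by blast
  have "(2 * act y)\<^sup>2 / (4 * act y) = act y" using y(4) by (simp add: power2_eq_square)
  then show ?thesis using inverse_maxact_le[OF y(1,2,4)] y(3,5) by simp
qed

lemma c_EHZ_eq: "c_EHZ D = 1 / (2 * maxact)"
  unfolding c_EHZ_def
proof (rule Least_equality)
  obtain \<gamma> where \<gamma>: "closed_characteristic D \<gamma>" "action \<gamma> = 1 / (2 * maxact)"
    by (rule exists_closed_characteristic)
  then have "\<bar>action \<gamma>\<bar> = 1 / (2 * maxact)" using maxact_pos by simp
  with \<gamma>(1) show "1 / (2 * maxact) \<in> {\<bar>action \<gamma>\<bar> |\<gamma>. closed_characteristic D \<gamma>}" by force
qed (use abs_action_ge in auto)

lemma c_EHZ_attained: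
  obtains y where "loop y" "\<And>t. t \<in> {0..1} \<Longrightarrow> y t \<noteq> 0" "0 < act y"
    "c_EHZ D = (integral {0..1} (\<lambda>t. h (y t)))\<^sup>2 / (4 * act y)"
proof -
  obtain \<gamma> where \<gamma>: "closed_characteristic D \<gamma>" "action \<gamma> = 1 / (2 * maxact)"
    by (rule exists_closed_characteristic)
  obtain y where y: "loop y" "\<And>t. t \<in> {0..1} \<Longrightarrow> y t \<noteq> 0" "act y = \<bar>action \<gamma>\<bar>" "0 < act y"
    "integral {0..1} (\<lambda>t. h (y t)) = 2 * act y"
    using closed_characteristic_loop[OF \<gamma>(1)] by blast
  have "(2 * act y)\<^sup>2 / (4 * act y) = act y" using y(4) by (simp add: power2_eq_square)
  moreover have "c_EHZ D = act y" using \<gamma>(2) y(3) maxact_pos by (simp add: c_EHZ_eq)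
  ultimately show thesis using that[OF y(1,2,4)] y(5) by simp
qed

end

section \<open>Translations and smoothing\<close>

lemma smooth_on_translate:
  fixes f :: "'a::euclidean_space \<Rightarrow> 'b::real_normed_vector"
  assumes "open U" "smooth_on U f"
  shows "smooth_on ((\<lambda>x. x - p) ` U) (\<lambda>y. f (y + p))"
  unfolding smooth_on_def
proof
  fix k
  have o: "open ((\<lambda>x. x - p) ` U)" using assms(1) by (rule open_translation_subtract)
  have "Ck_on k ((\<lambda>x. x - p) ` U) (\<lambda>y. y + p)"
    by (intro Ck_on_add o Ck_on_const Ck_on_bounded_linear bounded_linear_ident)
  then show "Ck_on k ((\<lambda>x. x - p) ` U) (\<lambda>y. f (y + p))"
    by (intro Ck_on_compose[OF o assms(1) _ smooth_on_Ck_on[OF assms(2)]]) auto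
qed

lemma smooth_hypersurface_translate:
  assumes "smooth_hypersurface S"
  shows "smooth_hypersurface ((\<lambda>x. x - p) ` S)"
  unfolding smooth_hypersurface_def
proof
  fix y assume "y \<in> (\<lambda>x. x - p) ` S"
  then have "y + p \<in> S" by auto
  then obtain U \<rho> where U: "open U" "y + p \<in> U" "smooth_on U \<rho>"
    "\<And>x. x \<in> U \<Longrightarrow> frechet_derivative \<rho> (at x) \<noteq> (\<lambda>_. 0 :: real)" "S \<inter> U = {x\<in>U. \<rho> x = 0}"
    using assms unfolding smooth_hypersurface_def by meson
  let ?U = "(\<lambda>x. x - p) ` U" and ?\<rho> = "\<lambda>y. \<rho> (y + p)"
  have "frechet_derivative ?\<rho> (at x) \<noteq> (\<lambda>_. 0)" if "x \<in> ?U" for x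
  proof -
    have x: "x + p \<in> U" using that by auto
    have "((\<lambda>y. y + p) has_derivative (\<lambda>v. v)) (at x)" by (auto intro!: derivative_eq_intros)
    from has_derivative_compose[OF this smooth_on_has_derivative[OF U(3) x]]
    have "frechet_derivative \<rho> (at (x + p)) = frechet_derivative ?\<rho> (at x)"
      by (rule frechet_derivative_at)
    with U(4)[OF x] show ?thesis by simp
  qed
  moreover have "(\<lambda>x. x - p) ` S \<inter> ?U = {y\<in>?U. ?\<rho> y = 0}"
  proof -
    have "(\<lambda>x. x - p) ` S \<inter> ?U = (\<lambda>x. x - p) ` (S \<inter> U)" by (rule image_Int[symmetric]) (simp add: inj_on_def)
    then show ?thesis unfolding U(5) by auto
  qed
  moreover have "y \<in> ?U" using U(2) by (intro image_eqI[of _ _ "y + p"]) auto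
  ultimately show "\<exists>U (\<rho> :: 'a \<Rightarrow> real). open U \<and> y \<in> U \<and> smooth_on U \<rho> \<and>
        (\<forall>y\<in>U. frechet_derivative \<rho> (at y) \<noteq> (\<lambda>_. 0)) \<and>
        (\<lambda>x. x - p) ` S \<inter> U = {y\<in>U. \<rho> y = 0}"
    using smooth_on_translate[OF U(1,3)] open_translation_subtract[OF U(1)]
    by (intro exI[of _ ?U] exI[of _ ?\<rho>] conjI ballI)
qed

lemma frontier_translate: "frontier ((\<lambda>x. x - p) ` S) = (\<lambda>x. x - p) ` frontier (S :: 'a::euclidean_space set)"
  using frontier_translation[of "- p" S] by simp

lemma smooth_convex_body_translate:
  assumes "smooth_convex_body S" "p \<in> interior S"
  shows "phase_body ((\<lambda>x. x - p) ` S)"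
proof
  have S: "compact S" "convex S" "smooth_hypersurface (frontier S)"
    using assms(1) by (auto simp: smooth_convex_body_def convex_body_def)
  show "compact ((\<lambda>x. x - p) ` S)" using S(1) by (rule compact_translation_subtract)
  show "convex ((\<lambda>x. x - p) ` S)" using S(2) by (rule convex_translation_subtract)
  have "interior ((\<lambda>x. x - p) ` S) = (\<lambda>x. x - p) ` interior S"
    using interior_translation[of "- p" S] by simp
  then show "0 \<in> interior ((\<lambda>x. x - p) ` S)" using assms(2) by force
  show "smooth_hypersurface (frontier ((\<lambda>x. x - p) ` S))"
    unfolding frontier_translate by (rule smooth_hypersurface_translate[OF S(3)])
qed

lemma smooth_on_diff_const:
  fixes c :: "real \<Rightarrow> 'a::real_normed_vector"
  assumes "open I" "smooth_on I c"
  shows "smooth_on I (\<lambda>t. c t - p)"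
  unfolding smooth_on_def
  using Ck_on_add[OF assms(1) smooth_on_Ck_on[OF assms(2)] Ck_on_const, of _ "- p"] by simp

lemma tangent_space_translate_subset:
  "tangent_space S x \<subseteq> tangent_space ((\<lambda>x. x - p) ` S) (x - p)"
proof
  fix v assume "v \<in> tangent_space S x"
  then obtain c \<epsilon> where c: "0 < \<epsilon>" "smooth_on {-\<epsilon><..<\<epsilon>} c" "\<And>t. t \<in> {-\<epsilon><..<\<epsilon>} \<Longrightarrow> c t \<in> S"
    "c (0::real) = x" "(c has_vector_derivative v) (at 0)"
    unfolding tangent_space_def by blast
  have "((\<lambda>t. c t - p) has_vector_derivative v) (at 0)"
    using c(5) by (auto intro!: derivative_eq_intros)
  moreover have "smooth_on {-\<epsilon><..<\<epsilon>} (\<lambda>t. c t - p)"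
    by (rule smooth_on_diff_const[OF _ c(2)]) simp
  ultimately show "v \<in> tangent_space ((\<lambda>x. x - p) ` S) (x - p)"
    unfolding tangent_space_def using c(1,3,4) by blast
qed

lemma tangent_space_translate:
  "tangent_space ((\<lambda>x. x - p) ` S) (x - p) = tangent_space S x"
proof
  have "(\<lambda>x. x - (- p)) ` (\<lambda>x. x - p) ` S = S" by (simp add: image_image)
  then show "tangent_space ((\<lambda>x. x - p) ` S) (x - p) \<subseteq> tangent_space S x"
    using tangent_space_translate_subset[of "(\<lambda>x. x - p) ` S" "x - p" "- p"] by simp
qed (rule tangent_space_translate_subset)

text \<open>The action is unaffected because the constant \<open>J p\<close> is paired with the
  integral of the velocity, which is zero on a closed curve.\<close>

lemma closed_characteristic_translate:
  assumes "closed_characteristic S \<gamma>"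
  shows "closed_characteristic ((\<lambda>x. x - p) ` S) (\<lambda>t. \<gamma> t - p)" "action (\<lambda>t. \<gamma> t - p) = action \<gamma>"
proof -
  have smooth: "smooth_on UNIV \<gamma>" and per: "\<And>t. \<gamma> (t + 2*pi) = \<gamma> t"
    using assms unfolding closed_characteristic_def by blast+
  note der = smooth_on_vector_derivative[OF smooth]
  have vd: "vector_derivative (\<lambda>t. \<gamma> t - p) (at t) = vector_derivative \<gamma> (at t)" for t
    using der(1)[of t] by (intro vector_derivative_at) (auto intro!: derivative_eq_intros)
  have "inj_on (\<lambda>t. \<gamma> t - p) {0..<2 * pi}"
    using assms unfolding closed_characteristic_def inj_on_def by simp
  then show "closed_characteristic ((\<lambda>x. x - p) ` S) (\<lambda>t. \<gamma> t - p)"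
    using assms smooth_on_diff_const[OF open_UNIV smooth]
    unfolding closed_characteristic_def characteristic_line_def frontier_translate tangent_space_translate vd
    by simp
  have gc: "continuous_on {0..2 * pi} \<gamma>"
    using smooth_on_imp_continuous_on[OF smooth] continuous_on_subset by blast
  have "((\<lambda>t. vector_derivative \<gamma> (at t)) has_integral (\<gamma> (2 * pi) - \<gamma> 0)) {0..2 * pi}"
    by (rule fundamental_theorem_of_calculus[OF _ has_vector_derivative_at_within[OF der(1)]]) simp
  then have int0: "integral {0..2 * pi} (\<lambda>t. vector_derivative \<gamma> (at t)) = 0"
    using per[of 0] by (simp add: integral_unique)
  have "integral {0..2 * pi} (\<lambda>t. J (\<gamma> t - p) \<bullet> vector_derivative \<gamma> (at t))
      = integral {0..2 * pi} (\<lambda>t. J (\<gamma> t) \<bullet> vector_derivative \<gamma> (at t))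
        - integral {0..2 * pi} (\<lambda>t. J p \<bullet> vector_derivative \<gamma> (at t))"
    unfolding J_simps inner_diff_left
    by (intro Henstock_Kurzweil_Integration.integral_diff integrable_continuous_real continuous_intros gc der(2))
  also have "integral {0..2 * pi} (\<lambda>t. J p \<bullet> vector_derivative \<gamma> (at t)) = 0"
    by (subst integral_inner_right) (simp_all add: int0 integrable_continuous_real der(2))
  finally show "action (\<lambda>t. \<gamma> t - p) = action \<gamma>" by (simp add: action_def vd)
qed

lemma c_EHZ_translate: "c_EHZ ((\<lambda>x. x - p) ` S) = c_EHZ S"
proof -
  have inv: "(\<lambda>x. x - (- p)) ` (\<lambda>x. x - p) ` S = S" by (simp add: image_image)
  have "{\<bar>action \<gamma>\<bar> |\<gamma>. closed_characteristic ((\<lambda>x. x - p) ` S) \<gamma>} = {\<bar>action \<gamma>\<bar> |\<gamma>. closed_characteristic S \<gamma>}"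
  proof (intro equalityI subsetI; elim CollectE exE conjE)
    fix a \<gamma> assume a: "a = \<bar>action \<gamma>\<bar>" and \<gamma>: "closed_characteristic ((\<lambda>x. x - p) ` S) \<gamma>"
    from closed_characteristic_translate[OF \<gamma>, of "- p", unfolded inv] a
    show "a \<in> {\<bar>action \<gamma>\<bar> |\<gamma>. closed_characteristic S \<gamma>}"
      by (intro CollectI exI[of _ "\<lambda>t. \<gamma> t - (- p)"] conjI) (simp_all only:)
  next
    fix a \<gamma> assume a: "a = \<bar>action \<gamma>\<bar>" and \<gamma>: "closed_characteristic S \<gamma>"
    from closed_characteristic_translate[OF \<gamma>, of p] a
    show "a \<in> {\<bar>action \<gamma>\<bar> |\<gamma>. closed_characteristic ((\<lambda>x. x - p) ` S) \<gamma>}"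
      by (intro CollectI exI[of _ "\<lambda>t. \<gamma> t - p"] conjI) (simp_all only:)
  qed
  then show ?thesis by (simp add: c_EHZ_def)
qed

text \<open>The translation adds a linear term, which integrates to zero over a loop. Together with
  \<open>c_EHZ_translate\<close> this removes the condition on the origin from the length
  formulas.\<close>

lemma integral_support_fn_translate:
  assumes "compact S" "S \<noteq> {}" "loop y"
  shows "integral {0..1} (\<lambda>t. support_fn ((\<lambda>x. x - p) ` S) (y t)) = integral {0..1} (\<lambda>t. support_fn S (y t))"
proof -
  note yc = loop_continuous[OF assms(3)]
  have yi: "y integrable_on {0..1}" by (intro integrable_continuous_real yc)
  have "integral {0..1} (\<lambda>t. support_fn S (y t) - p \<bullet> y t)
      = integral {0..1} (\<lambda>t. support_fn S (y t)) - integral {0..1} (\<lambda>t. p \<bullet> y t)"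
    by (intro Henstock_Kurzweil_Integration.integral_diff integrable_continuous_real continuous_intros yc
        continuous_on_compose2[OF continuous_on_support_fn[OF assms(1,2)] yc]) auto
  then show ?thesis
    using assms(3) by (simp add: support_fn_translate[OF assms(1,2)] integral_inner_right[OF yi] loop_def)
qed

lemma smooth_convex_bodyD:
  assumes "smooth_convex_body S"
  shows "compact S" "convex S" "S \<noteq> {}" "interior S \<noteq> {}"
  using assms interior_subset by (auto simp: smooth_convex_body_def convex_body_def)

theorem c_EHZ_le_length:
  assumes S: "smooth_convex_body S"
    and y: "loop y" "\<And>t. t \<in> {0..1} \<Longrightarrow> y t \<noteq> 0" "0 < act y"
  shows "c_EHZ S \<le> (integral {0..1} (\<lambda>t. support_fn S (y t)))\<^sup>2 / (4 * act y)"
proof -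
  note S' = smooth_convex_bodyD[OF S]
  obtain p where "p \<in> interior S" using S'(4) by blast
  interpret phase_body "(\<lambda>x. x - p) ` S" by (rule smooth_convex_body_translate[OF S \<open>p \<in> interior S\<close>])
  show ?thesis
    using inverse_maxact_le[OF y] c_EHZ_eq
    by (simp add: c_EHZ_translate integral_support_fn_translate[OF S'(1,3) y(1)])
qed

theorem c_EHZ_eq_length:
  assumes S: "smooth_convex_body S"
  obtains y where "loop y" "\<And>t. t \<in> {0..1} \<Longrightarrow> y t \<noteq> 0" "0 < act y"
    "c_EHZ S = (integral {0..1} (\<lambda>t. support_fn S (y t)))\<^sup>2 / (4 * act y)"
proof -
  note S' = smooth_convex_bodyD[OF S]
  obtain p where "p \<in> interior S" using S'(4) by blast
  interpret phase_body "(\<lambda>x. x - p) ` S" by (rule smooth_convex_body_translate[OF S \<open>p \<in> interior S\<close>])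
  obtain y where y: "loop y" "\<And>t. t \<in> {0..1} \<Longrightarrow> y t \<noteq> 0" "0 < act y"
    "c_EHZ ((\<lambda>x. x - p) ` S) = (integral {0..1} (\<lambda>t. h (y t)))\<^sup>2 / (4 * act y)"
    by (rule c_EHZ_attained) blast
  show thesis
    using that[OF y(1-3)] y(4) by (simp add: c_EHZ_translate integral_support_fn_translate[OF S'(1,3) y(1)])
qed

section \<open>Outer approximation by smooth bodies\<close>

lemma Ck_on_exp_affine: "Ck_on k UNIV (\<lambda>x::'a::euclidean_space. exp (m * (x \<bullet> b - c)))"
proof (induction k)
  case 0
  show ?case by (auto intro!: continuous_intros)
next
  case (Suc k)
  show ?case
  proof (rule Ck_on_SucI[OF open_UNIV])
    show "((\<lambda>x. exp (m * (x \<bullet> b - c))) has_derivative (\<lambda>v. (m * (v \<bullet> b)) * exp (m * (x \<bullet> b - c)))) (at x)" for x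
      by (auto intro!: derivative_eq_intros)
    show "Ck_on k UNIV (\<lambda>x. (m * (v \<bullet> b)) * exp (m * (x \<bullet> b - c)))" for v
      by (rule Ck_on_mult[OF open_UNIV Ck_on_const Suc])
  qed
qed

text \<open>
  Smoothing by a log-sum-exp function: the half spaces \<open>x \<bullet> b \<le> support_fn C b\<close>, for \<open>b\<close> in a finite
  net of the unit sphere, are replaced by a bound on the sum of the exponentials of their defects.
\<close>

theorem exists_smooth_convex_body_approx:
  fixes C :: "'a::euclidean_space set"
  assumes C: "convex_body C" and e: "0 < e"
  obtains S where "smooth_convex_body S" "C \<subseteq> S" "\<And>y. support_fn S y \<le> support_fn C y + e * norm y"
proof -
  have C': "compact C" "convex C" "interior C \<noteq> {}" using C by (auto simp: convex_body_def)
  then have "C \<noteq> {}" using interior_subset by blast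
  note C' = C' this
  let ?h = "support_fn C"
  obtain Rc where Rc: "0 < Rc" "\<And>x. x \<in> C \<Longrightarrow> norm x \<le> Rc"
    using compact_imp_bounded[OF C'(1)] by (auto simp: bounded_pos)
  \<comment> \<open>An a priori radius for \<open>S\<close>: the directions from
    \<open>Basis\<close> and their negatives bound each coordinate by \<open>Rc + 1\<close>, and the
    sum of the coordinates bounds the norm.\<close>
  define R where "R = DIM('a) * (Rc + 1)"
  have R: "Rc \<le> R" "0 < R"
  proof -
    have "1 * (Rc + 1) \<le> R" unfolding R_def using Rc(1) DIM_positive[where 'a = 'a] by (intro mult_right_mono) auto
    then show "Rc \<le> R" "0 < R" using Rc(1) by auto
  qed
  \<comment> \<open>Passing from a unit vector to the net costs \<open>R * \<delta>\<close> twice,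
    for the point and for the support function: \<open>e / 2\<close> in all. The other half of
    \<open>e\<close> is for the smoothing error \<open>\<eta>\<close>.\<close>
  define \<delta> where "\<delta> = e / (4 * R)"
  define \<eta> where "\<eta> = min 1 (e / 2)"
  have d: "0 < \<delta>" "\<delta> * R = e / 4" using e R by (auto simp: \<delta>_def)
  have et: "0 < \<eta>" "\<eta> \<le> 1" "\<eta> \<le> e / 2" using e by (auto simp: \<eta>_def)
  have "\<exists>F. finite F \<and> F \<subseteq> sphere 0 1 \<and> sphere (0::'a) 1 \<subseteq> (\<Union>x\<in>F. ball x \<delta>)"
    by (rule seq_compact_imp_totally_bounded[OF compact_imp_seq_compact[OF compact_sphere], rule_format, OF d(1)])
  then obtain F where F: "finite F" "F \<subseteq> sphere 0 1" "sphere (0::'a) 1 \<subseteq> (\<Union>x\<in>F. ball x \<delta>)"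
    by (elim exE conjE)
  define B where "B = F \<union> Basis \<union> uminus ` Basis"
  have B: "finite B" "\<And>b. b \<in> B \<Longrightarrow> norm b = 1" using F by (auto simp: B_def)
  have "B \<noteq> {}" by (simp add: B_def)
  then have N: "1 \<le> real (card B)" using B(1) card_gt_0_iff[of B] by linarith
  \<comment> \<open>If a sum of exponentials is at most \<open>card B\<close>, each exponent is at
    most \<open>ln (card B)\<close>, so each defect is at most
    \<open>ln (card B) / m \<le> \<eta>\<close>. The added 1 makes \<open>m\<close>
    positive.\<close>
  define m where "m = (ln (card B) + 1) / \<eta>"
  have m: "0 < m" "ln (card B) \<le> m * \<eta>" using N et by (auto simp: m_def intro!: divide_pos_pos add_nonneg_pos)
  define \<psi> where "\<psi> x b = exp (m * (x \<bullet> b - ?h b))" for x b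
  define \<phi> where "\<phi> x = (\<Sum>b\<in>B. \<psi> x b)" for x
  define G where "G x = (\<Sum>b\<in>B. (m * \<psi> x b) *\<^sub>R b)" for x
  \<comment> \<open>On \<open>C\<close> each of the \<open>card B\<close> summands is at most 1,
    hence this level.\<close>
  define S where "S = {x. \<phi> x \<le> card B}"
  have grad: "\<phi> y \<ge> \<phi> x + G x \<bullet> (y - x)" for x y
  proof -
    have "\<psi> x b + (m * \<psi> x b) * (b \<bullet> (y - x)) \<le> \<psi> y b" for b
    proof -
      have "\<psi> x b * (1 + m * (b \<bullet> (y - x))) \<le> \<psi> x b * exp (m * (b \<bullet> (y - x)))"
        by (intro mult_left_mono exp_ge_add_one_self) (simp add: \<psi>_def)
      also have "\<dots> = \<psi> y b"
        unfolding \<psi>_def by (simp add: exp_add[symmetric] inner_diff_right inner_commute algebra_simps)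
      finally show ?thesis by (simp add: algebra_simps)
    qed
    then have "(\<Sum>b\<in>B. \<psi> x b + (m * \<psi> x b) * (b \<bullet> (y - x))) \<le> \<phi> y"
      unfolding \<phi>_def by (intro sum_mono)
    then show ?thesis by (simp add: \<phi>_def G_def sum.distrib inner_sum_left)
  qed
  have \<psi>c: "continuous_on UNIV (\<lambda>x. \<psi> x b)" for b unfolding \<psi>_def by (intro continuous_intros)
  have \<phi>c: "continuous_on UNIV \<phi>" unfolding \<phi>_def by (intro continuous_intros \<psi>c)
  have "continuous_on UNIV G" unfolding G_def by (intro continuous_intros \<psi>c)
  then have \<phi>d: "(\<phi> has_derivative (\<lambda>v. G x \<bullet> v)) (at x)" for x
    by (intro subgradient_selection_has_derivative grad) (simp add: continuous_on_eq_continuous_at)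
  have sub: "C \<subseteq> S"
  proof
    fix x assume "x \<in> C"
    then have "\<psi> x b \<le> 1" for b
      using support_fn_upper[OF C'(1), of x b] m(1) by (simp add: \<psi>_def mult_le_0_iff)
    then have "\<phi> x \<le> (\<Sum>b\<in>B. 1)" unfolding \<phi>_def by (intro sum_mono)
    then show "x \<in> S" by (simp add: S_def)
  qed
  have S_le: "x \<bullet> b \<le> ?h b + \<eta>" if "x \<in> S" "b \<in> B" for x b
  proof -
    have "\<psi> x b \<le> \<phi> x" unfolding \<phi>_def
      by (rule member_le_sum[OF that(2) _ B(1)]) (simp add: \<psi>_def)
    then have "exp (m * (x \<bullet> b - ?h b)) \<le> card B" using that(1) by (simp add: S_def \<psi>_def)
    then have "m * (x \<bullet> b - ?h b) \<le> ln (card B)" using N by (simp add: ln_ge_iff)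
    then have "m * (x \<bullet> b - ?h b) \<le> m * \<eta>" using m(2) by linarith
    then show ?thesis using m(1) by simp
  qed
  have h_le: "?h b \<le> Rc" if "norm b = 1" for b
    using support_fn_le_norm[OF C'(4) Rc(2), of b] that by simp
  have S_norm: "norm x \<le> R" if "x \<in> S" for x
  proof -
    have "\<bar>x \<bullet> b\<bar> \<le> Rc + 1" if b: "b \<in> Basis" for b
      using S_le[OF \<open>x \<in> S\<close>, of b] S_le[OF \<open>x \<in> S\<close>, of "- b"] h_le[of b] h_le[of "- b"] b et(2)
      by (auto simp: B_def)
    then have "(\<Sum>b\<in>Basis. \<bar>x \<bullet> b\<bar>) \<le> R"
      unfolding R_def using sum_bounded_above[of Basis "\<lambda>b. \<bar>x \<bullet> b\<bar>" "Rc + 1"] by simp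
    then show ?thesis using norm_le_l1[of x] by linarith
  qed
  have unit: "x \<bullet> b \<le> ?h b + e" if x: "x \<in> S" and b: "norm b = 1" for x b
  proof -
    obtain b' where b': "b' \<in> F" "dist b' b < \<delta>" using F(3) b by auto
    have nb: "norm (b - b') \<le> \<delta>" using b'(2) by (simp add: dist_norm norm_minus_commute)
    have "x \<bullet> b = x \<bullet> b' + x \<bullet> (b - b')" by (simp add: inner_diff_right)
    also have "x \<bullet> (b - b') \<le> R * \<delta>"
      using norm_cauchy_schwarz[of x "b - b'"] mult_mono[OF S_norm[OF x] nb] R(2) by auto
    also have "x \<bullet> b' \<le> ?h b' + \<eta>" using S_le[OF x] b'(1) by (simp add: B_def)
    also have "?h b' \<le> ?h b + Rc * norm (b' - b)"
      using support_fn_diff_le[OF C'(1,4) Rc(2), of b' b] by simp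
    also have "Rc * norm (b' - b) \<le> R * \<delta>"
      using nb R Rc(1) by (intro mult_mono) (auto simp: norm_minus_commute)
    finally show ?thesis using d(2) et(3) by (simp add: mult.commute)
  qed
  have "S \<noteq> {}" using sub C'(4) by auto
  have supp: "support_fn S y \<le> ?h y + e * norm y" for y
  proof (rule support_fn_least[OF \<open>S \<noteq> {}\<close>])
    fix x assume x: "x \<in> S"
    show "x \<bullet> y \<le> ?h y + e * norm y"
    proof (cases "y = 0")
      case True
      then show ?thesis using support_fn_scaleR[OF C'(1,4), of 0 0] by simp
    next
      case False
      define b where "b = (1 / norm y) *\<^sub>R y"
      have b: "norm b = 1" "y = norm y *\<^sub>R b" using False by (auto simp: b_def)
      have "x \<bullet> y = norm y * (x \<bullet> b)" by (subst b(2)) simp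
      also have "\<dots> \<le> norm y * (?h b + e)" by (intro mult_left_mono unit x b) simp
      also have "\<dots> = norm y * ?h b + e * norm y" by (simp add: algebra_simps)
      also have "norm y * ?h b = ?h y"
        using support_fn_scaleR[OF C'(1,4), of "norm y" b] b(2) by simp
      finally show ?thesis .
    qed
  qed
  have "convex S"
  proof (rule convexI)
    fix x y u v :: 'a and s t :: real
    assume xy: "x \<in> S" "y \<in> S" and st: "0 \<le> s" "0 \<le> t" "s + t = 1"
    let ?z = "s *\<^sub>R x + t *\<^sub>R y"
    \<comment> \<open>Jensen's inequality from the tangent plane of \<open>\<phi>\<close> at
      \<open>?z\<close>; the linear terms cancel.\<close>
    have "s * (\<phi> ?z + G ?z \<bullet> (x - ?z)) + t * (\<phi> ?z + G ?z \<bullet> (y - ?z)) \<le> s * card B + t * card B"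
      using xy order_trans[OF grad] by (intro add_mono mult_left_mono st) (auto simp: S_def)
    moreover have "s * (\<phi> ?z + G ?z \<bullet> (x - ?z)) + t * (\<phi> ?z + G ?z \<bullet> (y - ?z))
        = (s + t) * \<phi> ?z + G ?z \<bullet> (s *\<^sub>R (x - ?z) + t *\<^sub>R (y - ?z))"
      by (simp add: inner_add_right algebra_simps)
    moreover have "s *\<^sub>R (x - ?z) + t *\<^sub>R (y - ?z) = ?z - (s + t) *\<^sub>R ?z" by (simp add: algebra_simps)
    moreover have "s * card B + t * card B = card B" using st(3) by (metis distrib_right mult_1)
    ultimately show "?z \<in> S" using st(3) by (simp add: S_def)
  qed
  moreover have "compact S"
  proof -
    have "closed S" unfolding S_def by (intro closed_Collect_le \<phi>c continuous_intros)
    moreover have "bounded S" using S_norm by (auto simp: bounded_iff)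
    ultimately show ?thesis by (simp add: compact_eq_bounded_closed)
  qed
  moreover have "interior S \<noteq> {}" using interior_mono[OF sub] C'(3) by auto
  moreover have "smooth_hypersurface (frontier S)"
  proof -
    obtain c0 where c0: "c0 \<in> interior C" using C'(3) by blast
    have c0_less: "\<phi> c0 < card B"
    proof -
      obtain r where r: "0 < r" "cball c0 r \<subseteq> C" using c0 by (meson mem_interior_cball)
      have "\<psi> c0 b < 1" if "b \<in> B" for b
      proof -
        have "c0 + r *\<^sub>R b \<in> C" using B(2)[OF that] r by (intro subsetD[OF r(2)]) (simp add: dist_norm)
        from support_fn_upper[OF C'(1) this, of b] have "c0 \<bullet> b + r \<le> ?h b"
          using B(2)[OF that] by (simp add: inner_add_left dot_square_norm)
        then show ?thesis using r(1) m(1) by (simp add: \<psi>_def mult_less_0_iff)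
      qed
      then have "\<phi> c0 < (\<Sum>b\<in>B. 1)" unfolding \<phi>_def by (intro sum_strict_mono B(1) \<open>B \<noteq> {}\<close>)
      then show ?thesis by simp
    qed
    \<comment> \<open>The point \<open>c0\<close> lies strictly below the level, so convexity
      forbids critical points of \<open>\<phi>\<close> on the frontier and on a neighbourhood of
      it.\<close>
    have Gpos: "0 < G x \<bullet> (x - c0)" if "\<phi> c0 < \<phi> x" for x
      using grad[of x c0] that by (simp add: inner_diff_right)
    have frontier: "frontier S = {x. \<phi> x = card B}"
    proof (intro equalityI subsetI)
      fix x assume x: "x \<in> frontier S"
      have "x \<in> S" using x frontier_subset_closed[OF compact_imp_closed[OF \<open>compact S\<close>]] by blast
      moreover have "\<not> \<phi> x < card B"
      proof
        assume "\<phi> x < card B"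
        moreover have "open {x. \<phi> x < card B}" by (intro open_Collect_less \<phi>c continuous_intros)
        moreover have "{x. \<phi> x < card B} \<subseteq> S" by (auto simp: S_def)
        ultimately have "x \<in> interior S" by (metis interiorI mem_Collect_eq)
        then show False using x by (simp add: frontier_def)
      qed
      ultimately show "x \<in> {x. \<phi> x = card B}" by (simp add: S_def)
    next
      fix x assume "x \<in> {x. \<phi> x = card B}"
      then have x: "\<phi> x = card B" by simp
      have "x \<notin> interior S"
      proof
        assume "x \<in> interior S"
        then obtain r where r: "0 < r" "cball x r \<subseteq> S" by (meson mem_interior_cball)
        define s where "s = r / (norm (x - c0) + 1)"
        have s: "0 < s" "s * norm (x - c0) \<le> r"
          using r(1) by (auto simp: s_def add_nonneg_pos divide_le_eq mult_left_mono)
        have "x + s *\<^sub>R (x - c0) \<in> S"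
          using s by (intro subsetD[OF r(2)]) (simp add: dist_norm)
        then have "\<phi> x + s * (G x \<bullet> (x - c0)) \<le> card B"
          using grad[of x "x + s *\<^sub>R (x - c0)"] by (simp add: S_def)
        moreover have "0 < s * (G x \<bullet> (x - c0))" using s(1) Gpos[of x] c0_less x by simp
        ultimately show False using x by simp
      qed
      moreover have "x \<in> S" using x by (simp add: S_def)
      ultimately show "x \<in> frontier S" using closure_subset by (auto simp: frontier_def)
    qed
    show ?thesis
      unfolding smooth_hypersurface_def
    proof (intro ballI exI conjI)
      fix x assume "x \<in> frontier S"
      let ?U = "{x. \<phi> c0 < \<phi> x}" and ?\<rho> = "\<lambda>x. \<phi> x + - real (card B)"
      show U: "open ?U" by (intro open_Collect_less \<phi>c continuous_intros)
      show "x \<in> ?U" using \<open>x \<in> frontier S\<close> c0_less by (simp add: frontier)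
      have "Ck_on k UNIV ?\<rho>" for k
        unfolding \<phi>_def \<psi>_def by (intro Ck_on_add Ck_on_sum Ck_on_exp_affine Ck_on_const open_UNIV)
      then show "smooth_on ?U ?\<rho>" unfolding smooth_on_def using Ck_on_subset by blast
      show "frontier S \<inter> ?U = {y \<in> ?U. ?\<rho> y = 0}" by (auto simp: frontier)
      show "frechet_derivative ?\<rho> (at y) \<noteq> (\<lambda>_. 0)" if "y \<in> ?U" for y
      proof -
        have "(?\<rho> has_derivative (\<lambda>v. G y \<bullet> v)) (at y)"
          using has_derivative_add[OF \<phi>d[of y] has_derivative_const[of "- real (card B)"]] by simp
        from frechet_derivative_at[OF this] have "frechet_derivative ?\<rho> (at y) (y - c0) = G y \<bullet> (y - c0)"
          by metis
        moreover have "0 < G y \<bullet> (y - c0)" using Gpos that by simp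
        ultimately show ?thesis by (metis less_irrefl)
      qed
    qed
  qed
  ultimately have "smooth_convex_body S" by (simp add: smooth_convex_body_def convex_body_def)
  then show thesis using that[OF _ sub supp] by blast
qed

section \<open>The Brunn-Minkowski inequality\<close>

lemma loop_fst_snd:
  assumes "loop y"
  shows "integral {0..1} (\<lambda>t. fst (y t)) = 0" "integral {0..1} (\<lambda>t. snd (y t)) = 0"
    and "continuous_on {0..1} (\<lambda>t. fst (y t))" "continuous_on {0..1} (\<lambda>t. snd (y t))"
proof -
  have yi: "y integrable_on {0..1}" by (intro integrable_continuous_real loop_continuous assms)
  show "integral {0..1} (\<lambda>t. fst (y t)) = 0" "integral {0..1} (\<lambda>t. snd (y t)) = 0"
    using integral_linear[OF yi bounded_linear_fst] integral_linear[OF yi bounded_linear_snd] assms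
    by (auto simp: o_def loop_def)
  show "continuous_on {0..1} (\<lambda>t. fst (y t))" "continuous_on {0..1} (\<lambda>t. snd (y t))"
    by (intro continuous_intros loop_continuous assms)+
qed

lemma support_fn_comp_continuous:
  assumes "compact S" "S \<noteq> {}" "continuous_on I u"
  shows "continuous_on I (\<lambda>t. support_fn S (u t))"
  by (rule continuous_on_compose2[OF continuous_on_support_fn[OF assms(1,2)] assms(3)]) simp

text \<open>Compare with \<open>p \<bullet> u\<close> for any point \<open>p\<close> of
  \<open>S\<close>; its integral vanishes. The support function itself may take negative values when
  the origin lies outside \<open>S\<close>.\<close>

lemma integral_support_fn_nonneg:
  fixes u :: "real \<Rightarrow> 'a::euclidean_space"
  assumes "compact S" "S \<noteq> {}" "continuous_on {0..1} u" "integral {0..1} u = 0"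
  shows "0 \<le> integral {0..1} (\<lambda>t. support_fn S (u t))"
proof -
  obtain p where "p \<in> S" using assms(2) by blast
  have ui: "u integrable_on {0..1}" by (intro integrable_continuous_real assms)
  have "integral {0..1} (\<lambda>t. p \<bullet> u t) \<le> integral {0..1} (\<lambda>t. support_fn S (u t))"
    by (intro integral_le support_fn_upper assms \<open>p \<in> S\<close> integrable_continuous_real continuous_intros
        support_fn_comp_continuous)
  then show ?thesis by (simp add: integral_inner_right[OF ui] assms(4))
qed

lemma c_EHZ_nonneg:
  assumes "smooth_convex_body S"
  shows "0 \<le> c_EHZ S"
proof -
  obtain y where "0 < act y" "c_EHZ S = (integral {0..1} (\<lambda>t. support_fn S (y t)))\<^sup>2 / (4 * act y)"
    by (rule c_EHZ_eq_length[OF assms]) blast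
  then show ?thesis by simp
qed

text \<open>Carries the upper bound over to bodies with corners: a smooth body around
  \<open>C\<close> lengthens the fixed loop by at most \<open>e\<close> times the integral of its
  norm, and \<open>e\<close> tends to 0.\<close>

lemma c_EHZ_ext_le_length:
  assumes C: "convex_body C"
    and y: "loop y" "\<And>t. t \<in> {0..1} \<Longrightarrow> y t \<noteq> 0" "0 < act y"
  shows "c_EHZ_ext C \<le> (integral {0..1} (\<lambda>t. support_fn C (y t)))\<^sup>2 / (4 * act y)"
proof -
  have C': "compact C" "C \<noteq> {}"
    using C interior_subset by (auto simp: convex_body_def)
  note yc = loop_continuous[OF y(1)]
  let ?L = "integral {0..1} (\<lambda>t. support_fn C (y t))" and ?M = "integral {0..1} (\<lambda>t. norm (y t))"
  have *: "c_EHZ_ext C \<le> (?L + e * ?M)\<^sup>2 / (4 * act y)" if e: "0 < e" for e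
  proof -
    obtain S where S: "smooth_convex_body S" "C \<subseteq> S" "\<And>y. support_fn S y \<le> support_fn C y + e * norm y"
      using exists_smooth_convex_body_approx[OF C e] by blast
    note S' = smooth_convex_bodyD[OF S(1)]
    have "c_EHZ_ext C \<le> c_EHZ S"
      unfolding c_EHZ_ext_def using S(1,2) c_EHZ_nonneg by (intro cInf_lower bdd_belowI[of _ 0]) auto
    also have "\<dots> \<le> (integral {0..1} (\<lambda>t. support_fn S (y t)))\<^sup>2 / (4 * act y)"
      by (rule c_EHZ_le_length[OF S(1) y])
    also have "\<dots> \<le> (?L + e * ?M)\<^sup>2 / (4 * act y)"
    proof (intro divide_right_mono power_mono)
      show "0 \<le> integral {0..1} (\<lambda>t. support_fn S (y t))"
        using y(1) by (intro integral_support_fn_nonneg S' yc) (simp add: loop_def)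
      have "integral {0..1} (\<lambda>t. support_fn S (y t)) \<le> integral {0..1} (\<lambda>t. support_fn C (y t) + e * norm (y t))"
        by (intro integral_le S(3) integrable_continuous_real continuous_intros support_fn_comp_continuous C' S' yc)
      also have "\<dots> = ?L + integral {0..1} (\<lambda>t. e * norm (y t))"
        by (intro Henstock_Kurzweil_Integration.integral_add integrable_continuous_real continuous_intros
            support_fn_comp_continuous C' yc)
      finally show "integral {0..1} (\<lambda>t. support_fn S (y t)) \<le> ?L + e * ?M" by simp
    qed (use y(3) in simp)
    finally show ?thesis .
  qed
  have "((\<lambda>e. (?L + e * ?M)\<^sup>2 / (4 * act y)) \<longlongrightarrow> (?L + 0 * ?M)\<^sup>2 / (4 * act y)) (at_right 0)"
    by (intro tendsto_intros) (use y(3) in simp)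
  moreover have "\<forall>\<^sub>F e in at_right 0. c_EHZ_ext C \<le> (?L + e * ?M)\<^sup>2 / (4 * act y)"
    using * by (auto simp: eventually_at_right_field intro!: exI[of _ 1])
  ultimately have "c_EHZ_ext C \<le> (?L + 0 * ?M)\<^sup>2 / (4 * act y)"
    by (rule tendsto_lowerbound) simp
  then show ?thesis by simp
qed

section \<open>Products and symplectic rescaling\<close>

lemma support_fn_Times:
  assumes "compact K" "compact T" "K \<noteq> {}" "T \<noteq> {}"
  shows "support_fn (K \<times> T) y = support_fn K (fst y) + support_fn T (snd y)"
proof (rule antisym)
  show "support_fn (K \<times> T) y \<le> support_fn K (fst y) + support_fn T (snd y)"
    using assms by (intro support_fn_least) (auto simp: inner_prod_def intro!: add_mono support_fn_upper)
  obtain a where a: "a \<in> K" "support_fn K (fst y) = a \<bullet> fst y" using support_fn_attained assms(1,3) .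
  obtain b where b: "b \<in> T" "support_fn T (snd y) = b \<bullet> snd y" using support_fn_attained assms(2,4) .
  show "support_fn K (fst y) + support_fn T (snd y) \<le> support_fn (K \<times> T) y"
    using support_fn_upper[OF compact_Times[OF assms(1,2)], of "(a, b)" y] a b by (simp add: inner_prod_def)
qed

text \<open>A linear symplectic map for \<open>l \<noteq> 0\<close>. It is applied to
  \<open>y\<close>, so the curve itself undergoes the inverse map, and the two factors cancel in the
  action.\<close>

definition squeeze :: "real \<Rightarrow> 'n::finite phase \<Rightarrow> 'n phase" where
  "squeeze l z = (l *\<^sub>R fst z, (1 / l) *\<^sub>R snd z)"

lemma bounded_linear_squeeze: "bounded_linear (squeeze l)"
  unfolding squeeze_def[abs_def]
  by (intro bounded_linear_Pair bounded_linear_compose[OF bounded_linear_scaleR_right]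
      bounded_linear_fst bounded_linear_snd)

lemma J_squeeze: "J (squeeze l z) = squeeze (1 / l) (J z)"
  by (simp add: squeeze_def J_def)

lemma
  assumes y: "loop y" and l: "l \<noteq> 0"
  shows loop_squeeze: "loop (\<lambda>t. squeeze l (y t))" and act_squeeze: "act (\<lambda>t. squeeze l (y t)) = act y"
proof -
  note yc = loop_continuous[OF y]
  have yi: "y integrable_on {0..1}" by (intro integrable_continuous_real yc)
  have "integral {0..1} (\<lambda>t. squeeze l (y t)) = squeeze l (integral {0..1} y)"
    using integral_linear[OF yi bounded_linear_squeeze] by (simp add: o_def)
  then show "loop (\<lambda>t. squeeze l (y t))"
    using y bounded_linear.continuous_on[OF bounded_linear_squeeze yc] by (simp add: loop_def squeeze_def zero_prod_def)
  have "((\<lambda>t. squeeze (1 / l) (prim y t)) has_vector_derivative J (squeeze l (y t))) (at t within {0..1})"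
    if "t \<in> {0..1}" for t
    unfolding J_squeeze
    by (rule bounded_linear.has_vector_derivative[OF bounded_linear_squeeze prim_has_vector_derivative[OF yc that]])
  then have prim: "prim (\<lambda>t. squeeze l (y t)) t = squeeze (1 / l) (prim y t)" if "t \<in> {0..1}" for t
    using prim_eqI[of "\<lambda>t. squeeze (1 / l) (prim y t)" "\<lambda>t. squeeze l (y t)" t] that
    by (simp add: prim_0 squeeze_def)
  have "squeeze (1 / l) a \<bullet> squeeze l b = a \<bullet> b" for a b :: "'a phase"
    using l by (simp add: squeeze_def inner_prod_def)
  then have "cross (\<lambda>t. squeeze l (y t)) (\<lambda>t. squeeze l (y t)) = cross y y"
    unfolding cross_def by (intro integral_cong) (simp add: prim)
  then show "act (\<lambda>t. squeeze l (y t)) = act y" by (simp add: act_def)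
qed

text \<open>Optimising the symplectic rescaling of the two factors makes the bound linear in \<open>K\<close>.\<close>

lemma \<xi>_le_product_length:
  assumes K: "convex_body K" and T: "convex_body T"
    and y: "loop y" "\<And>t. t \<in> {0..1} \<Longrightarrow> y t \<noteq> 0" "0 < act y"
  shows "\<xi> T K \<le> integral {0..1} (\<lambda>t. support_fn K (fst (y t))) * integral {0..1} (\<lambda>t. support_fn T (snd (y t)))
    / act y"
proof -
  have K': "compact K" "K \<noteq> {}" and T': "compact T" "T \<noteq> {}"
    using K T interior_subset by (auto simp: convex_body_def)
  have KT: "convex_body (K \<times> T)"
    using K T unfolding convex_body_def by (auto simp: compact_Times convex_Times interior_Times)
  note yf = loop_fst_snd[OF y(1)]
  let ?k = "integral {0..1} (\<lambda>t. support_fn K (fst (y t)))" and ?t = "integral {0..1} (\<lambda>t. support_fn T (snd (y t)))"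
  have k: "0 \<le> ?k" and t: "0 \<le> ?t" by (intro integral_support_fn_nonneg K' T' yf)+
  have scaled: "\<xi> T K \<le> (l * ?k + ?t / l)\<^sup>2 / (4 * act y)" if l: "0 < l" for l
  proof -
    have nz: "squeeze l (y t) \<noteq> 0" if "t \<in> {0..1}" for t
      using y(2)[OF that] l by (auto simp: squeeze_def prod_eq_iff)
    have "\<xi> T K \<le> (integral {0..1} (\<lambda>t. support_fn (K \<times> T) (squeeze l (y t))))\<^sup>2 / (4 * act (\<lambda>t. squeeze l (y t)))"
      unfolding \<xi>_def using l y(3)
      by (intro c_EHZ_ext_le_length KT loop_squeeze y nz) (simp_all add: act_squeeze[OF y(1)])
    also have "integral {0..1} (\<lambda>t. support_fn (K \<times> T) (squeeze l (y t)))
        = integral {0..1} (\<lambda>t. l * support_fn K (fst (y t)) + (1 / l) * support_fn T (snd (y t)))"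
      using l by (simp add: support_fn_Times[OF K'(1) T'(1) K'(2) T'(2)] squeeze_def
          support_fn_scaleR[OF K'] support_fn_scaleR[OF T'] del: times_divide_eq_left)
    also have "\<dots> = l * ?k + (1 / l) * ?t"
      unfolding integral_mult_right[symmetric]
      by (intro Henstock_Kurzweil_Integration.integral_add integrable_continuous_real continuous_intros
          support_fn_comp_continuous K' T' yf)
    finally show ?thesis using l by (simp add: act_squeeze[OF y(1)])
  qed
  have *: "\<xi> T K \<le> (?k + e) * (?t + e) / act y" if e: "0 < e" for e
  proof -
    \<comment> \<open>Balances the two terms, \<open>l * k = t / l\<close>, which is equality in the
      arithmetic-geometric inequality. The shift by \<open>e\<close> keeps \<open>l\<close> defined
      and positive when an integral vanishes.\<close>
    define l where "l = sqrt ((?t + e) / (?k + e))"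
    have pos: "0 < ?k + e" "0 < ?t + e" using k t e by auto
    then have l: "0 < l" by (simp add: l_def)
    have l2: "l * l * (?k + e) = ?t + e" using pos by (simp add: l_def)
    have "\<xi> T K \<le> (l * ?k + ?t / l)\<^sup>2 / (4 * act y)" by (rule scaled[OF l])
    also have "\<dots> \<le> (l * (?k + e) + (?t + e) / l)\<^sup>2 / (4 * act y)"
      using l e k t y(3) by (intro divide_right_mono power_mono add_mono mult_left_mono) auto
    also have "(?t + e) / l = l * (?k + e)" using l l2 by (simp add: field_simps)
    also have "(l * (?k + e) + l * (?k + e))\<^sup>2 / (4 * act y) = (?k + e) * (l * l * (?k + e)) / act y"
      by (simp add: power2_eq_square)
    finally show ?thesis by (simp only: l2)
  qed
  have "((\<lambda>e. (?k + e) * (?t + e) / act y) \<longlongrightarrow> (?k + 0) * (?t + 0) / act y) (at_right 0)"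
    by (intro tendsto_intros) (use y(3) in simp)
  moreover have "\<forall>\<^sub>F e in at_right 0. \<xi> T K \<le> (?k + e) * (?t + e) / act y"
    using * by (auto simp: eventually_at_right_field intro!: exI[of _ 1])
  ultimately have "\<xi> T K \<le> (?k + 0) * (?t + 0) / act y"
    by (rule tendsto_lowerbound) simp
  then show ?thesis by simp
qed

lemma exists_smooth_convex_body_superset:
  assumes "bounded (C :: 'a::euclidean_space set)"
  obtains S where "smooth_convex_body S" "C \<subseteq> S"
proof -
  obtain R where R: "0 < R" "C \<subseteq> cball 0 R"
    using assms unfolding bounded_pos by (auto simp: subset_iff)
  then have "convex_body (cball (0::'a) R)" by (simp add: convex_body_def)
  then show thesis using exists_smooth_convex_body_approx[of "cball 0 R" 1] R(2) that by (metis order_trans zero_less_one)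
qed

theorem mainTheorem6:
  fixes K1 K2 T :: "(real ^ 'n::finite) set"
  assumes "smooth_strictly_convex_body K1"
    and "smooth_strictly_convex_body K2"
    and "smooth_strictly_convex_body T"
  shows "\<xi> T {a + b | a b. a \<in> K1 \<and> b \<in> K2} \<ge> \<xi> T K1 + \<xi> T K2"
proof -
  let ?K = "{a + b | a b. a \<in> K1 \<and> b \<in> K2}"
  have body: "convex_body K1" "convex_body K2" "convex_body T"
    using assms by (auto simp: smooth_strictly_convex_body_def smooth_convex_body_def)
  then have cpt: "compact K1" "compact K2" "compact T" and ne: "K1 \<noteq> {}" "K2 \<noteq> {}" "T \<noteq> {}"
    using interior_subset by (auto simp: convex_body_def)
  \<comment> \<open>A minimising loop of \<open>S\<close> serves as test loop for both products at
    once, so the common factors \<open>\<tau>\<close> and \<open>act y\<close> allow the two bounds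
    to be added.\<close>
  have "\<xi> T K1 + \<xi> T K2 \<le> c_EHZ S" if S: "?K \<times> T \<subseteq> S" "smooth_convex_body S" for S
  proof -
    note S' = smooth_convex_bodyD[OF S(2)]
    obtain y where y: "loop y" "\<And>t. t \<in> {0..1} \<Longrightarrow> y t \<noteq> 0" "0 < act y"
      and c: "c_EHZ S = (integral {0..1} (\<lambda>t. support_fn S (y t)))\<^sup>2 / (4 * act y)"
      by (rule c_EHZ_eq_length[OF S(2)]) blast
    note yf = loop_fst_snd[OF y(1)]
    define k1 where "k1 = integral {0..1} (\<lambda>t. support_fn K1 (fst (y t)))"
    define k2 where "k2 = integral {0..1} (\<lambda>t. support_fn K2 (fst (y t)))"
    define \<tau> where "\<tau> = integral {0..1} (\<lambda>t. support_fn T (snd (y t)))"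
    have nonneg: "0 \<le> k1" "0 \<le> k2" "0 \<le> \<tau>"
      unfolding k1_def k2_def \<tau>_def by (intro integral_support_fn_nonneg cpt ne yf)+
    have pt: "support_fn K1 (fst z) + support_fn K2 (fst z) + support_fn T (snd z) \<le> support_fn S z" for z
    proof -
      obtain a where a: "a \<in> K1" "support_fn K1 (fst z) = a \<bullet> fst z" using support_fn_attained cpt(1) ne(1) .
      obtain b where b: "b \<in> K2" "support_fn K2 (fst z) = b \<bullet> fst z" using support_fn_attained cpt(2) ne(2) .
      obtain d where d: "d \<in> T" "support_fn T (snd z) = d \<bullet> snd z" using support_fn_attained cpt(3) ne(3) .
      have "(a + b, d) \<in> S" using a(1) b(1) d(1) by (intro subsetD[OF S(1)]) blast
      from support_fn_upper[OF S'(1) this, of z] show ?thesis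
        by (simp add: a(2) b(2) d(2) inner_prod_def inner_add_left)
    qed
    note cont = support_fn_comp_continuous[OF cpt(1) ne(1) yf(3)] support_fn_comp_continuous[OF cpt(2) ne(2) yf(3)]
      support_fn_comp_continuous[OF cpt(3) ne(3) yf(4)]
    have "k1 + k2 + \<tau> = integral {0..1} (\<lambda>t. support_fn K1 (fst (y t)) + support_fn K2 (fst (y t)) + support_fn T (snd (y t)))"
      unfolding k1_def k2_def \<tau>_def
      by (simp add: Henstock_Kurzweil_Integration.integral_add integrable_continuous_real cont continuous_on_add)
    also have "\<dots> \<le> integral {0..1} (\<lambda>t. support_fn S (y t))"
      by (intro integral_le pt integrable_continuous_real continuous_on_add cont
          support_fn_comp_continuous S' loop_continuous y)
    finally have le: "k1 + k2 + \<tau> \<le> integral {0..1} (\<lambda>t. support_fn S (y t))" .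
    have "\<xi> T K1 + \<xi> T K2 \<le> k1 * \<tau> / act y + k2 * \<tau> / act y"
      unfolding k1_def k2_def \<tau>_def by (intro add_mono \<xi>_le_product_length body y)
    also have "\<dots> = (4 * ((k1 + k2) * \<tau>)) / (4 * act y)" by (simp add: add_divide_distrib distrib_right)
    \<comment> \<open>Arithmetic-geometric inequality for \<open>k1 + k2\<close> and
      \<open>\<tau>\<close>: it undoes the optimised rescaling, returning from the product of
      lengths to the squared total length.\<close>
    also have "\<dots> \<le> (k1 + k2 + \<tau>)\<^sup>2 / (4 * act y)"
    proof (rule divide_right_mono)
      have "0 \<le> (k1 + k2 - \<tau>)\<^sup>2" by simp
      then show "4 * ((k1 + k2) * \<tau>) \<le> (k1 + k2 + \<tau>)\<^sup>2" by (simp add: power2_eq_square algebra_simps)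
    qed (use y(3) in simp)
    also have "\<dots> \<le> c_EHZ S"
      unfolding c using le nonneg y(3) by (intro divide_right_mono power_mono) auto
    finally show ?thesis .
  qed
  \<comment> \<open>The real \<open>Inf\<close> of an empty set carries no information, so a
    competitor has to be exhibited before passing to the greatest lower bound.\<close>
  moreover have "{c_EHZ S |S. ?K \<times> T \<subseteq> S \<and> smooth_convex_body S} \<noteq> {}"
  proof -
    have "bounded (?K \<times> T)"
      using compact_sums[OF cpt(1,2)] cpt(3) by (intro compact_imp_bounded compact_Times)
    then obtain S where "smooth_convex_body S" "?K \<times> T \<subseteq> S"
      by (rule exists_smooth_convex_body_superset)
    then have "c_EHZ S \<in> {c_EHZ S |S. ?K \<times> T \<subseteq> S \<and> smooth_convex_body S}"
      by (intro CollectI exI[of _ S] conjI refl)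
    then show ?thesis by (metis empty_iff)
  qed
  ultimately show ?thesis
    unfolding \<xi>_def c_EHZ_ext_def[of "?K \<times> T"] by (intro cInf_greatest) (auto simp: \<xi>_def)
qed

end
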